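(* Let $\mathbb{M}$ be the multi operator-stable ISRM described in the context, with $\mathcal{I}(\mathbb{M})$, $I(f)$, $\tau_s$, $H(f,\lambda)$, $a$, $b$ as there. Let $C_3,C_4>0$ be constants with $C_3\min\{\|x\|^a,\|x\|^b\}\le\tau_s(x)\le C_4\max\{\|x\|^a,\|x\|^b\}$ for all $s\in S$, $x\in\mathbb{R}^m$ (such constants exist). Elements of $\mathcal{I}(\mathbb{M})$ that agree $\nu$-a.e. are identified. (a) $$\mathcal{I}(\mathbb{M})=\{f:S\to \mathrm{L}(\mathbb{R}^m)\text{ measurable}: H(f,\lambda)<\infty\text{ for all }\lambda>0\}=\{f:S\to \mathrm{L}(\mathbb{R}^m)\text{ measurable}: H(f,\lambda)<\infty\text{ for some }\lambda>0\}.$$ (b) $\|f\|_{\mathbb{M}}:=\inf\{\lambda>0:H(f,\lambda)\le1\}$ defines a quasi-norm on $\mathcal{I}(\mathbb{M})$. Moreover, for all $f\in\mathcal{I}(\mathbb{M})$ and $\lambda>0$, $$C_3\min\Big\{\Big(\tfrac{\|f\|_{\mathbb{M}}}{\lambda}\Big)^a,\Big(\tfrac{\|f\|_{\mathbb{M}}}{\lambda}\Big)^b\Big\}\le H(f,\lambda)\le C_4\max\Big\{\Big(\tfrac{\|f\|_{\mathbb{M}}}{\lambda}\Big)^a,\Big(\tfrac{\|f\|_{\mathbb{M}}}{\lambda}\Big)^b\Big\}.$$ (c) There exists $L_1\ge1$ such that $\mathbb{P}(\|I(f)\|\ge\delta)\le L_1H(f,\delta)$ for all $f\in\mathcal{I}(\mathbb{M})$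 and $\delta>0$. Additionally, if $0<p<a$, there exists a constant $L_2=L_2(p)>0$ such that $\mathbb{E}(\|I(f)\|^p)\le L_2\|f\|_{\mathbb{M}}^p$ for all $f\in\mathcal{I}(\mathbb{M})$. (d) The vector space $\mathcal{I}(\mathbb{M})$ is complete with respect to $\|\cdot\|_{\mathbb{M}}$ and, for $f,f_1,f_2,\ldots\in\mathcal{I}(\mathbb{M})$, $$I(f_n)\to I(f)\text{ in probability}\iff\|f_n-f\|_{\mathbb{M}}\to0.$$
   Context: Notation: $m\ge 1$; $\mathrm{L}(\mathbb{R}^m)$ is the set of linear operators on $\mathbb{R}^m$ ($m\times m$ matrices); $\|\cdot\|$ is the Euclidean norm and the operator norm, $\|\cdot\|_\infty$ the supremum norm on $\mathbb{R}^m$, $D^*$ the adjoint; $r^D=\exp((\ln r)D)$ for $r>0$. For $D\in \mathrm{L}(\mathbb{R}^m)$, $\lambda_D$ and $\Lambda_D$ are the minimum and maximum of the real parts of the eigenvalues of $D$; $Q(\mathbb{R}^m):=\{D:\lambda_D>0\}$. Setting: $(S,\Sigma,\nu)$ is a $\sigma$-finite measure space. For each $s\in S$, $B(s)\in Q(\mathbb{R}^m)$ is symmetric, $s\mapsto B(s)$ is measurable, and with $\lambda(s):=\lambda_{B(s)}$, $\Lambda(s):=\Lambda_{B(s)}$ one has $1/2<\inf_{s}\lambda(s)\le\sup_{s}\Lambda(s)<\infty$. Put $a:=\inf_s\Lambda(s)^{-1}$, $b:=\sup_s\lambda(s)^{-1}$, so $0<a\le b<2$. $\sigma$ is a finite symmetric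 Borel measure on the Euclidean unit sphere $S^{m-1}$ whose support spans $\mathbb{R}^m$. For $s\in S$, Borel $C\subset\mathbb{R}^m$, $$\varphi(s,C):=\int_0^\infty\int_{S^{m-1}}\mathbf 1_C(r^{B(s)}\theta)\,r^{-2}\,\sigma(d\theta)\,dr,\qquad \psi_s(u):=\int_{\mathbb{R}^m}(\cos\langle x,u\rangle-1)\,\varphi(s,dx).$$ Random measure: $\mathcal{S}:=\{A\in\Sigma:\nu(A)<\infty\}$. $\mathbb{M}=\{M(A):A\in\mathcal{S}\}$ is the multi operator-stable independently scattered random measure (ISRM): the $M(A)$ are $\mathbb{R}^m$-valued random vectors on one probability space, independent for pairwise disjoint sets, a.s. $\sigma$-additive over disjoint unions lying in $\mathcal{S}$, and $M(A)$ has characteristic function $u\mapsto\exp(\int_A\psi_s(u)\,\nu(ds))$. Integral: for simple $f=\sum_jR_j\mathbf 1_{A_j}$ (finite sum, $R_j\in \mathrm{L}(\mathbb{R}^m)$, $A_j\in\mathcal{S}$ disjoint), $I(f):=\sum_jR_jM(A_j)$. A measurable $f:S\to \mathrm{L}(\mathbb{R}^m)$ is integrable, $f\in\mathcal{I}(\mathbb{M})$, if there are simple $f_n\to f$ $\nu$-a.e. such that $I(f_n\mathbf 1_A)$ converges in probability for every $A\in\Sigma$; then $I(f)=\int_Sf\,d\mathbb{M}$ is the limit in probability of $I(f_n)$. $\mathcal{I}(\mathbb{M})$ is a real vector space and $I$ is linear; random vectors equal a.s. are identified. Polar coordinates: for $x\ne0$, $\tau_s(x)>0$ is the unique number such that $x=\tau_s(x)^{B(s)}\theta$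 with $\theta\in S^{m-1}$ (since $B(s)$ is symmetric with positive eigenvalues, $(r,\theta)\mapsto r^{B(s)}\theta$ is a homeomorphism $(0,\infty)\times S^{m-1}\to\mathbb{R}^m\setminus\{0\}$); $\tau_s(0):=0$. For measurable $f:S\to \mathrm{L}(\mathbb{R}^m)$ and $\lambda>0$, $$H(f,\lambda):=\int_S\sup_{\|u\|_\infty\le\lambda^{-1}}\tau_s(f(s)^*u)\,\nu(ds)\in[0,\infty].$$ A quasi-norm has all properties of a norm, except that the triangle inequality is weakened to: there is $T\ge1$ with $\|f_1+f_2\|\le T(\|f_1\|+\|f_2\|)$ for all $f_1,f_2$. *)

theory Defs
  imports "HOL-Probability.Probability"
begin

section \<open>Linear operators on \<open>\<real>\<^sup>m\<close>, represented as matrices\<close>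

text \<open>The multiplication on \<open>real^'m^'m\<close> supplied by the type class instances is componentwise,
  so powers and the exponential series are built from the matrix product \<open>**\<close>.\<close>

primrec matpow :: "real^'m^'m \<Rightarrow> nat \<Rightarrow> real^'m^'m" where
  "matpow A 0 = mat 1"
| "matpow A (Suc k) = A ** matpow A k"

definition mat_exp :: "real^'m^'m \<Rightarrow> real^'m^'m" where
  "mat_exp A = (\<Sum>k. (1 / fact k) *\<^sub>R matpow A k)"

definition mat_powr :: "real \<Rightarrow> real^'m^'m \<Rightarrow> real^'m^'m" where
  "mat_powr r D = mat_exp (ln r *\<^sub>R D)"

definition eigvals :: "real^'m^'m \<Rightarrow> complex set" where
  "eigvals D = {c. \<exists>v::complex^'m. v \<noteq> 0 \<and> (\<chi> i j. complex_of_real (D $ i $ j)) *v v = c *s v}"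

definition lam_min :: "real^'m^'m \<Rightarrow> real" where
  "lam_min D = Min (Re ` eigvals D)"

definition lam_max :: "real^'m^'m \<Rightarrow> real" where
  "lam_max D = Max (Re ` eigvals D)"

definition Q_ops :: "(real^'m^'m) set" where
  "Q_ops = {D. lam_min D > 0}"


section \<open>The spectral measure, the Levy measures and their exponents\<close>

definition msupport :: "'a::topological_space measure \<Rightarrow> 'a set" where
  "msupport \<sigma> = {x \<in> space \<sigma>. \<forall>U. open U \<longrightarrow> x \<in> U \<longrightarrow> emeasure \<sigma> (U \<inter> space \<sigma>) > 0}"

definition spectral_measure :: "(real^'m) measure \<Rightarrow> bool" where
  "spectral_measure \<sigma> \<longleftrightarrow>
     sets \<sigma> = sets (restrict_space borel (sphere 0 1)) \<and>
     finite_measure \<sigma> \<and>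
     (\<forall>C\<in>sets \<sigma>. emeasure \<sigma> (uminus ` C) = emeasure \<sigma> C) \<and>
     span (msupport \<sigma>) = UNIV"

definition levy_measure :: "(real^'m) measure \<Rightarrow> real^'m^'m \<Rightarrow> (real^'m) measure" where
  "levy_measure \<sigma> D = measure_of UNIV (sets borel)
     (\<lambda>C. \<integral>\<^sup>+ r\<in>{0<..}. ((\<integral>\<^sup>+ \<theta>. indicator C (mat_powr r D *v \<theta>) \<partial>\<sigma>) * ennreal (1 / r\<^sup>2)) \<partial>lborel)"

definition levy_exponent :: "(real^'m) measure \<Rightarrow> real^'m^'m \<Rightarrow> real^'m \<Rightarrow> real" where
  "levy_exponent \<sigma> D u = (\<integral>x. (cos (x \<bullet> u) - 1) \<partial>levy_measure \<sigma> D)"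


section \<open>The multi operator-stable independently scattered random measure\<close>

definition fin_sets :: "'s measure \<Rightarrow> 's set set" where
  "fin_sets \<nu> = {A \<in> sets \<nu>. emeasure \<nu> A < \<infinity>}"

text \<open>Finite disjoint families are covered by the sequences below, extended by empty sets.\<close>

definition multi_os_isrm ::
  "'s measure \<Rightarrow> ('s \<Rightarrow> real^'m^'m) \<Rightarrow> (real^'m) measure \<Rightarrow> 'w measure \<Rightarrow> ('s set \<Rightarrow> 'w \<Rightarrow> real^'m) \<Rightarrow> bool" where
  "multi_os_isrm \<nu> B \<sigma> P M \<longleftrightarrow>
     prob_space P \<and>
     (\<forall>A\<in>fin_sets \<nu>. M A \<in> borel_measurable P) \<and>
     (\<forall>A::nat \<Rightarrow> 's set. range A \<subseteq> fin_sets \<nu> \<longrightarrow> disjoint_family A \<longrightarrow>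
        prob_space.indep_vars P (\<lambda>_. borel) (\<lambda>i. M (A i)) UNIV) \<and>
     (\<forall>A::nat \<Rightarrow> 's set. range A \<subseteq> fin_sets \<nu> \<longrightarrow> disjoint_family A \<longrightarrow> (\<Union>i. A i) \<in> fin_sets \<nu> \<longrightarrow>
        (AE \<omega> in P. (\<lambda>i. M (A i) \<omega>) sums M (\<Union>i. A i) \<omega>)) \<and>
     (\<forall>A\<in>fin_sets \<nu>. \<forall>u. (\<integral>\<omega>. iexp (u \<bullet> M A \<omega>) \<partial>P)
        = complex_of_real (exp (LINT s:A|\<nu>. levy_exponent \<sigma> (B s) u)))"


section \<open>The stochastic integral\<close>

definition conv_in_prob ::
  "'w measure \<Rightarrow> (nat \<Rightarrow> 'w \<Rightarrow> 'a::real_normed_vector) \<Rightarrow> ('w \<Rightarrow> 'a) \<Rightarrow> bool" where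
  "conv_in_prob P X Y \<longleftrightarrow>
     (\<forall>\<epsilon>>0. (\<lambda>n. measure P {\<omega>\<in>space P. norm (X n \<omega> - Y \<omega>) \<ge> \<epsilon>}) \<longlonglongrightarrow> 0)"

definition simple_rep ::
  "'s measure \<Rightarrow> ('s \<Rightarrow> real^'m^'m) \<Rightarrow> nat \<Rightarrow> (nat \<Rightarrow> real^'m^'m) \<Rightarrow> (nat \<Rightarrow> 's set) \<Rightarrow> bool" where
  "simple_rep \<nu> f n R A \<longleftrightarrow>
     (\<forall>j<n. A j \<in> fin_sets \<nu>) \<and> disjoint_family_on A {..<n} \<and>
     (\<forall>s\<in>space \<nu>. f s = (\<Sum>j<n. indicat_real (A j) s *\<^sub>R R j))"

definition simple_fn :: "'s measure \<Rightarrow> ('s \<Rightarrow> real^'m^'m) \<Rightarrow> bool" where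
  "simple_fn \<nu> f \<longleftrightarrow> (\<exists>n R A. simple_rep \<nu> f n R A)"

text \<open>Both integrals below are determined only up to almost sure equality (different
  representations, resp. approximating sequences, give almost surely equal random vectors);
  \<open>SOME\<close> picks a version.\<close>

definition simple_integral ::
  "'s measure \<Rightarrow> ('s set \<Rightarrow> 'w \<Rightarrow> real^'m) \<Rightarrow> ('s \<Rightarrow> real^'m^'m) \<Rightarrow> 'w \<Rightarrow> real^'m" where
  "simple_integral \<nu> M f =
     (SOME X. \<exists>n R A. simple_rep \<nu> f n R A \<and> X = (\<lambda>\<omega>. \<Sum>j<n. R j *v M (A j) \<omega>))"

definition approx_seq ::
  "'s measure \<Rightarrow> 'w measure \<Rightarrow> ('s set \<Rightarrow> 'w \<Rightarrow> real^'m) \<Rightarrow> ('s \<Rightarrow> real^'m^'m)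
     \<Rightarrow> (nat \<Rightarrow> 's \<Rightarrow> real^'m^'m) \<Rightarrow> bool" where
  "approx_seq \<nu> P M f F \<longleftrightarrow>
     (\<forall>n. simple_fn \<nu> (F n)) \<and>
     (AE s in \<nu>. (\<lambda>n. F n s) \<longlonglongrightarrow> f s) \<and>
     (\<forall>A\<in>sets \<nu>. \<exists>X\<in>borel_measurable P.
        conv_in_prob P (\<lambda>n. simple_integral \<nu> M (\<lambda>s. indicat_real A s *\<^sub>R F n s)) X)"

definition integrable_fns ::
  "'s measure \<Rightarrow> 'w measure \<Rightarrow> ('s set \<Rightarrow> 'w \<Rightarrow> real^'m) \<Rightarrow> ('s \<Rightarrow> real^'m^'m) set" where
  "integrable_fns \<nu> P M = {f \<in> borel_measurable \<nu>. \<exists>F. approx_seq \<nu> P M f F}"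

definition stoch_integral ::
  "'s measure \<Rightarrow> 'w measure \<Rightarrow> ('s set \<Rightarrow> 'w \<Rightarrow> real^'m) \<Rightarrow> ('s \<Rightarrow> real^'m^'m) \<Rightarrow> 'w \<Rightarrow> real^'m" where
  "stoch_integral \<nu> P M f =
     (SOME X. X \<in> borel_measurable P \<and>
        (\<exists>F. approx_seq \<nu> P M f F \<and> conv_in_prob P (\<lambda>n. simple_integral \<nu> M (F n)) X))"


section \<open>Generalized polar coordinates and the quasi-norm\<close>

definition tau :: "real^'m^'m \<Rightarrow> real^'m \<Rightarrow> real" where
  "tau D x = (if x = 0 then 0
     else (THE t. t > 0 \<and> (\<exists>\<theta>\<in>sphere 0 1. x = mat_powr t D *v \<theta>)))"

definition Hfun ::
  "'s measure \<Rightarrow> ('s \<Rightarrow> real^'m^'m) \<Rightarrow> ('s \<Rightarrow> real^'m^'m) \<Rightarrow> real \<Rightarrow> ennreal" where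
  "Hfun \<nu> B f l =
     (\<integral>\<^sup>+ s. (SUP u\<in>{u. infnorm u \<le> 1 / l}. ennreal (tau (B s) (transpose (f s) *v u))) \<partial>\<nu>)"

definition Mnorm :: "'s measure \<Rightarrow> ('s \<Rightarrow> real^'m^'m) \<Rightarrow> ('s \<Rightarrow> real^'m^'m) \<Rightarrow> real" where
  "Mnorm \<nu> B f = Inf {l. l > 0 \<and> Hfun \<nu> B f l \<le> 1}"

text \<open>A quasi-norm on the vector space of \<open>\<nu>\<close>-a.e. classes of the functions in \<open>V\<close>,
  expressed on representatives.\<close>

definition quasi_norm_ae ::
  "'s measure \<Rightarrow> ('s \<Rightarrow> 'b::real_normed_vector) set \<Rightarrow> (('s \<Rightarrow> 'b) \<Rightarrow> real) \<Rightarrow> bool" where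
  "quasi_norm_ae \<nu> V N \<longleftrightarrow>
     (\<lambda>s. 0) \<in> V \<and>
     (\<forall>f\<in>V. \<forall>g\<in>V. (\<lambda>s. f s + g s) \<in> V) \<and>
     (\<forall>c. \<forall>f\<in>V. (\<lambda>s. c *\<^sub>R f s) \<in> V) \<and>
     (\<forall>f\<in>V. \<forall>g\<in>V. (AE s in \<nu>. f s = g s) \<longrightarrow> N f = N g) \<and>
     (\<forall>f\<in>V. N f \<ge> 0) \<and>
     (\<forall>f\<in>V. N f = 0 \<longleftrightarrow> (AE s in \<nu>. f s = 0)) \<and>
     (\<forall>c. \<forall>f\<in>V. N (\<lambda>s. c *\<^sub>R f s) = \<bar>c\<bar> * N f) \<and>
     (\<exists>T\<ge>1. \<forall>f\<in>V. \<forall>g\<in>V. N (\<lambda>s. f s + g s) \<le> T * (N f + N g))"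

definition quasi_complete :: "('s \<Rightarrow> 'b::real_normed_vector) set \<Rightarrow> (('s \<Rightarrow> 'b) \<Rightarrow> real) \<Rightarrow> bool" where
  "quasi_complete V N \<longleftrightarrow>
     (\<forall>F. (\<forall>n. F n \<in> V) \<longrightarrow>
        (\<forall>\<epsilon>>0. \<exists>k::nat. \<forall>m\<ge>k. \<forall>n\<ge>k. N (\<lambda>s. F m s - F n s) < \<epsilon>) \<longrightarrow>
        (\<exists>f\<in>V. (\<lambda>n. N (\<lambda>s. F n s - f s)) \<longlonglongrightarrow> 0))"

end

theory Submission
  imports Defs
begin

text \<open>
  Write \<open>G\<^sub>s(A)\<close> for the supremum of \<open>\<tau>\<^sub>s(A\<^sup>Tu)\<close> over the unit cube, so that \<open>H(f, l)\<close> is the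
  integral of \<open>G\<^sub>s(f(s) / l)\<close>.  The theorem holds because \<open>H\<close> is the modular of a space of
  Musielak-Orlicz type, and because this modular controls the random integral in probability from
  above and from below.

  The modular.  A symmetric \<open>B(s)\<close> is diagonal in an orthonormal basis, where \<open>r\<^sup>B\<close> acts by the powers
  \<open>r\<^sup>\<mu>\<close>, and all eigenvalues \<open>\<mu>\<close> of all \<open>B(s)\<close> lie in \<open>[1/b, 1/a]\<close>.  For \<open>t > 0\<close> the inequality
  \<open>\<tau>\<^sub>s(x) \<le> t\<close> means that \<open>t\<close> to the power \<open>-B(s)\<close> maps \<open>x\<close> into the unit ball (\<open>tau_le_iff\<close>).
  Hence multiplying \<open>x\<close> by \<open>c \<ge> 1\<close> multiplies \<open>\<tau>\<^sub>s(x)\<close> by a factor between \<open>c\<^sup>a\<close> and \<open>c\<^sup>b\<close>, and \<open>\<tau>\<^sub>s\<close>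
  satisfies a triangle inequality up to a constant.  Both properties pass to \<open>G\<^sub>s\<close>
  (\<open>scaling_modular_box_gauge\<close>).  The locale \<open>scaling_modular\<close> derives from properties of this kind
  the quasi-norm, the two-sided estimate of \<open>H\<close> by powers of the quasi-norm, completeness, and the
  density of simple functions.  The two-sided estimate comes out with constant 1, and
  \<open>C\<^sub>3 \<le> 1 \<le> C\<^sub>4\<close> because \<open>\<tau>\<^sub>s\<close> equals 1 on the unit sphere.

  The control of the integral.  The exponent \<open>-\<psi>\<^sub>s\<close> lies between two multiples of \<open>\<tau>\<^sub>s\<close>
  (\<open>levy_nn_upper\<close>, \<open>levy_nn_lower\<close>): the upper bound uses \<open>b < 2\<close>, the lower one that the support
  of \<open>\<sigma>\<close> spans.  For a simple function \<open>F\<close> the characteristic function of \<open>I(F)\<close> at \<open>u\<close> is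
  \<open>exp(-\<Psi>(u))\<close>, where \<open>\<Psi>(u)\<close> is the integral of \<open>-\<psi>\<^sub>s(F(s)\<^sup>Tu)\<close>.  Therefore \<open>\<Psi>(u)\<close> is at most a multiple
  of \<open>H(F, l)\<close> for \<open>u\<close> in the cube of half-width \<open>1/l\<close>, and \<open>H(F, l)\<close> is at most a multiple of the sum of the
  \<open>\<Psi>(e\<^sub>i / l)\<close> over the coordinate vectors.  The first bound yields
  the tail estimate for \<open>I(F)\<close> (\<open>simple_integral_tail\<close>); the second one shows that \<open>F\<close> is small in the
  quasi-norm as soon as \<open>I(F)\<close> is small in probability (\<open>simple_integral_small_imp_N_small\<close>).

  So for simple functions being Cauchy in probability and being Cauchy in the quasi-norm are the
  same.  Density and Fatou's lemma then identify the integrable functions with the modular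
  space (\<open>integrable_fns_eq\<close>), and both estimates survive the passage to the limit.  The moment
  bound is the tail estimate summed over dyadic shells, where \<open>p < a\<close> gives convergence.\<close>


section \<open>Spectral calculus of symmetric matrices\<close>

lemma inner_matrix_vector_transpose:
  fixes A :: "real^'n^'m"
  shows "(A *v x) \<bullet> y = x \<bullet> (transpose A *v y)"
  by (metis dot_lmul_matrix inner_commute transpose_matrix_vector)

text \<open>First-order optimality: near \<open>t = 0\<close> the linear term would win.\<close>

lemma quadratic_bound_imp_linear_zero:
  fixes c d :: real
  assumes "\<And>t. 2 * t * c + t\<^sup>2 * d \<le> 0"
  shows "c = 0"
proof (rule ccontr)
  assume "c \<noteq> 0"
  \<comment> \<open>small enough for the linear term to dominate the quadratic one\<close>
  define t where "t = c / (\<bar>d\<bar> + 1)"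
  have "t * c = (\<bar>d\<bar> + 1) * t\<^sup>2" by (simp add: t_def power2_eq_square)
  then have "2 * t * c + t\<^sup>2 * d = t\<^sup>2 * (2 * (\<bar>d\<bar> + 1) + d)" by (simp add: algebra_simps)
  moreover have "t\<^sup>2 > 0" using \<open>c \<noteq> 0\<close> by (simp add: t_def)
  moreover have "2 * (\<bar>d\<bar> + 1) + d > 0" using abs_ge_minus_self[of d] abs_ge_zero[of d] by argo
  ultimately show False using assms[of t] by (metis mult_pos_pos not_less)
qed

text \<open>A maximizer of the quadratic form on the unit sphere of \<open>V\<close>: perturbing it in a direction \<open>v\<close> of \<open>V\<close>
  and comparing first-order terms shows that \<open>D e - \<mu> e\<close>, which lies in \<open>V\<close>, is orthogonal to \<open>V\<close>.\<close>

lemma symmetric_matrix_eigenvector: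
  fixes D :: "real^'m^'m"
  assumes sym: "transpose D = D" and V: "subspace V" "\<And>v. v \<in> V \<Longrightarrow> D *v v \<in> V" and "V \<noteq> {0}"
  obtains e \<mu> where "e \<in> V" "norm e = 1" "D *v e = \<mu> *\<^sub>R e"
proof -
  let ?S = "V \<inter> sphere 0 1"
  obtain w where w: "w \<in> V" "w \<noteq> 0" using assms(4) subspace_0[OF V(1)] by auto
  have "(1 / norm w) *\<^sub>R w \<in> ?S" using w subspace_scale[OF V(1)] by simp
  then have ne: "?S \<noteq> {}" by blast
  have comp: "compact ?S" using closed_subspace[OF V(1)] by (simp add: closed_Int_compact)
  have cont: "continuous_on ?S (\<lambda>x. x \<bullet> (D *v x))"
    by (intro continuous_intros)
  obtain e where e: "e \<in> ?S" and max: "\<And>x. x \<in> ?S \<Longrightarrow> x \<bullet> (D *v x) \<le> e \<bullet> (D *v e)"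
    using continuous_attains_sup[OF comp ne cont] by blast
  define \<mu> where "\<mu> = e \<bullet> (D *v e)"
  have max': "x \<bullet> (D *v x) \<le> \<mu> * (x \<bullet> x)" if x: "x \<in> V" for x
  proof (cases "x = 0")
    case False
    have "(1 / norm x) *\<^sub>R x \<in> ?S" using x False subspace_scale[OF V(1)] by simp
    from max[OF this] have "(1 / norm x) * ((1 / norm x) * (x \<bullet> (D *v x))) \<le> \<mu>"
      by (simp add: \<mu>_def matrix_vector_mult_scaleR)
    then show ?thesis using False
      by (simp add: field_simps power2_norm_eq_inner[symmetric] power2_eq_square)
  qed simp
  have orth: "(D *v e - \<mu> *\<^sub>R e) \<bullet> v = 0" if v: "v \<in> V" for v
  proof (rule quadratic_bound_imp_linear_zero[where d = "v \<bullet> (D *v v) - \<mu> * (v \<bullet> v)"])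
    fix t :: real
    have "e + t *\<^sub>R v \<in> V" using e v subspace_add subspace_scale V(1) by blast
    from max'[OF this]
    have *: "(e + t *\<^sub>R v) \<bullet> (D *v (e + t *\<^sub>R v)) \<le> \<mu> * ((e + t *\<^sub>R v) \<bullet> (e + t *\<^sub>R v))" .
    have s: "e \<bullet> (D *v v) = (D *v e) \<bullet> v" using inner_matrix_vector_transpose[of D e v] sym by simp
    have ee: "e \<bullet> e = 1" using e by (simp add: norm_eq_1)
    from * show "2 * t * ((D *v e - \<mu> *\<^sub>R e) \<bullet> v) + t\<^sup>2 * (v \<bullet> (D *v v) - \<mu> * (v \<bullet> v)) \<le> 0"
      using s by (simp add: matrix_vector_right_distrib matrix_vector_mult_scaleR inner_add_left
          inner_add_right inner_diff_left ee \<mu>_def[symmetric] algebra_simps power2_eq_square inner_commute)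
  qed
  have "D *v e - \<mu> *\<^sub>R e \<in> V" using e V subspace_diff subspace_scale by blast
  from orth[OF this] have "D *v e = \<mu> *\<^sub>R e" by simp
  then show thesis using that e by auto
qed

text \<open>Split off one eigenvector; by symmetry its orthogonal complement in \<open>V\<close> is again invariant.\<close>

lemma symmetric_matrix_eigenbasis_subspace:
  fixes D :: "real^'m^'m"
  assumes sym: "transpose D = D"
  shows "subspace V \<Longrightarrow> (\<And>v. v \<in> V \<Longrightarrow> D *v v \<in> V) \<Longrightarrow>
    \<exists>E \<mu>. finite E \<and> pairwise orthogonal E \<and> (\<forall>e\<in>E. norm e = 1 \<and> D *v e = \<mu> e *\<^sub>R e) \<and> span E = V"
proof (induction "dim V" arbitrary: V rule: less_induct)
  case less
  show ?case
  proof (cases "V = {0}")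
    case True
    then show ?thesis by (intro exI[of _ "{}"]) auto
  next
    case False
    obtain e m where e: "e \<in> V" "norm e = 1" "D *v e = m *\<^sub>R e"
      using symmetric_matrix_eigenvector[OF sym less.prems False] .
    define W where "W = {v \<in> V. v \<bullet> e = 0}"
    have W: "subspace W" unfolding W_def
      using less.prems(1) by (auto simp: subspace_def inner_add_left)
    have inv: "D *v v \<in> W" if "v \<in> W" for v
      using that less.prems(2) inner_matrix_vector_transpose[of D v e] e(3) sym by (auto simp: W_def)
    have "e \<notin> W" using e(2) by (auto simp: W_def)
    then have "dim W < dim V"
      using e(1) subspace_dim_equal[OF W less.prems(1)] dim_subset[of W V] by (force simp: W_def)
    from less.hyps[OF this W inv] obtain E \<mu> where E: "finite E" "pairwise orthogonal E"
      "\<forall>e\<in>E. norm e = 1 \<and> D *v e = \<mu> e *\<^sub>R e" "span E = W" by blast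
    have EW: "E \<subseteq> W" using E(4) span_superset by blast
    have "e \<notin> E" using EW \<open>e \<notin> W\<close> by blast
    have sp: "span (insert e E) = V"
    proof
      show "span (insert e E) \<subseteq> V"
        using EW e(1) less.prems(1) by (intro span_minimal) (auto simp: W_def)
      show "V \<subseteq> span (insert e E)"
      proof
        fix v assume "v \<in> V"
        then have "v - (v \<bullet> e) *\<^sub>R e \<in> W"
          using e subspace_diff[OF less.prems(1)] subspace_scale[OF less.prems(1)]
          by (auto simp: W_def inner_diff_left norm_eq_1)
        then show "v \<in> span (insert e E)" by (auto simp: span_insert E(4))
      qed
    qed
    show ?thesis
      using E EW e \<open>e \<notin> E\<close> sp
      by (intro exI[of _ "insert e E"] exI[of _ "\<mu>(e := m)"])
         (auto simp: pairwise_insert orthogonal_def W_def inner_commute)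
  qed
qed

definition eigenbasis :: "real^'m^'m \<Rightarrow> (real^'m) set \<Rightarrow> (real^'m \<Rightarrow> real) \<Rightarrow> bool" where
  "eigenbasis D E \<mu> \<longleftrightarrow> finite E \<and> pairwise orthogonal E \<and>
     (\<forall>e\<in>E. norm e = 1 \<and> D *v e = \<mu> e *\<^sub>R e) \<and> span E = UNIV"

lemma symmetric_matrix_eigenbasis:
  fixes D :: "real^'m^'m"
  assumes "transpose D = D"
  obtains E \<mu> where "eigenbasis D E \<mu>"
  using symmetric_matrix_eigenbasis_subspace[OF assms, of UNIV] by (auto simp: eigenbasis_def)

lemma eigenbasis_expand:
  assumes "eigenbasis D E \<mu>"
  shows "(\<Sum>e\<in>E. (x \<bullet> e) *\<^sub>R e) = x"
  using assms by (intro orthonormal_basis_expand) (auto simp: eigenbasis_def)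

lemma eigenbasis_inner:
  assumes "eigenbasis D E \<mu>" "e \<in> E" "e' \<in> E"
  shows "e \<bullet> e' = (if e = e' then 1 else 0)"
  using assms by (auto simp: eigenbasis_def pairwise_def orthogonal_def norm_eq_1)

lemma eigenbasis_inner_sum:
  assumes E: "eigenbasis D E \<mu>" and e: "e' \<in> E"
  shows "(\<Sum>e\<in>E. c e *\<^sub>R e) \<bullet> e' = c e'"
proof -
  have "(\<Sum>e\<in>E. c e *\<^sub>R e) \<bullet> e' = (\<Sum>e\<in>E. if e = e' then c e' else 0)"
    unfolding inner_sum_left using eigenbasis_inner[OF E _ e] by (intro sum.cong) auto
  also have "\<dots> = c e'" using E e by (simp add: eigenbasis_def)
  finally show ?thesis .
qed

lemma eigenbasis_norm_sum:
  assumes E: "eigenbasis D E \<mu>"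
  shows "(norm (\<Sum>e\<in>E. c e *\<^sub>R e))\<^sup>2 = (\<Sum>e\<in>E. (c e)\<^sup>2)"
proof -
  have "(norm (\<Sum>e\<in>E. c e *\<^sub>R e))\<^sup>2 = (\<Sum>e'\<in>E. c e' * ((\<Sum>e\<in>E. c e *\<^sub>R e) \<bullet> e'))"
    by (simp add: power2_norm_eq_inner inner_sum_right)
  also have "\<dots> = (\<Sum>e\<in>E. (c e)\<^sup>2)"
    using eigenbasis_inner_sum[OF E] by (intro sum.cong) (auto simp: power2_eq_square)
  finally show ?thesis .
qed

lemma scaleR_matrix_vector_mult: "(c *\<^sub>R A) *v x = c *\<^sub>R (A *v x)"
  for A :: "real^'m^'n" by (simp add: matrix_vector_mult_def vec_eq_iff sum_distrib_left mult.assoc)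

lemma sum_matrix_vector_mult: "(\<Sum>e\<in>E. F e) *v x = (\<Sum>e\<in>E. F e *v x)"
  for F :: "_ \<Rightarrow> real^'m^'n"
  by (induction E rule: infinite_finite_induct) (auto simp: matrix_vector_mult_add_rdistrib)

lemma outer_product_vector_mult: "(\<chi> i j. e $ i * e $ j) *v x = (x \<bullet> e) *\<^sub>R e"
  for e x :: "real^'m"
  by (simp add: matrix_vector_mult_def inner_vec_def vec_eq_iff sum_distrib_left mult_ac)

lemma eigenbasis_matpow:
  assumes E: "eigenbasis D E \<mu>"
  shows "matpow (c *\<^sub>R D) k = (\<Sum>e\<in>E. (c * \<mu> e) ^ k *\<^sub>R (\<chi> i j. e $ i * e $ j))"
proof -
  have "matpow (c *\<^sub>R D) k *v x = (\<Sum>e\<in>E. (c * \<mu> e) ^ k *\<^sub>R (x \<bullet> e) *\<^sub>R e)" for x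
  proof (induction k)
    case 0
    then show ?case using eigenbasis_expand[OF E] by simp
  next
    case (Suc k)
    have "matpow (c *\<^sub>R D) (Suc k) *v x = c *\<^sub>R (D *v (\<Sum>e\<in>E. (c * \<mu> e) ^ k *\<^sub>R (x \<bullet> e) *\<^sub>R e))"
      by (simp add: matrix_vector_mul_assoc[symmetric] Suc scaleR_matrix_vector_mult)
    also have "\<dots> = (\<Sum>e\<in>E. c *\<^sub>R (c * \<mu> e) ^ k *\<^sub>R (x \<bullet> e) *\<^sub>R (D *v e))"
      by (simp add: linear_sum[OF matrix_vector_mul_linear] matrix_vector_mult_scaleR scaleR_sum_right)
    also have "\<dots> = (\<Sum>e\<in>E. (c * \<mu> e) ^ Suc k *\<^sub>R (x \<bullet> e) *\<^sub>R e)"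
      using E by (intro sum.cong) (auto simp: eigenbasis_def mult_ac)
    finally show ?case .
  qed
  also have "(\<Sum>e\<in>E. (c * \<mu> e) ^ k *\<^sub>R (x \<bullet> e) *\<^sub>R e)
      = (\<Sum>e\<in>E. (c * \<mu> e) ^ k *\<^sub>R (\<chi> i j. e $ i * e $ j)) *v x" for x
    by (simp add: sum_matrix_vector_mult scaleR_matrix_vector_mult outer_product_vector_mult)
  finally show ?thesis by (simp add: matrix_eq)
qed

text \<open>The exponential series acts on each eigenline as the scalar exponential series.\<close>

lemma mat_powr_eigenbasis:
  assumes E: "eigenbasis D E \<mu>" and t: "t > 0"
  shows "mat_powr t D *v x = (\<Sum>e\<in>E. (t powr \<mu> e * (x \<bullet> e)) *\<^sub>R e)"
proof -
  let ?O = "\<lambda>e::real^'a. (\<chi> i j. e $ i * e $ j) :: real^'a^'a"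
  have "(\<lambda>k. (1 / fact k) *\<^sub>R matpow (ln t *\<^sub>R D) k) sums (\<Sum>e\<in>E. exp (ln t * \<mu> e) *\<^sub>R ?O e)"
    unfolding eigenbasis_matpow[OF E] scaleR_sum_right scaleR_scaleR
    using exp_converges[of "ln t * \<mu> e" for e]
    by (intro sums_sum sums_scaleR_left) (simp add: divide_inverse mult.commute)
  then have "mat_powr t D = (\<Sum>e\<in>E. exp (ln t * \<mu> e) *\<^sub>R ?O e)"
    unfolding mat_powr_def mat_exp_def by (rule sums_unique[symmetric])
  then show ?thesis using t by (simp add: sum_matrix_vector_mult scaleR_matrix_vector_mult outer_product_vector_mult powr_def mult_ac)
qed

text \<open>This ties the complex eigenvalues, through which the spectral bounds are given, to the real
  eigenbasis.  A complex eigenvector has a nonzero coefficient along some real one, and symmetry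
  forces the two eigenvalues to agree.\<close>

lemma eigenbasis_eigvals:
  fixes D :: "real^'m^'m"
  assumes E: "eigenbasis D E \<mu>" and sym: "transpose D = D"
  shows "eigvals D = (\<lambda>e. complex_of_real (\<mu> e)) ` E"
proof (intro equalityI subsetI)
  fix c assume "c \<in> (\<lambda>e. complex_of_real (\<mu> e)) ` E"
  then obtain e where e: "e \<in> E" "c = \<mu> e" by auto
  have "D *v e = \<mu> e *\<^sub>R e" "e \<noteq> 0" using E e by (auto simp: eigenbasis_def)
  then have "(\<Sum>j\<in>UNIV. D $ i $ j * e $ j) = \<mu> e * e $ i" for i
    by (simp add: matrix_vector_mult_def vec_eq_iff)
  then have "(\<Sum>j\<in>UNIV. complex_of_real (D $ i $ j) * complex_of_real (e $ j)) = \<mu> e * e $ i" for i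
    by (metis (no_types, lifting) of_real_mult of_real_sum sum.cong)
  then show "c \<in> eigvals D" using e(2) \<open>e \<noteq> 0\<close>
    by (auto simp: eigvals_def matrix_vector_mult_def vec_eq_iff intro!: exI[of _ "\<chi> i. complex_of_real (e $ i)"])
next
  fix c assume "c \<in> eigvals D"
  then obtain v where v: "v \<noteq> 0" "(\<chi> i j. complex_of_real (D $ i $ j)) *v v = c *s v"
    by (auto simp: eigvals_def)
  have ev: "(\<Sum>j\<in>UNIV. complex_of_real (D $ i $ j) * v $ j) = c * v $ i" for i
    using v(2) by (simp add: matrix_vector_mult_def vec_eq_iff)
  define p where "p e = (\<Sum>i\<in>UNIV. v $ i * complex_of_real (e $ i))" for e :: "real^'m"
  have "\<exists>e\<in>E. p e \<noteq> 0"
  proof (rule ccontr)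
    assume *: "\<not> (\<exists>e\<in>E. p e \<noteq> 0)"
    define x y where "x = (\<chi> i. Re (v $ i))" and "y = (\<chi> i. Im (v $ i))"
    have "x \<bullet> e = Re (p e)" "y \<bullet> e = Im (p e)" for e
      by (simp_all add: p_def x_def y_def inner_vec_def)
    then have "x \<bullet> e = 0" "y \<bullet> e = 0" if "e \<in> E" for e using * that by auto
    then have "x = 0" "y = 0"
      using eigenbasis_expand[OF E, of x] eigenbasis_expand[OF E, of y] by auto
    then have "v = 0" by (simp add: x_def y_def vec_eq_iff complex_eq_iff)
    then show False using v by simp
  qed
  then obtain e where e: "e \<in> E" "p e \<noteq> 0" by blast
  have De: "D *v e = \<mu> e *\<^sub>R e" using E e by (auto simp: eigenbasis_def)
  have col: "(\<Sum>i\<in>UNIV. D $ i $ j * e $ i) = \<mu> e * e $ j" for j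
  proof -
    have "D $ i $ j = D $ j $ i" for i
      using sym by (metis transpose_def vec_lambda_beta)
    then show ?thesis using De by (simp add: matrix_vector_mult_def vec_eq_iff)
  qed
  have "c * p e = (\<Sum>i\<in>UNIV. (\<Sum>j\<in>UNIV. complex_of_real (D $ i $ j) * v $ j) * e $ i)"
    by (simp only: ev p_def sum_distrib_left mult.assoc)
  also have "\<dots> = (\<Sum>j\<in>UNIV. v $ j * complex_of_real (\<Sum>i\<in>UNIV. D $ i $ j * e $ i))"
    by (simp add: sum_distrib_left sum_distrib_right mult_ac) (rule sum.swap)
  also have "\<dots> = \<mu> e * p e"
    by (simp only: col p_def) (simp add: sum_distrib_left mult_ac)
  finally have "c = \<mu> e" using e by simp
  then show "c \<in> (\<lambda>e. complex_of_real (\<mu> e)) ` E" using e by blast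
qed

section \<open>Generalized polar coordinates\<close>

text \<open>With \<open>a\<close> and \<open>b\<close> the extreme reciprocals of the eigenvalues, this is the uniform bound shared by all
  exponents \<open>B(s)\<close>.\<close>

definition pinched :: "real \<Rightarrow> real \<Rightarrow> real^'m^'m \<Rightarrow> bool" where
  "pinched a b D \<longleftrightarrow> transpose D = D \<and> (\<forall>c\<in>eigvals D. 1 / b \<le> Re c \<and> Re c \<le> 1 / a)"

lemma pinched_eigenbasis:
  fixes D :: "real^'m^'m"
  assumes "pinched a b D"
  obtains E \<mu> where "eigenbasis D E \<mu>" "\<And>e. e \<in> E \<Longrightarrow> 1 / b \<le> \<mu> e \<and> \<mu> e \<le> 1 / a"
proof -
  have sym: "transpose D = D" using assms by (simp add: pinched_def)
  obtain E \<mu> where E: "eigenbasis D E \<mu>" using symmetric_matrix_eigenbasis[OF sym] .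
  then show thesis
    using that[OF E] assms eigenbasis_eigvals[OF E sym] by (auto simp: pinched_def)
qed

lemma symmetric_pinched:
  fixes D :: "real^'m^'m"
  assumes sym: "transpose D = D" and "0 < a" "0 < b" "1 / b \<le> lam_min D" "lam_max D \<le> 1 / a"
  shows "pinched a b D"
proof -
  obtain E \<mu> where E: "eigenbasis D E \<mu>" using symmetric_matrix_eigenbasis[OF sym] .
  have fin: "finite (Re ` eigvals D)"
    using E by (simp add: eigenbasis_eigvals[OF E sym] eigenbasis_def)
  show ?thesis unfolding pinched_def
  proof (intro conjI ballI sym)
    fix c assume "c \<in> eigvals D"
    then have "lam_min D \<le> Re c" "Re c \<le> lam_max D"
      using fin by (auto simp: lam_min_def lam_max_def)
    then show "1 / b \<le> Re c" "Re c \<le> 1 / a" using assms by auto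
  qed
qed

lemma eigvals_nonempty:
  fixes D :: "real^'m^'m"
  assumes sym: "transpose D = D"
  shows "eigvals D \<noteq> {}" "finite (eigvals D)"
proof -
  obtain E \<mu> where E: "eigenbasis D E \<mu>" using symmetric_matrix_eigenbasis[OF sym] .
  have "E \<noteq> {}"
  proof
    assume "E = {}"
    then have "(1 :: real^'m) = 0" using eigenbasis_expand[OF E, of 1] by simp
    then show False by simp
  qed
  then show "eigvals D \<noteq> {}" "finite (eigvals D)"
    using E by (auto simp: eigenbasis_eigvals[OF E sym] eigenbasis_def)
qed

context
  fixes a b :: real and D :: "real^'m^'m"
  assumes a: "0 < a" and b: "0 < b" and D: "pinched a b D"
begin

lemma mat_powr_mult:
  assumes "0 < s" "0 < t"
  shows "mat_powr s D *v (mat_powr t D *v x) = mat_powr (s * t) D *v x"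
proof -
  obtain E \<mu> where E: "eigenbasis D E \<mu>" using pinched_eigenbasis[OF D] .
  show ?thesis
    using assms by (simp add: mat_powr_eigenbasis[OF E] eigenbasis_inner_sum[OF E] powr_mult mult.assoc)
qed

lemma mat_powr_one: "mat_powr 1 D *v x = x"
proof -
  obtain E \<mu> where E: "eigenbasis D E \<mu>" using pinched_eigenbasis[OF D] .
  show ?thesis by (simp add: mat_powr_eigenbasis[OF E] eigenbasis_expand[OF E])
qed

lemma mat_powr_symmetric:
  assumes "0 < t"
  shows "(mat_powr t D *v x) \<bullet> y = x \<bullet> (mat_powr t D *v y)"
proof -
  obtain E \<mu> where E: "eigenbasis D E \<mu>" using pinched_eigenbasis[OF D] .
  show ?thesis using assms
    by (simp add: mat_powr_eigenbasis[OF E] inner_sum_left inner_sum_right inner_commute mult_ac)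
qed

text \<open>In eigencoordinates, \<open>t \<le> 1\<close> raised to an exponent from \<open>[1/b, 1/a]\<close> lies between the two extreme powers.\<close>

lemma norm_mat_powr_contract:
  assumes "0 < t" "t \<le> 1"
  shows "t powr (1 / a) * norm x \<le> norm (mat_powr t D *v x)"
    and "norm (mat_powr t D *v x) \<le> t powr (1 / b) * norm x"
proof -
  obtain E \<mu> where E: "eigenbasis D E \<mu>" and \<mu>: "\<And>e. e \<in> E \<Longrightarrow> 1 / b \<le> \<mu> e \<and> \<mu> e \<le> 1 / a"
    using pinched_eigenbasis[OF D] by blast
  have n: "(norm x)\<^sup>2 = (\<Sum>e\<in>E. (x \<bullet> e)\<^sup>2)"
    using eigenbasis_norm_sum[OF E, of "\<lambda>e. x \<bullet> e"] by (simp add: eigenbasis_expand[OF E])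
  have N: "(norm (mat_powr t D *v x))\<^sup>2 = (\<Sum>e\<in>E. (t powr \<mu> e)\<^sup>2 * (x \<bullet> e)\<^sup>2)"
    using assms by (simp add: mat_powr_eigenbasis[OF E] eigenbasis_norm_sum[OF E] power_mult_distrib)
  have "(t powr (1 / a) * norm x)\<^sup>2 \<le> (norm (mat_powr t D *v x))\<^sup>2"
    unfolding N power_mult_distrib n sum_distrib_left
    using assms \<mu> by (intro sum_mono mult_right_mono power_mono) (auto intro!: powr_mono')
  then show "t powr (1 / a) * norm x \<le> norm (mat_powr t D *v x)" by (rule power2_le_imp_le) simp
  have "(norm (mat_powr t D *v x))\<^sup>2 \<le> (t powr (1 / b) * norm x)\<^sup>2"
    unfolding N power_mult_distrib n sum_distrib_left
    using assms \<mu> by (intro sum_mono mult_right_mono power_mono) (auto intro!: powr_mono')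
  then show "norm (mat_powr t D *v x) \<le> t powr (1 / b) * norm x" by (rule power2_le_imp_le) simp
qed

text \<open>The contraction estimates applied to the inverse operator.\<close>

lemma norm_mat_powr_expand:
  assumes "1 \<le> t"
  shows "t powr (1 / b) * norm x \<le> norm (mat_powr t D *v x)"
    and "norm (mat_powr t D *v x) \<le> t powr (1 / a) * norm x"
proof -
  let ?y = "mat_powr t D *v x"
  have x: "mat_powr (1 / t) D *v ?y = x"
    using assms by (simp add: mat_powr_mult mat_powr_one)
  have "(1 / t) powr (1 / a) * norm ?y \<le> norm x" "norm x \<le> (1 / t) powr (1 / b) * norm ?y"
    using norm_mat_powr_contract[of "1 / t" ?y] assms unfolding x by auto
  then show "t powr (1 / b) * norm x \<le> norm ?y" "norm ?y \<le> t powr (1 / a) * norm x"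
    using assms by (simp_all add: powr_divide field_simps)
qed

lemma mat_powr_continuous: "continuous_on {0<..} (\<lambda>t. mat_powr t D *v x)"
proof -
  obtain E \<mu> where E: "eigenbasis D E \<mu>" using pinched_eigenbasis[OF D] .
  have "continuous_on {0<..} (\<lambda>t. \<Sum>e\<in>E. (t powr \<mu> e * (x \<bullet> e)) *\<^sub>R e)"
    by (intro continuous_intros) auto
  then show ?thesis
    by (rule continuous_on_cong[THEN iffD1, rotated -1]) (auto simp: mat_powr_eigenbasis[OF E])
qed

text \<open>The expansion and contraction bounds put the norm on either side of 1 at \<open>t = 1\<close> and at
  \<open>t\<close> equal to the norm of \<open>x\<close> raised to \<open>b\<close>; the intermediate value theorem does the rest.\<close>

lemma mat_powr_hits_sphere:
  assumes "x \<noteq> 0"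
  obtains t where "0 < t" "norm (mat_powr (1 / t) D *v x) = 1"
proof -
  define c where "c = norm x powr b"
  have c: "c > 0" using assms by (simp add: c_def)
  have cb: "(1 / c) powr (1 / b) * norm x = 1"
    using assms b by (simp add: c_def powr_divide powr_powr)
  let ?h = "\<lambda>t. norm (mat_powr t D *v x)"
  have cont: "continuous_on S ?h" if "S \<subseteq> {0<..}" for S
    by (intro continuous_intros continuous_on_subset[OF mat_powr_continuous that])
  have "\<exists>r>0. ?h r = 1"
  proof (cases "norm x \<ge> 1")
    case True
    then have "c \<ge> 1" using b by (simp add: c_def ge_one_powr_ge_zero)
    then have "?h (1 / c) \<le> 1" using norm_mat_powr_contract(2)[of "1 / c" x] c cb by simp
    then have "\<exists>r. 1 / c \<le> r \<and> r \<le> 1 \<and> ?h r = 1"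
      using c \<open>c \<ge> 1\<close> True by (intro IVT'[of ?h "1 / c" 1 1] cont) (auto simp: mat_powr_one intro: less_le_trans[of 0 "1 / c"])
    then show ?thesis using c by (meson divide_pos_pos less_le_trans zero_less_one)
  next
    case False
    then have "c \<le> 1" using b by (simp add: c_def powr_le1)
    then have "?h (1 / c) \<ge> 1" using norm_mat_powr_expand(1)[of "1 / c" x] c cb by simp
    then have "\<exists>r. 1 \<le> r \<and> r \<le> 1 / c \<and> ?h r = 1"
      using c \<open>c \<le> 1\<close> False by (intro IVT'[of ?h 1 1 "1 / c"] cont) (auto simp: mat_powr_one)
    then show ?thesis by (meson less_le_trans zero_less_one)
  qed
  then obtain r where "r > 0" "?h r = 1" by blast
  then show thesis using that[of "1 / r"] by simp
qed

text \<open>Strict monotonicity along orbits makes the polar radius unique and turns its sublevel sets into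
  norm inequalities.\<close>

lemma norm_mat_powr_mono_iff:
  assumes "0 < s" "0 < t" "x \<noteq> 0"
  shows "norm (mat_powr s D *v x) \<le> norm (mat_powr t D *v x) \<longleftrightarrow> s \<le> t"
proof -
  have pos: "norm (mat_powr r D *v x) > 0" if "r > 0" for r
  proof -
    have "mat_powr (1 / r) D *v (mat_powr r D *v x) = x"
      using that by (simp add: mat_powr_mult mat_powr_one)
    then show ?thesis using assms(3) by auto
  qed
  have strict: "norm (mat_powr s D *v x) < norm (mat_powr t D *v x)" if "0 < s" "s < t" for s t
  proof -
    have "norm (mat_powr s D *v x) = norm (mat_powr (s / t) D *v (mat_powr t D *v x))"
      using that by (simp add: mat_powr_mult)
    also have "\<dots> \<le> (s / t) powr (1 / b) * norm (mat_powr t D *v x)"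
      using that by (intro norm_mat_powr_contract) auto
    also have "\<dots> < 1 * norm (mat_powr t D *v x)"
      using that b pos[of t] powr_less_mono2[of "1 / b" "s / t" 1]
      by (intro mult_strict_right_mono) auto
    finally show ?thesis by simp
  qed
  show ?thesis using strict[of s t] strict[of t s] assms by (cases s t rule: linorder_cases) auto
qed

lemma tau_polar:
  assumes "x \<noteq> 0"
  shows "0 < tau D x" "norm (mat_powr (1 / tau D x) D *v x) = 1"
proof -
  obtain t where t: "0 < t" "norm (mat_powr (1 / t) D *v x) = 1" using mat_powr_hits_sphere[OF assms] .
  let ?P = "\<lambda>t. t > 0 \<and> (\<exists>\<theta>\<in>sphere 0 1. x = mat_powr t D *v \<theta>)"
  have "?P t" using t
    by (auto intro!: bexI[of _ "mat_powr (1 / t) D *v x"] simp: mat_powr_mult mat_powr_one)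
  moreover have "t' = t" if t': "?P t'" for t'
  proof -
    obtain \<theta> where \<theta>: "norm \<theta> = 1" "x = mat_powr t' D *v \<theta>" using t' by auto
    have "mat_powr (1 / t') D *v x = \<theta>" using t' unfolding \<theta>(2) by (simp add: mat_powr_mult mat_powr_one)
    then have "norm (mat_powr (1 / t') D *v x) = norm (mat_powr (1 / t) D *v x)" using \<theta> t by simp
    then have "1 / t' = 1 / t"
      using norm_mat_powr_mono_iff[of "1 / t" "1 / t'" x] norm_mat_powr_mono_iff[of "1 / t'" "1 / t" x]
        assms t t' by (intro antisym) auto
    then show ?thesis by simp
  qed
  ultimately have "(THE t. ?P t) = t" by (rule the_equality)
  then have "tau D x = t" using assms by (simp only: tau_def if_False)
  then show "0 < tau D x" "norm (mat_powr (1 / tau D x) D *v x) = 1" using t by auto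
qed

lemma tau_zero: "tau D 0 = 0" by (simp add: tau_def)

lemma tau_nonneg: "0 \<le> tau D x"
  using tau_polar(1)[of x] by (cases "x = 0") (auto simp: tau_zero)

text \<open>All later facts about the polar radius come from this description of its sublevel sets, which are
  convex, closed, and depend measurably on the exponent.\<close>

lemma tau_le_iff:
  assumes "0 < t"
  shows "tau D x \<le> t \<longleftrightarrow> norm (mat_powr (1 / t) D *v x) \<le> 1"
proof (cases "x = 0")
  case False
  then show ?thesis
    using norm_mat_powr_mono_iff[of "1 / t" "1 / tau D x" x] tau_polar[OF False] assms
    by (simp add: field_simps)
qed (use assms in \<open>simp add: tau_zero\<close>)

lemma tau_unit: "norm x = 1 \<Longrightarrow> tau D x = 1"
proof -
  assume x: "norm x = 1"
  then have "x \<noteq> 0" by auto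
  have "norm (mat_powr 1 D *v x) = norm (mat_powr (1 / tau D x) D *v x)"
    using x tau_polar(2)[OF \<open>x \<noteq> 0\<close>] by (simp add: mat_powr_one)
  then have "1 / tau D x = 1"
    using norm_mat_powr_mono_iff[of 1 "1 / tau D x" x] norm_mat_powr_mono_iff[of "1 / tau D x" 1 x]
      tau_polar(1)[OF \<open>x \<noteq> 0\<close>] \<open>x \<noteq> 0\<close> by (intro antisym) auto
  then show ?thesis by simp
qed

lemma tau_scale_le:
  assumes c: "1 \<le> c"
  shows "tau D (c *\<^sub>R x) \<le> c powr b * tau D x"
proof (cases "x = 0")
  case False
  let ?t = "tau D x"
  have t: "?t > 0" "norm (mat_powr (1 / ?t) D *v x) = 1" by (rule tau_polar[OF False])+
  have cb: "c powr b > 0" "c powr b \<ge> 1"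
    using c b ge_one_powr_ge_zero[of c b] by simp_all
  have eq: "mat_powr (1 / (c powr b * ?t)) D *v x
      = mat_powr (1 / c powr b) D *v (mat_powr (1 / ?t) D *v x)"
    using t cb by (simp add: mat_powr_mult)
  have "norm (mat_powr (1 / (c powr b * ?t)) D *v x) \<le> (1 / c powr b) powr (1 / b)"
    unfolding eq using norm_mat_powr_contract(2)[of "1 / c powr b" "mat_powr (1 / ?t) D *v x"] t cb by simp
  also have "\<dots> = 1 / c" using c b by (simp add: powr_divide powr_powr)
  finally have "norm (mat_powr (1 / (c powr b * ?t)) D *v (c *\<^sub>R x)) \<le> 1"
    using c by (simp add: matrix_vector_mult_scaleR field_simps)
  then show ?thesis using tau_le_iff[of "c powr b * ?t" "c *\<^sub>R x"] t cb by simp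
qed (simp add: tau_zero)

lemma tau_scale_ge:
  assumes c: "1 \<le> c"
  shows "c powr a * tau D x \<le> tau D (c *\<^sub>R x)"
proof (cases "x = 0")
  case False
  let ?y = "c *\<^sub>R x"
  let ?t = "tau D ?y"
  have y: "?y \<noteq> 0" using False c by auto
  have t: "?t > 0" "norm (mat_powr (1 / ?t) D *v ?y) = 1" by (rule tau_polar[OF y])+
  have ca: "c powr a > 0" "c powr a \<ge> 1"
    using c a ge_one_powr_ge_zero[of c a] by simp_all
  have eq: "mat_powr (1 / (?t / c powr a)) D *v x
      = mat_powr (c powr a) D *v (mat_powr (1 / ?t) D *v x)"
    using t ca by (simp add: mat_powr_mult)
  have n: "norm (mat_powr (1 / ?t) D *v x) = 1 / c"
    using t c by (simp add: matrix_vector_mult_scaleR field_simps)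
  have "norm (mat_powr (1 / (?t / c powr a)) D *v x) \<le> (c powr a) powr (1 / a) * (1 / c)"
    unfolding eq using norm_mat_powr_expand(2)[of "c powr a" "mat_powr (1 / ?t) D *v x"] n ca by simp
  also have "\<dots> = 1" using c a by (simp add: powr_powr)
  finally show ?thesis using tau_le_iff[of "?t / c powr a" x] t ca by (simp add: field_simps)
qed (simp add: tau_zero)

text \<open>The sublevel sets are balanced.\<close>

lemma tau_shrink:
  assumes "\<bar>c\<bar> \<le> 1"
  shows "tau D (c *\<^sub>R x) \<le> tau D x"
proof (cases "x = 0")
  case False
  then show ?thesis
    using tau_polar[OF False] assms tau_le_iff[of "tau D x" "c *\<^sub>R x"]
    by (simp add: matrix_vector_mult_scaleR)
qed (simp add: tau_zero)

lemma tau_minus: "tau D (- x) = tau D x"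
  using tau_shrink[of "-1" x] tau_shrink[of "-1" "- x"] by simp

text \<open>Enlarging the radius by the factor \<open>n\<^sup>b\<close> contracts every summand at least by \<open>n\<close>, so that the \<open>n\<close>
  summands together still fit into the unit ball.\<close>

lemma tau_sum_le:
  assumes I: "finite I" "I \<noteq> {}" and t: "\<And>i. i \<in> I \<Longrightarrow> tau D (x i) \<le> t" "0 < t"
  shows "tau D (\<Sum>i\<in>I. x i) \<le> real (card I) powr b * t"
proof -
  define n where "n = real (card I)"
  have n: "n \<ge> 1" using I by (simp add: n_def Suc_leI card_gt_0_iff)
  let ?c = "n powr b"
  have c: "?c > 0" "?c \<ge> 1" using n b ge_one_powr_ge_zero[of n b] by simp_all
  have "norm (mat_powr (1 / (?c * t)) D *v x i) \<le> 1 / n" if i: "i \<in> I" for i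
  proof -
    have "mat_powr (1 / (?c * t)) D *v x i = mat_powr (1 / ?c) D *v (mat_powr (1 / t) D *v x i)"
      using t c by (simp add: mat_powr_mult)
    then have "norm (mat_powr (1 / (?c * t)) D *v x i)
        \<le> (1 / ?c) powr (1 / b) * norm (mat_powr (1 / t) D *v x i)"
      using norm_mat_powr_contract(2)[of "1 / ?c" "mat_powr (1 / t) D *v x i"] c by simp
    also have "\<dots> \<le> (1 / ?c) powr (1 / b) * 1"
      using t i tau_le_iff[of t "x i"] by (intro mult_left_mono) auto
    also have "\<dots> = 1 / n" using n b by (simp add: powr_divide powr_powr)
    finally show ?thesis .
  qed
  then have "norm (\<Sum>i\<in>I. mat_powr (1 / (?c * t)) D *v x i) \<le> real (card I) * (1 / n)"
    by (intro sum_norm_le[THEN order_trans] sum_bounded_above) auto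
  also have "\<dots> = 1" using n by (simp add: n_def)
  finally have "norm (mat_powr (1 / (?c * t)) D *v (\<Sum>i\<in>I. x i)) \<le> 1"
    by (simp add: linear_sum[OF matrix_vector_mul_linear])
  then show ?thesis using tau_le_iff[of "?c * t"] t c by (simp add: n_def)
qed

text \<open>Scale from the unit sphere, where the polar radius is 1.\<close>

lemma tau_norm_bounds:
  assumes ab: "a \<le> b"
  shows "min (norm x powr a) (norm x powr b) \<le> tau D x"
    and "tau D x \<le> max (norm x powr a) (norm x powr b)"
proof -
  have "min (norm x powr a) (norm x powr b) \<le> tau D x \<and> tau D x \<le> max (norm x powr a) (norm x powr b)"
  proof (cases "x = 0")
    case False
    define r u where "r = norm x" and "u = (1 / r) *\<^sub>R x"
    have r: "r > 0" and x: "x = r *\<^sub>R u" and u: "norm u = 1" "tau D u = 1"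
      using False tau_unit by (auto simp: r_def u_def)
    show ?thesis
    proof (cases "r \<ge> 1")
      case True
      then show ?thesis using tau_scale_le[OF True, of u] tau_scale_ge[OF True, of u] u x ab
        by (auto simp: r_def[symmetric] min_le_iff_disj le_max_iff_disj)
    next
      case False
      then have r1: "1 / r \<ge> 1" using r by simp
      have ux: "(1 / r) *\<^sub>R x = u" by (simp add: u_def)
      have "1 \<le> (1 / r) powr b * tau D x" "(1 / r) powr a * tau D x \<le> 1"
        using tau_scale_le[OF r1, of x] tau_scale_ge[OF r1, of x] unfolding ux u by auto
      then have "r powr b \<le> tau D x" "tau D x \<le> r powr a"
        using r by (simp_all add: powr_divide field_simps)
      then show ?thesis by (auto simp: r_def)
    qed
  qed (simp add: tau_zero)
  then show "min (norm x powr a) (norm x powr b) \<le> tau D x"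
    and "tau D x \<le> max (norm x powr a) (norm x powr b)" by auto
qed

end

section \<open>Spaces defined by a modular with two-sided power scaling\<close>

lemma ennreal_tendsto_0_le:
  fixes X Y :: "nat \<Rightarrow> ennreal"
  assumes "\<And>n. X n \<le> Y n" "Y \<longlonglongrightarrow> 0"
  shows "X \<longlonglongrightarrow> 0"
  using assms(1) by (intro tendsto_sandwich[OF _ _ tendsto_const assms(2)]) simp_all

lemma power_powr_commute:
  fixes x u :: real
  assumes "0 < x"
  shows "(x ^ k) powr u = (x powr u) ^ k"
  using assms by (induction k) (simp_all add: powr_mult)

text \<open>A modular need be neither convex nor homogeneous here.  The two-sided power scaling replaces
  homogeneity; it already makes the level \<open>H f l = 1\<close> determine the quasi-norm and gives all
  comparisons between \<open>H\<close> at different levels.  Lower semicontinuity is what Fatou's lemma needs, and the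
  norm bounds connect the modular to pointwise convergence.\<close>

locale scaling_modular =
  fixes \<nu> :: "'s measure" and G :: "'s \<Rightarrow> 'v::euclidean_space \<Rightarrow> ennreal" and a b Q \<kappa> C :: real
  assumes a_pos: "0 < a" and ab: "a \<le> b" and Q: "1 \<le> Q" and \<kappa>: "0 < \<kappa>"
    and G_measurable: "\<And>f. f \<in> borel_measurable \<nu> \<Longrightarrow> (\<lambda>s. G s (f s)) \<in> borel_measurable \<nu>"
    and G_scale_le: "\<And>s c v. s \<in> space \<nu> \<Longrightarrow> 1 \<le> c \<Longrightarrow> G s (c *\<^sub>R v) \<le> ennreal (c powr b) * G s v"
    and G_scale_ge: "\<And>s c v. s \<in> space \<nu> \<Longrightarrow> 1 \<le> c \<Longrightarrow> ennreal (c powr a) * G s v \<le> G s (c *\<^sub>R v)"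
    and G_add: "\<And>s v w. s \<in> space \<nu> \<Longrightarrow> G s (v + w) \<le> ennreal Q * (G s v + G s w)"
    and G_minus: "\<And>s v. s \<in> space \<nu> \<Longrightarrow> G s (- v) = G s v"
    and G_lsc: "\<And>s t. s \<in> space \<nu> \<Longrightarrow> 0 < t \<Longrightarrow> closed {v. G s v \<le> ennreal t}"
    and G_upper: "\<And>s v. s \<in> space \<nu> \<Longrightarrow> G s v \<le> ennreal (C * max (norm v powr a) (norm v powr b))"
    and G_lower: "\<And>s v. s \<in> space \<nu> \<Longrightarrow> ennreal (\<kappa> * min (norm v powr a) (norm v powr b)) \<le> G s v"
begin

definition H :: "('s \<Rightarrow> 'v) \<Rightarrow> real \<Rightarrow> ennreal" where
  "H f l = (\<integral>\<^sup>+ s. G s ((1 / l) *\<^sub>R f s) \<partial>\<nu>)"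

definition N :: "('s \<Rightarrow> 'v) \<Rightarrow> real" where
  "N f = Inf {l. 0 < l \<and> H f l \<le> 1}"

definition V :: "('s \<Rightarrow> 'v) set" where
  "V = {f \<in> borel_measurable \<nu>. \<exists>l>0. H f l < \<infinity>}"

lemma b_pos: "0 < b" using a_pos ab by simp

lemma G_zero: "s \<in> space \<nu> \<Longrightarrow> G s 0 = 0"
  using G_upper[of s 0] by simp

lemma G_eq_0_iff: "s \<in> space \<nu> \<Longrightarrow> G s v = 0 \<longleftrightarrow> v = 0"
proof
  assume "s \<in> space \<nu>" "G s v = 0"
  then have "\<kappa> * min (norm v powr a) (norm v powr b) \<le> 0"
    using G_lower[of s v] by (simp add: ennreal_eq_0_iff)
  then have "min (norm v powr a) (norm v powr b) \<le> 0" using \<kappa> by (simp add: mult_le_0_iff)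
  then show "v = 0" by (auto simp: min_le_iff_disj)
qed (simp add: G_zero)

lemma V_measurable: "f \<in> V \<Longrightarrow> f \<in> borel_measurable \<nu>" by (simp add: V_def)

lemma H_measurable_integrand: "f \<in> borel_measurable \<nu> \<Longrightarrow> (\<lambda>s. G s (c *\<^sub>R f s)) \<in> borel_measurable \<nu>"
  by (rule G_measurable) simp

lemma H_scale_le:
  assumes f: "f \<in> borel_measurable \<nu>" and l: "0 < l" "l \<le> l'"
  shows "H f l \<le> ennreal ((l' / l) powr b) * H f l'"
proof -
  have "H f l \<le> (\<integral>\<^sup>+ s. ennreal ((l' / l) powr b) * G s ((1 / l') *\<^sub>R f s) \<partial>\<nu>)"
    unfolding H_def
  proof (rule nn_integral_mono)
    fix s assume "s \<in> space \<nu>"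
    from G_scale_le[OF this, of "l' / l" "(1 / l') *\<^sub>R f s"] l
    show "G s ((1 / l) *\<^sub>R f s) \<le> ennreal ((l' / l) powr b) * G s ((1 / l') *\<^sub>R f s)" by simp
  qed
  also have "\<dots> = ennreal ((l' / l) powr b) * H f l'"
    unfolding H_def by (rule nn_integral_cmult[OF H_measurable_integrand[OF f]])
  finally show ?thesis .
qed

lemma H_scale_ge:
  assumes f: "f \<in> borel_measurable \<nu>" and l: "0 < l" "l \<le> l'"
  shows "ennreal ((l' / l) powr a) * H f l' \<le> H f l"
proof -
  have "ennreal ((l' / l) powr a) * H f l' = (\<integral>\<^sup>+ s. ennreal ((l' / l) powr a) * G s ((1 / l') *\<^sub>R f s) \<partial>\<nu>)"
    unfolding H_def by (rule nn_integral_cmult[OF H_measurable_integrand[OF f], symmetric])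
  also have "\<dots> \<le> H f l"
    unfolding H_def
  proof (rule nn_integral_mono)
    fix s assume "s \<in> space \<nu>"
    from G_scale_ge[OF this, of "l' / l" "(1 / l') *\<^sub>R f s"] l
    show "ennreal ((l' / l) powr a) * G s ((1 / l') *\<^sub>R f s) \<le> G s ((1 / l) *\<^sub>R f s)" by simp
  qed
  finally show ?thesis .
qed

lemma H_antimono:
  assumes f: "f \<in> borel_measurable \<nu>" and l: "0 < l" "l \<le> l'"
  shows "H f l' \<le> H f l"
proof -
  have "1 * H f l' \<le> ennreal ((l' / l) powr a) * H f l'"
    using l a_pos by (intro mult_right_mono) (auto simp: ge_one_powr_ge_zero)
  then show ?thesis using H_scale_ge[OF assms] by simp
qed

lemma V_H_finite:
  assumes "f \<in> V" "0 < l"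
  shows "H f l < \<infinity>"
proof -
  obtain l' where f: "f \<in> borel_measurable \<nu>" and l': "l' > 0" "H f l' < \<infinity>"
    using assms by (auto simp: V_def)
  show ?thesis
  proof (cases "l \<le> l'")
    case True
    show ?thesis
      using H_scale_le[OF f assms(2) True] l' ennreal_mult_less_top[of "ennreal ((l' / l) powr b)" "H f l'"]
      by (auto simp: le_less_trans)
  next
    case False
    then show ?thesis using H_antimono[OF f l'(1), of l] l' by (auto simp: le_less_trans)
  qed
qed

text \<open>The lower scaling bound makes \<open>H f l\<close> decay at least like \<open>l\<close> to the power \<open>-a\<close>.\<close>

lemma H_shrinks:
  assumes "f \<in> V" "0 < e"
  obtains l where "0 < l" "H f l \<le> ennreal e"
proof -
  have f: "f \<in> borel_measurable \<nu>" using assms V_measurable by blast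
  obtain h where h: "H f 1 = ennreal h" "h \<ge> 0" using V_H_finite[OF assms(1), of 1] by (cases "H f 1") auto
  \<comment> \<open>the level at which the scaling bound brings the value \<open>h\<close> at level 1 below \<open>e\<close>\<close>
  define l where "l = max 1 ((h / e) powr (1 / a))"
  have l: "l \<ge> 1" by (simp add: l_def)
  have la: "h \<le> e * l powr a"
  proof -
    have "h / e = ((h / e) powr (1 / a)) powr a" using h assms a_pos by (simp add: powr_powr)
    also have "\<dots> \<le> l powr a" using a_pos by (intro powr_mono2) (auto simp: l_def)
    finally show ?thesis using assms by (simp add: field_simps)
  qed
  have "H f l < \<infinity>" using l by (intro V_H_finite[OF assms(1)]) simp
  then obtain x where x: "H f l = ennreal x" "x \<ge> 0" by (cases "H f l") auto
  have "ennreal (l powr a) * H f l \<le> H f 1" using H_scale_ge[OF f, of 1 l] l by simp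
  then have "l powr a * x \<le> h" using h x by (simp add: ennreal_mult'[symmetric])
  also note la
  finally have "l powr a * x \<le> l powr a * e" by (simp add: mult.commute)
  then have "x \<le> e" using l by simp
  then show thesis using that[of l] l x by (simp add: ennreal_leI)
qed

lemma V_unit_level: "f \<in> V \<Longrightarrow> \<exists>l>0. H f l \<le> 1"
  using H_shrinks[of f 1] by auto

lemma H_add:
  assumes "f \<in> borel_measurable \<nu>" "g \<in> borel_measurable \<nu>"
  shows "H (\<lambda>s. f s + g s) l \<le> ennreal Q * (H f l + H g l)"
proof -
  have "H (\<lambda>s. f s + g s) l \<le> (\<integral>\<^sup>+ s. ennreal Q * (G s ((1 / l) *\<^sub>R f s) + G s ((1 / l) *\<^sub>R g s)) \<partial>\<nu>)"
    unfolding H_def by (intro nn_integral_mono) (simp add: scaleR_add_right G_add)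
  also have "\<dots> = ennreal Q * (H f l + H g l)"
    unfolding H_def using H_measurable_integrand[OF assms(1)] H_measurable_integrand[OF assms(2)]
    by (simp add: nn_integral_cmult nn_integral_add)
  finally show ?thesis .
qed

lemma H_minus: "H (\<lambda>s. - f s) l = H f l"
  unfolding H_def by (intro nn_integral_cong) (simp add: G_minus)

lemma H_diff:
  assumes "f \<in> borel_measurable \<nu>" "g \<in> borel_measurable \<nu>"
  shows "H (\<lambda>s. f s - g s) l \<le> ennreal Q * (H f l + H g l)"
  using H_add[of f "\<lambda>s. - g s" l] assms by (simp add: H_minus)

lemma H_diff_commute: "H (\<lambda>s. f s - g s) l = H (\<lambda>s. g s - f s) l"
  using H_minus[of "\<lambda>s. f s - g s" l] by simp

lemma H_scaleR:
  assumes "c \<noteq> 0"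
  shows "H (\<lambda>s. c *\<^sub>R f s) l = H f (l / \<bar>c\<bar>)"
proof (cases "c > 0")
  case True
  then show ?thesis by (simp add: H_def)
next
  case False
  then have "(c / l) *\<^sub>R f s = - ((\<bar>c\<bar> / l) *\<^sub>R f s)" for s by simp
  then show ?thesis unfolding H_def using assms by (intro nn_integral_cong) (simp add: G_minus)
qed

lemma H_zero: "H (\<lambda>s. 0) l = 0"
proof -
  have "H (\<lambda>s. 0) l = (\<integral>\<^sup>+ s. 0 \<partial>\<nu>)"
    unfolding H_def by (intro nn_integral_cong) (simp add: G_zero)
  then show ?thesis by simp
qed

lemma H_cong_AE:
  assumes "AE s in \<nu>. f s = g s"
  shows "H f l = H g l"
  unfolding H_def using assms by (intro nn_integral_cong_AE) auto

lemma zero_in_V: "(\<lambda>s. 0) \<in> V" by (auto simp: V_def H_zero intro!: exI[of _ 1])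

lemma add_in_V: "f \<in> V \<Longrightarrow> g \<in> V \<Longrightarrow> (\<lambda>s. f s + g s) \<in> V"
  using H_add[of f g 1] V_H_finite[of f 1] V_H_finite[of g 1]
  by (auto simp: V_def intro!: exI[of _ 1] le_less_trans[OF H_add] ennreal_mult_less_top[THEN iffD2])

lemma scaleR_in_V: "f \<in> V \<Longrightarrow> (\<lambda>s. c *\<^sub>R f s) \<in> V"
proof (cases "c = 0")
  case False
  assume "f \<in> V"
  then show ?thesis
    using H_scaleR[OF False, of f 1] V_H_finite[of f "1 / \<bar>c\<bar>"] False
    by (auto simp: V_def intro!: exI[of _ 1])
qed (simp add: zero_in_V)

lemma diff_in_V: "f \<in> V \<Longrightarrow> g \<in> V \<Longrightarrow> (\<lambda>s. f s - g s) \<in> V"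
  using add_in_V[of f "\<lambda>s. (-1) *\<^sub>R g s"] scaleR_in_V[of g "-1"] by simp

lemma N_bdd: "bdd_below {l. 0 < l \<and> H f l \<le> 1}" by (intro bdd_belowI[of _ 0]) auto

lemma N_le: "0 < l \<Longrightarrow> H f l \<le> 1 \<Longrightarrow> N f \<le> l"
  unfolding N_def by (intro cInf_lower N_bdd) auto

lemma N_nonneg: "f \<in> V \<Longrightarrow> 0 \<le> N f"
  unfolding N_def using V_unit_level[of f] by (intro cInf_greatest) auto

lemma H_above_N:
  assumes "f \<in> V" "N f < l"
  shows "H f l \<le> 1"
proof -
  have "{l. 0 < l \<and> H f l \<le> 1} \<noteq> {}" using V_unit_level[OF assms(1)] by auto
  then obtain l' where l': "0 < l'" "H f l' \<le> 1" "l' < l"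
    using assms(2) cInf_less_iff[OF _ N_bdd] unfolding N_def by auto
  then show ?thesis using H_antimono[OF V_measurable[OF assms(1)] l'(1), of l] by (auto intro: order_trans)
qed

lemma H_below_N: "0 < l \<Longrightarrow> l < N f \<Longrightarrow> 1 < H f l"
  using N_le[of l f] by force

text \<open>Scaling makes \<open>H f\<close> continuous in the level: on either side of \<open>N f\<close> it is at most 1, respectively above 1,
  and a change of the level by a factor \<open>c\<close> close to 1 changes the value at most by \<open>c\<^sup>b\<close>.\<close>

lemma H_at_N:
  assumes f: "f \<in> V" and pos: "0 < N f"
  shows "H f (N f) = 1"
proof -
  have fm: "f \<in> borel_measurable \<nu>" using f V_measurable by blast
  define c where "c n = 1 + 1 / real (Suc n)" for n
  have c1: "c n > 1" for n by (simp add: c_def)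
  have "(\<lambda>n. 1 / real (Suc n)) \<longlonglongrightarrow> 0" by (rule LIMSEQ_Suc[OF lim_1_over_n])
  then have "(\<lambda>n. c n powr b) \<longlonglongrightarrow> (1 + 0) powr b"
    unfolding c_def by (intro tendsto_intros) auto
  then have lim: "(\<lambda>n. c n powr b) \<longlonglongrightarrow> 1" by simp
  obtain h where h: "H f (N f) = ennreal h" "h \<ge> 0"
    using V_H_finite[OF f pos] by (cases "H f (N f)") auto
  have "h \<le> c n powr b" for n
  proof -
    have "N f < c n * N f" using c1[of n] pos by simp
    then have "H f (N f) \<le> ennreal (c n powr b) * H f (c n * N f)" "H f (c n * N f) \<le> 1"
      using H_scale_le[OF fm pos, of "c n * N f"] pos H_above_N[OF f] by auto
    then have "H f (N f) \<le> ennreal (c n powr b) * 1" by (meson mult_left_mono order_trans zero_le)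
    then show ?thesis using h by simp
  qed
  then have "h \<le> 1" using LIMSEQ_le_const[OF lim] by blast
  moreover have "1 \<le> c n powr b * h" for n
  proof -
    have l: "0 < N f / c n" "N f / c n < N f" using c1[of n] pos by (auto simp: field_simps)
    then have "1 < H f (N f / c n)" by (rule H_below_N)
    also have "\<dots> \<le> ennreal (c n powr b) * H f (N f)"
      using H_scale_le[OF fm l(1), of "N f"] l pos c1[of n] by simp
    finally have "1 \<le> ennreal (c n powr b * h)" using h by (simp add: ennreal_mult)
    then show ?thesis using h by (simp add: ennreal_1[symmetric] del: ennreal_1)
  qed
  then have "1 \<le> 1 * h" by (intro LIMSEQ_le_const[OF tendsto_mult[OF lim tendsto_const]]) blast
  ultimately show ?thesis using h by simp
qed

text \<open>Here \<open>H f\<close> is at most 1 at every level, and scaling amplifies any positive value beyond 1.\<close>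

lemma H_N_zero:
  assumes f: "f \<in> V" and N0: "N f = 0" and l: "0 < l"
  shows "H f l = 0"
proof -
  have fm: "f \<in> borel_measurable \<nu>" using f V_measurable by blast
  obtain h where h: "H f l = ennreal h" "h \<ge> 0" using V_H_finite[OF f l] by (cases "H f l") auto
  have bd: "k powr a * h \<le> 1" if "k \<ge> 1" for k
  proof -
    have "ennreal (k powr a) * H f l \<le> H f (l / k)"
      using H_scale_ge[OF fm, of "l / k" l] that l by (simp add: divide_le_eq)
    also have "\<dots> \<le> 1" using that l N0 by (intro H_above_N[OF f]) simp
    finally have "ennreal (k powr a * h) \<le> 1" using h by (simp add: ennreal_mult)
    then show ?thesis by simp
  qed
  have "h = 0"
  proof (rule ccontr)
    assume "h \<noteq> 0"
    then have hp: "h > 0" using h by simp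
    define k where "k = max 1 ((2 / h) powr (1 / a))"
    have "2 / h = ((2 / h) powr (1 / a)) powr a" using hp a_pos by (simp add: powr_powr)
    also have "\<dots> \<le> k powr a" using a_pos by (intro powr_mono2) (auto simp: k_def)
    finally have "2 \<le> k powr a * h" using hp by (simp add: field_simps)
    then show False using bd[of k] by (simp add: k_def)
  qed
  then show ?thesis using h by simp
qed

text \<open>For a positive quasi-norm this is scaling from the level \<open>N f\<close>, where \<open>H f\<close> equals 1.\<close>

lemma H_N_bounds:
  assumes f: "f \<in> V" and l: "0 < l"
  shows "ennreal (min ((N f / l) powr a) ((N f / l) powr b)) \<le> H f l"
    and "H f l \<le> ennreal (max ((N f / l) powr a) ((N f / l) powr b))"
proof -
  have fm: "f \<in> borel_measurable \<nu>" using f V_measurable by blast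
  have "ennreal (min ((N f / l) powr a) ((N f / l) powr b)) \<le> H f l \<and>
    H f l \<le> ennreal (max ((N f / l) powr a) ((N f / l) powr b))"
  proof (cases "N f = 0")
    case True
    then show ?thesis using H_N_zero[OF f _ l] by simp
  next
    case False
    then have pos: "N f > 0" using N_nonneg[OF f] by simp
    show ?thesis
    proof (cases "l \<le> N f")
      case True
      then have "ennreal ((N f / l) powr a) \<le> H f l" "H f l \<le> ennreal ((N f / l) powr b)"
        using H_scale_le[OF fm l True] H_scale_ge[OF fm l True] H_at_N[OF f pos] by auto
      then show ?thesis
        using ennreal_leI[OF min.cobounded1] ennreal_leI[OF max.cobounded2] order_trans by metis
    next
      case False
      obtain h where h: "H f l = ennreal h" "h \<ge> 0" using V_H_finite[OF f l] by (cases "H f l") auto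
      have "1 \<le> (l / N f) powr b * h" "(l / N f) powr a * h \<le> 1"
        using H_scale_le[OF fm pos, of l] H_scale_ge[OF fm pos, of l] False H_at_N[OF f pos] h
        by (simp_all add: ennreal_mult[symmetric] ennreal_1[symmetric] del: ennreal_1)
      then have "(N f / l) powr b \<le> h" "h \<le> (N f / l) powr a"
        using pos l by (simp_all add: powr_divide field_simps)
      then show ?thesis using h by (auto intro!: ennreal_leI)
    qed
  qed
  then show "ennreal (min ((N f / l) powr a) ((N f / l) powr b)) \<le> H f l"
    and "H f l \<le> ennreal (max ((N f / l) powr a) ((N f / l) powr b))" by auto
qed

lemma N_cong_AE: "AE s in \<nu>. f s = g s \<Longrightarrow> N f = N g"
  unfolding N_def using H_cong_AE by simp

lemma N_eq_0_iff:
  assumes f: "f \<in> V"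
  shows "N f = 0 \<longleftrightarrow> (AE s in \<nu>. f s = 0)"
proof
  assume "N f = 0"
  then have "H f 1 = 0" using H_N_zero[OF f] by simp
  then have "AE s in \<nu>. G s (f s) = 0"
    unfolding H_def using H_measurable_integrand[OF V_measurable[OF f], of 1]
    by (simp add: nn_integral_0_iff_AE)
  then show "AE s in \<nu>. f s = 0" by (rule AE_mp) (auto simp: G_eq_0_iff)
next
  assume "AE s in \<nu>. f s = 0"
  then have "H f l = 0" for l using H_cong_AE[of f "\<lambda>s. 0"] by (simp add: H_zero)
  then have "N f \<le> l" if "l > 0" for l using that by (intro N_le) auto
  then show "N f = 0" using N_nonneg[OF f] by (meson dense_ge order_antisym)
qed

lemma N_scaleR:
  assumes f: "f \<in> V"
  shows "N (\<lambda>s. c *\<^sub>R f s) = \<bar>c\<bar> * N f"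
proof (cases "c = 0")
  case True
  then show ?thesis using N_eq_0_iff[OF zero_in_V] by simp
next
  case False
  have le: "N (\<lambda>s. d *\<^sub>R g s) \<le> \<bar>d\<bar> * N g" if g: "g \<in> V" and d: "d \<noteq> 0" for d g
  proof (rule dense_ge)
    fix l assume "\<bar>d\<bar> * N g < l"
    then have "N g < l / \<bar>d\<bar>" using d by (simp add: field_simps)
    moreover have "0 < l" using \<open>\<bar>d\<bar> * N g < l\<close> N_nonneg[OF g] by (meson abs_ge_zero le_less_trans mult_nonneg_nonneg)
    ultimately show "N (\<lambda>s. d *\<^sub>R g s) \<le> l"
      using H_above_N[OF g, of "l / \<bar>d\<bar>"] by (intro N_le) (auto simp: H_scaleR[OF d])
  qed
  have "N f \<le> \<bar>1 / c\<bar> * N (\<lambda>s. c *\<^sub>R f s)"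
    using le[OF scaleR_in_V[OF f], of "1 / c" c] False by simp
  then have "\<bar>c\<bar> * N f \<le> N (\<lambda>s. c *\<^sub>R f s)" using False by (simp add: field_simps)
  then show ?thesis using le[OF f False] by simp
qed

text \<open>Enlarging the level by \<open>T = (2Q)\<close> to the power \<open>1/a\<close> divides each of the two modulars by \<open>2Q\<close>, which
  compensates the constant \<open>Q\<close> of the quasi-additivity and the two summands.\<close>

lemma N_quasi_triangle: "\<exists>T\<ge>1. \<forall>f\<in>V. \<forall>g\<in>V. N (\<lambda>s. f s + g s) \<le> T * (N f + N g)"
proof -
  define T where "T = (2 * Q) powr (1 / a)"
  have T1: "T \<ge> 1" using Q a_pos by (simp add: T_def ge_one_powr_ge_zero)
  have Ta: "T powr a = 2 * Q" using Q a_pos by (simp add: T_def powr_powr)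
  have "N (\<lambda>s. f s + g s) \<le> T * (N f + N g)" if fg: "f \<in> V" "g \<in> V" for f g
  proof (rule dense_ge)
    fix m assume m: "T * (N f + N g) < m"
    define l where "l = m / T"
    have l: "N f + N g < l" "m = T * l" using m T1 by (auto simp: l_def field_simps)
    have lpos: "0 < l" using l N_nonneg fg by (meson add_nonneg_nonneg le_less_trans)
    have small: "H h (T * l) \<le> ennreal (1 / (2 * Q))" if h: "h \<in> V" "N h < l" for h
    proof -
      obtain x where x: "H h (T * l) = ennreal x" "x \<ge> 0"
        using V_H_finite[OF h(1), of "T * l"] lpos T1 by (cases "H h (T * l)") auto
      have "ennreal (T powr a) * H h (T * l) \<le> H h l"
        using H_scale_ge[OF V_measurable[OF h(1)] lpos, of "T * l"] T1 lpos by simp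
      also have "\<dots> \<le> 1" using H_above_N[OF h] .
      finally have "2 * Q * x \<le> 1"
        using x Q by (simp add: Ta ennreal_mult[symmetric] ennreal_1[symmetric] del: ennreal_1)
      then have "x \<le> 1 / (2 * Q)" using Q by (simp add: field_simps)
      then show ?thesis using x by (simp add: ennreal_leI)
    qed
    have "H (\<lambda>s. f s + g s) m \<le> ennreal Q * (H f m + H g m)"
      by (intro H_add V_measurable fg)
    also have "\<dots> \<le> ennreal Q * (ennreal (1 / (2 * Q)) + ennreal (1 / (2 * Q)))"
      unfolding l(2) using l(1) N_nonneg[OF fg(1)] N_nonneg[OF fg(2)]
      by (intro mult_left_mono add_mono small fg) auto
    also have "\<dots> = 1"
      using Q by (simp add: ennreal_plus[symmetric] ennreal_mult[symmetric] del: ennreal_plus)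
    finally show "N (\<lambda>s. f s + g s) \<le> m" using l lpos T1 by (intro N_le) auto
  qed
  then show ?thesis using T1 by blast
qed

theorem quasi_norm_ae_N: "quasi_norm_ae \<nu> V N"
  unfolding quasi_norm_ae_def
  using zero_in_V add_in_V scaleR_in_V N_cong_AE N_nonneg N_eq_0_iff N_scaleR N_quasi_triangle
  by blast

lemma N_tendsto_0_iff:
  assumes g: "\<And>n. g n \<in> V"
  shows "(\<lambda>n. N (g n)) \<longlonglongrightarrow> 0 \<longleftrightarrow> (\<lambda>n. H (g n) 1) \<longlonglongrightarrow> 0"
proof
  assume "(\<lambda>n. N (g n)) \<longlonglongrightarrow> 0"
  then have "(\<lambda>n. max (N (g n) powr a) (N (g n) powr b)) \<longlonglongrightarrow> max (0 powr a) (0 powr b)"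
    using N_nonneg[OF g] a_pos b_pos by (intro tendsto_max tendsto_powr') auto
  then have "(\<lambda>n. ennreal (max (N (g n) powr a) (N (g n) powr b))) \<longlonglongrightarrow> ennreal 0"
    by (intro tendsto_ennrealI) simp
  moreover have "H (g n) 1 \<le> ennreal (max (N (g n) powr a) (N (g n) powr b))" for n
    using H_N_bounds(2)[OF g[of n], of 1] by simp
  ultimately show "(\<lambda>n. H (g n) 1) \<longlonglongrightarrow> 0"
    using ennreal_tendsto_0_le[of "\<lambda>n. H (g n) 1" "\<lambda>n. ennreal (max (N (g n) powr a) (N (g n) powr b))"] by simp
next
  assume lim: "(\<lambda>n. H (g n) 1) \<longlonglongrightarrow> 0"
  show "(\<lambda>n. N (g n)) \<longlonglongrightarrow> 0"
  proof (rule LIMSEQ_I)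
    fix e :: real assume e: "e > 0"
    define d where "d = min (e / 2) 1"
    have d: "0 < d" "d \<le> 1" "d < e" using e by (auto simp: d_def)
    have "0 < ennreal (d powr b)" using d by simp
    from order_tendstoD(2)[OF lim this] obtain k where k: "\<And>n. n \<ge> k \<Longrightarrow> H (g n) 1 < ennreal (d powr b)"
      by (auto simp: eventually_sequentially)
    have "norm (N (g n) - 0) < e" if n: "n \<ge> k" for n
    proof -
      have "H (g n) d \<le> ennreal ((1 / d) powr b) * H (g n) 1"
        using H_scale_le[OF V_measurable[OF g] d(1,2)] by simp
      also have "\<dots> \<le> ennreal ((1 / d) powr b) * ennreal (d powr b)"
        using k[OF n] by (intro mult_left_mono) auto
      also have "\<dots> = 1" using d by (simp add: ennreal_mult[symmetric] powr_divide)
      finally have "N (g n) \<le> d" by (rule N_le[OF d(1)])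
      then show ?thesis using N_nonneg[OF g[of n]] d by simp
    qed
    then show "\<exists>no. \<forall>n\<ge>no. norm (N (g n) - 0) < e" by blast
  qed
qed

text \<open>Fatou's lemma; closed sublevel sets make each \<open>G s\<close> lower semicontinuous.\<close>

lemma H_Fatou:
  assumes F: "\<And>n. F n \<in> borel_measurable \<nu>" and f: "f \<in> borel_measurable \<nu>"
    and conv: "AE s in \<nu>. (\<lambda>n. F n s) \<longlonglongrightarrow> f s"
    and le: "\<forall>\<^sub>F n in sequentially. H (F n) l \<le> c"
  shows "H f l \<le> c"
proof -
  have "H f l \<le> (\<integral>\<^sup>+ s. liminf (\<lambda>n. G s ((1 / l) *\<^sub>R F n s)) \<partial>\<nu>)"
    unfolding H_def
  proof (rule nn_integral_mono_AE, use conv in \<open>rule AE_mp\<close>, intro AE_I2 impI)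
    fix s assume s: "s \<in> space \<nu>" and lim: "(\<lambda>n. F n s) \<longlonglongrightarrow> f s"
    have lim': "(\<lambda>n. (1 / l) *\<^sub>R F n s) \<longlonglongrightarrow> (1 / l) *\<^sub>R f s" by (intro tendsto_intros lim)
    show "G s ((1 / l) *\<^sub>R f s) \<le> liminf (\<lambda>n. G s ((1 / l) *\<^sub>R F n s))"
    proof (subst le_Liminf_iff, intro allI impI)
      fix y assume "y < G s ((1 / l) *\<^sub>R f s)"
      then obtain z where z: "y < z" "z < G s ((1 / l) *\<^sub>R f s)" using dense by blast
      then have "z \<noteq> \<infinity>" by auto
      then obtain t where t: "z = ennreal t" "t \<ge> 0" by (cases z) auto
      have "t > 0" using z t by (metis ennreal_0 less_eq_real_def not_less_zero)
      have "open (- {v. G s v \<le> ennreal t})" using G_lsc[OF s \<open>t > 0\<close>] by (rule open_Compl)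
      moreover have "(1 / l) *\<^sub>R f s \<in> - {v. G s v \<le> ennreal t}" using z t by auto
      ultimately have "\<forall>\<^sub>F n in sequentially. (1 / l) *\<^sub>R F n s \<in> - {v. G s v \<le> ennreal t}"
        using lim' topological_tendstoD by blast
      then show "\<forall>\<^sub>F n in sequentially. y < G s ((1 / l) *\<^sub>R F n s)"
        by (rule eventually_mono) (use z t in auto)
    qed
  qed
  also have "\<dots> \<le> liminf (\<lambda>n. H (F n) l)"
    unfolding H_def by (intro nn_integral_liminf H_measurable_integrand F)
  also have "\<dots> \<le> c"
    using le by (intro order_trans[OF Liminf_le_Limsup Limsup_bounded]) auto
  finally show ?thesis .
qed

lemma V_of_H_bound: "f \<in> borel_measurable \<nu> \<Longrightarrow> 0 < l \<Longrightarrow> H f l \<le> ennreal c \<Longrightarrow> f \<in> V"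
  using le_less_trans[of "H f l" "ennreal c" \<infinity>] by (auto simp: V_def)

text \<open>Almost everywhere convergence along one subsequence suffices: Fatou's lemma in the second index of
  the Cauchy condition bounds the distance to the limit.\<close>

lemma quasi_limit:
  assumes F: "\<And>n. F n \<in> V" and f: "f \<in> borel_measurable \<nu>"
    and r: "filterlim r at_top sequentially" "AE s in \<nu>. (\<lambda>k. F (r k) s) \<longlonglongrightarrow> f s"
    and cauchy: "\<And>e. e > 0 \<Longrightarrow> \<exists>k. \<forall>m\<ge>k. \<forall>n\<ge>k. N (\<lambda>s. F m s - F n s) < e"
  shows "f \<in> V" "(\<lambda>n. N (\<lambda>s. F n s - f s)) \<longlonglongrightarrow> 0"
proof -
  have *: "\<exists>k. \<forall>n\<ge>k. H (\<lambda>s. F n s - f s) e \<le> 1" if e: "e > 0" for e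
  proof -
    obtain k where k: "\<And>m n. m \<ge> k \<Longrightarrow> n \<ge> k \<Longrightarrow> N (\<lambda>s. F m s - F n s) < e" using cauchy[OF e] by blast
    have "H (\<lambda>s. F n s - f s) e \<le> 1" if n: "n \<ge> k" for n
    proof (rule H_Fatou[where F = "\<lambda>j s. F n s - F (r j) s"])
      show "AE s in \<nu>. (\<lambda>j. F n s - F (r j) s) \<longlonglongrightarrow> F n s - f s"
        using r(2) by (rule AE_mp) (auto intro!: AE_I2 tendsto_intros)
      have "\<forall>\<^sub>F j in sequentially. k \<le> r j" using r(1) by (simp add: filterlim_at_top)
      then show "\<forall>\<^sub>F j in sequentially. H (\<lambda>s. F n s - F (r j) s) e \<le> 1"
        by (rule eventually_mono) (use n in \<open>auto intro!: H_above_N diff_in_V F k\<close>)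
    qed (use F V_measurable f in auto)
    then show ?thesis by blast
  qed
  from *[of 1] obtain n where n: "H (\<lambda>s. F n s - f s) 1 \<le> 1" by auto
  have "(\<lambda>s. F n s - f s) \<in> V"
    using n V_measurable[OF F] f by (intro V_of_H_bound[of _ 1 1]) auto
  from diff_in_V[OF F[of n] this] show fV: "f \<in> V" by simp
  show "(\<lambda>n. N (\<lambda>s. F n s - f s)) \<longlonglongrightarrow> 0"
  proof (rule LIMSEQ_I)
    fix e :: real assume e: "e > 0"
    then obtain k where k: "\<And>n. n \<ge> k \<Longrightarrow> H (\<lambda>s. F n s - f s) (e / 2) \<le> 1" using *[of "e / 2"] by auto
    have "norm (N (\<lambda>s. F n s - f s) - 0) < e" if "n \<ge> k" for n
      using N_le[OF _ k[OF that]] N_nonneg[OF diff_in_V[OF F fV], of n] e by simp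
    then show "\<exists>no. \<forall>n\<ge>no. norm (N (\<lambda>s. F n s - f s) - 0) < e" by blast
  qed
qed

text \<open>Once the increments are below 1, the lower norm bound is their \<open>b\<close>-th power, so geometric decay
  of the modular is geometric decay of the increments.\<close>

lemma summable_of_G_bound:
  assumes s: "s \<in> space \<nu>" and K: "0 \<le> K" and bd: "\<And>k. G s (v k) \<le> ennreal (K * (1 / 2) ^ k)"
  shows "summable (\<lambda>k. norm (v k))"
proof -
  define q where "q = (1 / 2 :: real) powr (1 / b)"
  have q: "0 < q" "q < 1" using b_pos powr_less_mono2[of "1 / b" "1 / 2" 1] by (auto simp: q_def)
  have bnd: "\<kappa> * min (norm (v k) powr a) (norm (v k) powr b) \<le> K * (1 / 2) ^ k" for k
  proof -
    have "ennreal (\<kappa> * min (norm (v k) powr a) (norm (v k) powr b)) \<le> ennreal (K * (1 / 2) ^ k)"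
      by (rule order_trans[OF G_lower[OF s] bd])
    moreover have "0 \<le> K * (1 / 2) ^ k" using K by simp
    ultimately show ?thesis by (simp only: ennreal_le_iff)
  qed
  have "(\<lambda>k. K / \<kappa> * (1 / 2 :: real) ^ k) \<longlonglongrightarrow> K / \<kappa> * 0"
    by (rule tendsto_mult[OF tendsto_const LIMSEQ_power_zero]) simp
  then have "\<forall>\<^sub>F k in sequentially. K / \<kappa> * (1 / 2 :: real) ^ k < 1"
    by (rule order_tendstoD) simp
  then have "\<forall>\<^sub>F k in sequentially. norm (norm (v k)) \<le> (K / \<kappa>) powr (1 / b) * q ^ k"
  proof (rule eventually_mono)
    fix k assume k: "K / \<kappa> * (1 / 2 :: real) ^ k < 1"
    have le: "min (norm (v k) powr a) (norm (v k) powr b) \<le> K / \<kappa> * (1 / 2) ^ k"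
      using bnd[of k] \<kappa> by (simp add: field_simps)
    have n1: "norm (v k) < 1"
    proof (rule ccontr)
      assume "\<not> norm (v k) < 1"
      then have "1 \<le> min (norm (v k) powr a) (norm (v k) powr b)"
        using a_pos b_pos by (intro min.boundedI ge_one_powr_ge_zero) simp_all
      then show False using le k by linarith
    qed
    have "norm (v k) powr b \<le> norm (v k) powr a"
      using n1 ab by (intro powr_mono') simp_all
    then have "norm (v k) powr b \<le> K / \<kappa> * (1 / 2) ^ k" using le by simp
    then have "(norm (v k) powr b) powr (1 / b) \<le> (K / \<kappa> * (1 / 2) ^ k) powr (1 / b)"
      using b_pos by (intro powr_mono2) auto
    also have "\<dots> = (K / \<kappa>) powr (1 / b) * ((1 / 2) ^ k) powr (1 / b)"
      using K \<kappa> by (intro powr_mult)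
    also have "((1 / 2 :: real) ^ k) powr (1 / b) = q ^ k"
      unfolding q_def by (rule power_powr_commute) simp
    finally show "norm (norm (v k)) \<le> (K / \<kappa>) powr (1 / b) * q ^ k"
      using b_pos by (simp add: powr_powr)
  qed
  moreover have "summable (\<lambda>k. (K / \<kappa>) powr (1 / b) * q ^ k)"
    using q by (intro summable_mult summable_geometric) auto
  ultimately show ?thesis by (rule summable_comparison_test_ev)
qed

text \<open>The usual proof for Lebesgue spaces: increments of a fast subsequence have modulars at most \<open>4\<close> to the power \<open>-j\<close>,
  so that the sum of \<open>2\<^sup>j\<close> times the integrands is finite almost everywhere and the subsequence converges
  pointwise.\<close>

theorem quasi_complete_N: "quasi_complete V N"
  unfolding quasi_complete_def
proof (intro allI impI)
  fix F :: "nat \<Rightarrow> 's \<Rightarrow> 'v"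
  assume F: "\<forall>n. F n \<in> V" and cauchy: "\<forall>e>0. \<exists>k. \<forall>m\<ge>k. \<forall>n\<ge>k. N (\<lambda>s. F m s - F n s) < e"
  have Fm[measurable]: "F n \<in> borel_measurable \<nu>" for n using F V_measurable by blast
  have "\<exists>k. \<forall>m\<ge>k. \<forall>n\<ge>k. H (\<lambda>s. F m s - F n s) 1 \<le> ennreal ((1 / 4) ^ j)" for j
  proof -
    define e where "e = ((1 / 4) ^ j :: real) powr (1 / a)"
    have e: "0 < e" "e \<le> 1" using a_pos by (auto simp: e_def intro!: powr_le1 power_le_one)
    obtain k where k: "\<And>m n. m \<ge> k \<Longrightarrow> n \<ge> k \<Longrightarrow> N (\<lambda>s. F m s - F n s) < e" using cauchy e by blast
    have "H (\<lambda>s. F m s - F n s) 1 \<le> ennreal ((1 / 4) ^ j)" if "m \<ge> k" "n \<ge> k" for m n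
    proof -
      let ?g = "\<lambda>s. F m s - F n s"
      have g: "?g \<in> V" using F diff_in_V by blast
      have "H ?g 1 \<le> ennreal (max (N ?g powr a) (N ?g powr b))" using H_N_bounds(2)[OF g, of 1] by simp
      also have "max (N ?g powr a) (N ?g powr b) \<le> e powr a"
        using k[OF that] N_nonneg[OF g] e ab a_pos b_pos
        by (auto intro!: powr_mono2 order_trans[OF powr_mono2[of b _ e] powr_mono'])
      also have "e powr a = (1 / 4) ^ j" using a_pos by (simp add: e_def powr_powr)
      finally show ?thesis by (simp add: ennreal_leI)
    qed
    then show ?thesis by blast
  qed
  then obtain k where k: "\<And>j m n. m \<ge> k j \<Longrightarrow> n \<ge> k j \<Longrightarrow> H (\<lambda>s. F m s - F n s) 1 \<le> ennreal ((1 / 4) ^ j)"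
    by metis
  \<comment> \<open>summing the thresholds makes the subsequence eventually dominate each of them\<close>
  define r where "r j = j + (\<Sum>i\<le>j. k i)" for j
  have r: "r j \<ge> k j" "r (Suc j) \<ge> k j" "r j \<ge> j" for j
    using member_le_sum[of j "{..j}" k] by (auto simp: r_def)
  have rlim: "filterlim r at_top sequentially"
    by (rule filterlim_at_top_mono[OF filterlim_ident]) (use r in auto)
  let ?g = "\<lambda>j s. F (r (Suc j)) s - F (r j) s"
  have gm[measurable]: "(\<lambda>s. G s (?g j s)) \<in> borel_measurable \<nu>" for j
    by (intro G_measurable) auto
  have int: "(\<integral>\<^sup>+ s. ennreal (2 ^ j) * G s (?g j s) \<partial>\<nu>) \<le> ennreal ((1 / 2) ^ j)" for j
  proof -
    have "(\<integral>\<^sup>+ s. ennreal (2 ^ j) * G s (?g j s) \<partial>\<nu>) = ennreal (2 ^ j) * H (?g j) 1"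
      by (simp add: nn_integral_cmult H_def)
    also have "\<dots> \<le> ennreal (2 ^ j) * ennreal ((1 / 4) ^ j)"
      using k[OF r(2) r(1)] by (intro mult_left_mono) auto
    also have "\<dots> = ennreal ((1 / 2) ^ j)"
      by (simp add: ennreal_mult[symmetric] power_mult_distrib[symmetric])
    finally show ?thesis .
  qed
  have "(\<integral>\<^sup>+ s. (\<Sum>j. ennreal (2 ^ j) * G s (?g j s)) \<partial>\<nu>) = (\<Sum>j. \<integral>\<^sup>+ s. ennreal (2 ^ j) * G s (?g j s) \<partial>\<nu>)"
    by (intro nn_integral_suminf) auto
  also have "\<dots> \<le> (\<Sum>j. ennreal ((1 / 2) ^ j))" by (intro suminf_le int) auto
  also have "\<dots> < \<infinity>"
    by (subst suminf_ennreal2) (auto simp: summable_geometric)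
  finally have "AE s in \<nu>. (\<Sum>j. ennreal (2 ^ j) * G s (?g j s)) \<noteq> \<infinity>"
    by (intro nn_integral_PInf_AE) auto
  then have ae: "AE s in \<nu>. convergent (\<lambda>j. F (r j) s)"
  proof (rule AE_mp, intro AE_I2 impI)
    fix s assume s: "s \<in> space \<nu>" and fin: "(\<Sum>j. ennreal (2 ^ j) * G s (?g j s)) \<noteq> \<infinity>"
    obtain K where K: "(\<Sum>j. ennreal (2 ^ j) * G s (?g j s)) = ennreal K" "K \<ge> 0"
      using fin by (cases "(\<Sum>j. ennreal (2 ^ j) * G s (?g j s))") auto
    have "G s (?g j s) \<le> ennreal (K * (1 / 2) ^ j)" for j
    proof -
      have "ennreal (2 ^ j) * G s (?g j s) \<le> ennreal K"
        unfolding K(1)[symmetric] using sum_le_suminf[of "\<lambda>j. ennreal (2 ^ j) * G s (?g j s)" "{j}"] by simp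
      then have "ennreal ((1 / 2) ^ j) * (ennreal (2 ^ j) * G s (?g j s)) \<le> ennreal ((1 / 2) ^ j) * ennreal K"
        by (rule mult_left_mono) simp
      moreover have "ennreal ((1 / 2) ^ j) * ennreal (2 ^ j) = 1"
        by (simp add: ennreal_mult[symmetric] power_mult_distrib[symmetric])
      moreover have "ennreal ((1 / 2) ^ j) * ennreal K = ennreal (K * (1 / 2) ^ j)"
        using K(2) by (subst ennreal_mult[symmetric]) (simp_all add: mult.commute)
      ultimately show ?thesis by (simp only: mult.assoc[symmetric] mult_1)
    qed
    then have "summable (\<lambda>j. norm (?g j s))" by (rule summable_of_G_bound[OF s K(2)])
    then have "summable (\<lambda>j. ?g j s)" by (rule summable_norm_cancel)
    then have "convergent (\<lambda>n. \<Sum>j<n. ?g j s)" by (simp add: summable_iff_convergent)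
    then have "convergent (\<lambda>n. F (r n) s - F (r 0) s)"
      by (simp add: sum_lessThan_telescope[where f = "\<lambda>j. F (r j) s"])
    then have "convergent (\<lambda>n. F (r n) s - F (r 0) s + F (r 0) s)"
      by (rule convergent_add[OF _ convergent_const])
    then show "convergent (\<lambda>j. F (r j) s)" by simp
  qed
  define f where "f s = lim (\<lambda>j. F (r j) s)" for s
  have "f \<in> borel_measurable \<nu>" unfolding f_def by measurable
  moreover have "AE s in \<nu>. (\<lambda>j. F (r j) s) \<longlonglongrightarrow> f s"
    using ae by (rule AE_mp) (simp add: f_def convergent_LIMSEQ_iff)
  ultimately show "\<exists>f\<in>V. (\<lambda>n. N (\<lambda>s. F n s - f s)) \<longlonglongrightarrow> 0"
    using quasi_limit[of F f r] F rlim cauchy by blast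
qed

text \<open>The modular need not be monotone in the norm, so approximants with norms bounded by that of \<open>f\<close> need not
  have modulars dominated by that of \<open>f\<close>.  Instead \<open>f\<close> is cut off outside a set of
  finite measure on which it is bounded.  There the norm bound of \<open>G\<close> provides an integrable majorant
  for the approximation error, and outside the approximant vanishes, so that the error is the modular
  of the remaining part of \<open>f\<close>.\<close>

theorem simple_functions_dense:
  assumes sf: "sigma_finite_measure \<nu>" and f: "f \<in> V"
  obtains F where "\<And>n. simple_function \<nu> (F n) \<and> emeasure \<nu> {s \<in> space \<nu>. F n s \<noteq> 0} < \<infinity>"
    "\<And>s. s \<in> space \<nu> \<Longrightarrow> (\<lambda>n. F n s) \<longlonglongrightarrow> f s"
    "\<And>n. F n \<in> V" "(\<lambda>n. N (\<lambda>s. F n s - f s)) \<longlonglongrightarrow> 0"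
proof -
  interpret sigma_finite_measure \<nu> by fact
  have fm[measurable]: "f \<in> borel_measurable \<nu>" using f V_measurable by blast
  obtain A :: "nat \<Rightarrow> 's set" where A: "range A \<subseteq> sets \<nu>" "(\<Union>i. A i) = space \<nu>"
    "\<And>i. emeasure \<nu> (A i) \<noteq> \<infinity>" "incseq A"
    using sigma_finite_incseq by metis
  have [measurable]: "A i \<in> sets \<nu>" for i using A by auto
  obtain F0 where F0: "\<And>i. simple_function \<nu> (F0 i)" "\<And>x. x \<in> space \<nu> \<Longrightarrow> (\<lambda>i. F0 i x) \<longlonglongrightarrow> f x"
    "\<And>i x. x \<in> space \<nu> \<Longrightarrow> norm (F0 i x) \<le> 2 * norm (f x)"
    using borel_measurable_implies_sequence_metric[OF fm, of 0] by simp metis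
  have F0m[measurable]: "F0 i \<in> borel_measurable \<nu>" for i
    using F0(1) by (rule borel_measurable_simple_function)
  \<comment> \<open>on \<open>E k\<close> the measure is finite and \<open>f\<close> is bounded, so dominated convergence applies\<close>
  define E where "E k = {s \<in> A k. norm (f s) \<le> real k}" for k
  have E[measurable]: "E k \<in> sets \<nu>" for k
  proof -
    have "E k = A k \<inter> {s \<in> space \<nu>. norm (f s) \<le> real k}"
      using sets.sets_into_space[of "A k" \<nu>] by (auto simp: E_def)
    then show ?thesis by simp
  qed
  have limE: "(\<lambda>n. H (\<lambda>s. indicat_real (E k) s *\<^sub>R (F0 n s - f s)) 1) \<longlonglongrightarrow> 0" for k
  proof -
    define w where "w s = ennreal (\<bar>C\<bar> * max ((3 * real k) powr a) ((3 * real k) powr b)) * indicator (A k) s" for s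
    let ?u = "\<lambda>n s. G s (indicat_real (E k) s *\<^sub>R (F0 n s - f s))"
    have up: "?u n s \<le> ennreal (\<bar>C\<bar> * max (norm (indicat_real (E k) s *\<^sub>R (F0 n s - f s)) powr a)
        (norm (indicat_real (E k) s *\<^sub>R (F0 n s - f s)) powr b))" if "s \<in> space \<nu>" for n s
      by (rule order_trans[OF G_upper[OF that]]) (intro ennreal_leI mult_right_mono, auto simp: le_max_iff_disj)
    have "(\<lambda>n. \<integral>\<^sup>+ s. ?u n s \<partial>\<nu>) \<longlonglongrightarrow> (\<integral>\<^sup>+ s. 0 \<partial>\<nu>)"
    proof (rule nn_integral_dominated_convergence[where w = w])
      show "?u n \<in> borel_measurable \<nu>" for n by (intro G_measurable) measurable
      show "w \<in> borel_measurable \<nu>" unfolding w_def by measurable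
      show "(\<integral>\<^sup>+ s. w s \<partial>\<nu>) < \<infinity>"
        using A(3)[of k] by (simp add: w_def nn_integral_cmult_indicator ennreal_mult_less_top top.not_eq_extremum)
      show "AE s in \<nu>. ?u n s \<le> w s" for n
      proof (intro AE_I2)
        fix s assume s: "s \<in> space \<nu>"
        show "?u n s \<le> w s"
        proof (cases "s \<in> E k")
          case True
          then have "norm (F0 n s - f s) \<le> 3 * real k"
            using F0(3)[OF s, of n] norm_triangle_ineq4[of "F0 n s" "f s"] by (simp add: E_def)
          then have "max (norm (F0 n s - f s) powr a) (norm (F0 n s - f s) powr b)
              \<le> max ((3 * real k) powr a) ((3 * real k) powr b)"
            using a_pos b_pos by (intro max.mono powr_mono2) auto
          then have "ennreal (\<bar>C\<bar> * max (norm (F0 n s - f s) powr a) (norm (F0 n s - f s) powr b)) \<le> w s"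
            using True by (auto simp: w_def E_def intro!: ennreal_leI mult_left_mono)
          with up[OF s, of n] True show ?thesis by simp
        next
          case False
          then show ?thesis using G_zero[OF s] by simp
        qed
      qed
      show "AE s in \<nu>. (\<lambda>n. ?u n s) \<longlonglongrightarrow> 0"
      proof (intro AE_I2)
        fix s assume s: "s \<in> space \<nu>"
        let ?d = "\<lambda>n. norm (indicat_real (E k) s *\<^sub>R (F0 n s - f s))"
        have "?d \<longlonglongrightarrow> norm (indicat_real (E k) s *\<^sub>R (f s - f s))"
          by (intro tendsto_intros F0 s)
        then have d0: "?d \<longlonglongrightarrow> 0" by simp
        then have "(\<lambda>n. \<bar>C\<bar> * max (?d n powr a) (?d n powr b)) \<longlonglongrightarrow> \<bar>C\<bar> * max (0 powr a) (0 powr b)"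
          using a_pos b_pos by (intro tendsto_mult tendsto_const tendsto_max tendsto_powr') auto
        then have "(\<lambda>n. ennreal (\<bar>C\<bar> * max (?d n powr a) (?d n powr b))) \<longlonglongrightarrow> ennreal 0"
          by (intro tendsto_ennrealI) simp
        then show "(\<lambda>n. ?u n s) \<longlonglongrightarrow> 0"
          by - (rule ennreal_tendsto_0_le[OF up[OF s]], simp)
      qed
    qed auto
    then show ?thesis by (simp add: H_def)
  qed
  have "\<exists>n\<ge>k. H (\<lambda>s. indicat_real (E k) s *\<^sub>R (F0 n s - f s)) 1 \<le> ennreal (1 / real (Suc k))" for k
  proof -
    have "\<forall>\<^sub>F n in sequentially. H (\<lambda>s. indicat_real (E k) s *\<^sub>R (F0 n s - f s)) 1 < ennreal (1 / real (Suc k))"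
      using limE[of k] by (rule order_tendstoD) simp
    then show ?thesis using eventually_ge_at_top[of k]
      by (metis (mono_tags, lifting) eventually_at_top_linorder le_cases less_imp_le order_trans)
  qed
  then obtain r where r: "\<And>k. r k \<ge> k"
    "\<And>k. H (\<lambda>s. indicat_real (E k) s *\<^sub>R (F0 (r k) s - f s)) 1 \<le> ennreal (1 / real (Suc k))"
    by metis
  define F where "F k s = indicat_real (E k) s *\<^sub>R F0 (r k) s" for k s
  have Fm[measurable]: "F k \<in> borel_measurable \<nu>" for k unfolding F_def by measurable
  have F_simple: "simple_function \<nu> (F n) \<and> emeasure \<nu> {s \<in> space \<nu>. F n s \<noteq> 0} < \<infinity>" for n
  proof
    show "simple_function \<nu> (F n)"
      unfolding F_def using F0(1) E by (intro simple_function_compose2[where h = scaleR] simple_function_indicator) auto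
    have "{s \<in> space \<nu>. F n s \<noteq> 0} \<subseteq> A n" by (auto simp: F_def E_def indicator_def)
    moreover have "{s \<in> space \<nu>. F n s \<noteq> 0} \<in> sets \<nu>" by measurable
    ultimately have "emeasure \<nu> {s \<in> space \<nu>. F n s \<noteq> 0} \<le> emeasure \<nu> (A n)" by (intro emeasure_mono) auto
    then show "emeasure \<nu> {s \<in> space \<nu>. F n s \<noteq> 0} < \<infinity>"
      using A(3)[of n] by (auto simp: top_unique less_top)
  qed
  have ev: "\<forall>\<^sub>F k in sequentially. s \<in> E k" if s: "s \<in> space \<nu>" for s
  proof -
    have "s \<in> (\<Union>i. A i)" using s A(2) by simp
    then obtain i where i: "s \<in> A i" by (rule UN_E)
    obtain j where j: "norm (f s) \<le> real j" using real_arch_simple by blast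
    have "s \<in> E k" if "k \<ge> max i j" for k
      using i j that incseqD[OF A(4), of i k] unfolding E_def by fastforce
    then show ?thesis unfolding eventually_sequentially by blast
  qed
  have F_lim: "(\<lambda>n. F n s) \<longlonglongrightarrow> f s" if s: "s \<in> space \<nu>" for s
  proof -
    have "filterlim r at_top sequentially"
      by (rule filterlim_at_top_mono[OF filterlim_ident]) (use r in auto)
    then have "(\<lambda>k. F0 (r k) s) \<longlonglongrightarrow> f s" using filterlim_compose[OF F0(2)[OF s]] by blast
    moreover have "\<forall>\<^sub>F k in sequentially. F0 (r k) s = F k s"
      using ev[OF s] by (rule eventually_mono) (simp add: F_def)
    ultimately show ?thesis by (rule Lim_transform_eventually)
  qed
  have Hf: "(\<integral>\<^sup>+ s. G s (f s) \<partial>\<nu>) < \<infinity>" using V_H_finite[OF f, of 1] by (simp add: H_def)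
  have "(\<lambda>k. \<integral>\<^sup>+ s. G s (indicat_real (space \<nu> - E k) s *\<^sub>R f s) \<partial>\<nu>) \<longlonglongrightarrow> (\<integral>\<^sup>+ s. 0 \<partial>\<nu>)"
  proof (rule nn_integral_dominated_convergence[where w = "\<lambda>s. G s (f s)"])
    show "(\<lambda>s. G s (indicat_real (space \<nu> - E k) s *\<^sub>R f s)) \<in> borel_measurable \<nu>" for k
      by (intro G_measurable) measurable
    show "AE s in \<nu>. G s (indicat_real (space \<nu> - E k) s *\<^sub>R f s) \<le> G s (f s)" for k
      using G_zero by (intro AE_I2) (simp add: indicator_def)
    show "AE s in \<nu>. (\<lambda>k. G s (indicat_real (space \<nu> - E k) s *\<^sub>R f s)) \<longlonglongrightarrow> 0"
    proof (intro AE_I2)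
      fix s assume s: "s \<in> space \<nu>"
      have "\<forall>\<^sub>F k in sequentially. G s (indicat_real (space \<nu> - E k) s *\<^sub>R f s) = 0"
        using ev[OF s] by (rule eventually_mono) (simp add: G_zero[OF s])
      then show "(\<lambda>k. G s (indicat_real (space \<nu> - E k) s *\<^sub>R f s)) \<longlonglongrightarrow> 0" by (rule tendsto_eventually)
    qed
  qed (use Hf G_measurable[OF fm] in auto)
  then have tail: "(\<lambda>k. H (\<lambda>s. indicat_real (space \<nu> - E k) s *\<^sub>R f s) 1) \<longlonglongrightarrow> 0" by (simp add: H_def)
  have bound: "H (\<lambda>s. F k s - f s) 1
      \<le> ennreal Q * (ennreal (1 / real (Suc k)) + H (\<lambda>s. indicat_real (space \<nu> - E k) s *\<^sub>R f s) 1)" for k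
  proof -
    let ?u = "\<lambda>s. indicat_real (E k) s *\<^sub>R (F0 (r k) s - f s)"
    let ?v = "\<lambda>s. indicat_real (space \<nu> - E k) s *\<^sub>R f s"
    have "H (\<lambda>s. F k s - f s) 1 = H (\<lambda>s. ?u s - ?v s) 1"
      by (intro H_cong_AE AE_I2) (auto simp: F_def indicator_def)
    also have "\<dots> \<le> ennreal Q * (H ?u 1 + H ?v 1)" by (intro H_diff) measurable
    also have "\<dots> \<le> ennreal Q * (ennreal (1 / real (Suc k)) + H ?v 1)"
      using r(2)[of k] by (intro mult_left_mono add_mono) auto
    finally show ?thesis .
  qed
  have "(\<lambda>k. ennreal Q * (ennreal (1 / real (Suc k)) + H (\<lambda>s. indicat_real (space \<nu> - E k) s *\<^sub>R f s) 1))
      \<longlonglongrightarrow> ennreal Q * (ennreal 0 + 0)"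
    by (intro ennreal_tendsto_cmult tendsto_add tail tendsto_ennrealI LIMSEQ_Suc[OF lim_1_over_n]) auto
  then have H0: "(\<lambda>k. H (\<lambda>s. F k s - f s) 1) \<longlonglongrightarrow> 0"
    by - (rule ennreal_tendsto_0_le[OF bound], simp)
  have FV: "F k \<in> V" for k
  proof -
    have "H (\<lambda>s. indicat_real (space \<nu> - E k) s *\<^sub>R f s) 1 \<le> H f 1"
      unfolding H_def using G_zero by (intro nn_integral_mono) (simp add: indicator_def)
    also note V_H_finite[OF f, of 1]
    finally have "ennreal Q * (ennreal (1 / real (Suc k)) + H (\<lambda>s. indicat_real (space \<nu> - E k) s *\<^sub>R f s) 1) < \<infinity>"
      by (simp add: ennreal_mult_less_top)
    then have "H (\<lambda>s. F k s - f s) 1 < \<infinity>" using bound[of k] by (rule le_less_trans[rotated])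
    then have "(\<lambda>s. F k s - f s) \<in> V" by (auto simp: V_def intro!: exI[of _ 1])
    from add_in_V[OF this f] show ?thesis by simp
  qed
  have "(\<lambda>n. N (\<lambda>s. F n s - f s)) \<longlonglongrightarrow> 0"
    using H0 by (subst N_tendsto_0_iff) (auto intro: diff_in_V FV f)
  then show thesis using that[OF F_simple F_lim FV] by blast
qed

end

section \<open>The modular on matrices induced by the polar radius\<close>

\<comment> \<open>keeps \<open>transpose A *v u\<close> in the form in which it occurs in the modular\<close>
declare transpose_matrix_vector [simp del]

lemma borel_measurable_matrix_matrix_mult:
  fixes A C :: "'s \<Rightarrow> real^'m^'m"
  assumes "A \<in> borel_measurable M" "C \<in> borel_measurable M"
  shows "(\<lambda>s. A s ** C s) \<in> borel_measurable M"
proof -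
  have "continuous_on UNIV (\<lambda>p :: (real^'m^'m) \<times> (real^'m^'m). fst p ** snd p)"
    unfolding matrix_matrix_mult_def
    by (intro continuous_on_vec_lambda continuous_on_sum continuous_on_mult continuous_on_component
        continuous_on_fst continuous_on_snd continuous_on_id)
  then have "(\<lambda>p :: (real^'m^'m) \<times> (real^'m^'m). fst p ** snd p) \<in> borel_measurable borel" by (rule borel_measurable_continuous_onI)
  from measurable_compose[OF borel_measurable_Pair[OF assms] this] show ?thesis by simp
qed

lemma borel_measurable_matrix_vector_mult:
  fixes A :: "'s \<Rightarrow> real^'m^'m" and x :: "'s \<Rightarrow> real^'m"
  assumes "A \<in> borel_measurable M" "x \<in> borel_measurable M"
  shows "(\<lambda>s. A s *v x s) \<in> borel_measurable M"
proof -
  have "continuous_on UNIV (\<lambda>p :: (real^'m^'m) \<times> (real^'m). fst p *v snd p)"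
    unfolding matrix_vector_mult_def
    by (intro continuous_on_vec_lambda continuous_on_sum continuous_on_mult continuous_on_component
        continuous_on_fst continuous_on_snd continuous_on_id)
  then have "(\<lambda>p :: (real^'m^'m) \<times> (real^'m). fst p *v snd p) \<in> borel_measurable borel" by (rule borel_measurable_continuous_onI)
  from measurable_compose[OF borel_measurable_Pair[OF assms] this] show ?thesis by simp
qed

lemma continuous_on_transpose: "continuous_on S (transpose :: real^'m^'n \<Rightarrow> _)"
  unfolding transpose_def
  by (intro continuous_on_vec_lambda continuous_on_component continuous_on_id)

lemma borel_measurable_transpose:
  fixes A :: "'s \<Rightarrow> real^'m^'m"
  assumes "A \<in> borel_measurable M"
  shows "(\<lambda>s. transpose (A s)) \<in> borel_measurable M"
  using measurable_compose[OF assms borel_measurable_continuous_onI[OF continuous_on_transpose]] .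

lemma borel_measurable_mat_powr:
  fixes A :: "'s \<Rightarrow> real^'m^'m"
  assumes [measurable]: "A \<in> borel_measurable M" "r \<in> borel_measurable M"
  shows "(\<lambda>s. mat_powr (r s) (A s)) \<in> borel_measurable M"
proof -
  have "(\<lambda>s. matpow (ln (r s) *\<^sub>R A s) k) \<in> borel_measurable M" for k
    by (induction k) (simp_all add: borel_measurable_matrix_matrix_mult)
  then show ?thesis unfolding mat_powr_def mat_exp_def by simp
qed

text \<open>The integrand of the modular as a function of the matrix alone: a level \<open>l\<close> enters only by dividing the
  matrix by \<open>l\<close>.\<close>

definition box_gauge :: "real^'m^'m \<Rightarrow> real^'m^'m \<Rightarrow> ennreal" where
  "box_gauge D A = (SUP u\<in>{u. infnorm u \<le> 1}. ennreal (tau D (transpose A *v u)))"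

lemma tau_le_box_gauge: "infnorm u \<le> 1 \<Longrightarrow> ennreal (tau D (transpose A *v u)) \<le> box_gauge D A"
  unfolding box_gauge_def by (rule SUP_upper) simp

lemma transpose_scaleR: "transpose (c *\<^sub>R A) = c *\<^sub>R transpose A"
  for A :: "real^'m^'n" by (simp add: transpose_def vec_eq_iff)

lemma transpose_add: "transpose (A + C) = transpose A + transpose C"
  for A :: "real^'m^'n" by (simp add: transpose_def vec_eq_iff)

lemma transpose_uminus: "transpose (- A) = - transpose A"
  for A :: "real^'m^'n" by (simp add: transpose_def vec_eq_iff)

lemma uminus_matrix_vector_mult: "(- A) *v x = - (A *v x)"
  for A :: "real^'m^'n" by (simp add: matrix_vector_mult_def vec_eq_iff sum_negf)

lemma transpose_matrix_vector_sum:
  "transpose A *v u = (\<Sum>i\<in>UNIV. u $ i *\<^sub>R A $ i)" for A :: "real^'m^'m"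
  by (simp add: matrix_vector_mult_def transpose_def vec_eq_iff mult.commute)

text \<open>Dividing the matrix by \<open>l\<close> amounts to shrinking the cube.\<close>

lemma Hfun_eq_box_gauge:
  assumes l: "0 < l"
  shows "Hfun \<nu> B f l = (\<integral>\<^sup>+ s. box_gauge (B s) ((1 / l) *\<^sub>R f s) \<partial>\<nu>)"
proof -
  have "(SUP u\<in>{u. infnorm u \<le> 1 / l}. ennreal (tau D (transpose A *v u))) = box_gauge D ((1 / l) *\<^sub>R A)"
    for D A :: "real^'b^'b"
    unfolding box_gauge_def
  proof (rule SUP_eq)
    fix u :: "real^'b" assume "u \<in> {u. infnorm u \<le> 1 / l}"
    then show "\<exists>v\<in>{u. infnorm u \<le> 1}. ennreal (tau D (transpose A *v u))
        \<le> ennreal (tau D (transpose ((1 / l) *\<^sub>R A) *v v))"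
      using l by (intro bexI[of _ "l *\<^sub>R u"])
        (simp_all add: infnorm_mul transpose_scaleR scaleR_matrix_vector_mult matrix_vector_mult_scaleR field_simps)
  next
    fix v :: "real^'b" assume "v \<in> {u. infnorm u \<le> 1}"
    then show "\<exists>u\<in>{u. infnorm u \<le> 1 / l}. ennreal (tau D (transpose ((1 / l) *\<^sub>R A) *v v))
        \<le> ennreal (tau D (transpose A *v u))"
      using l by (intro bexI[of _ "(1 / l) *\<^sub>R v"])
        (simp_all add: infnorm_mul transpose_scaleR scaleR_matrix_vector_mult matrix_vector_mult_scaleR field_simps)
  qed
  then show ?thesis unfolding Hfun_def by simp
qed

lemma infnorm_axis_le: "infnorm (axis i 1 :: real^'m) \<le> 1"
  using infnorm_le_norm[of "axis i 1 :: real^'m"] by simp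

context
  fixes a b :: real and D :: "real^'m^'m"
  assumes a: "0 < a" and ab: "a \<le> b" and D: "pinched a b D"
begin


lemma b: "0 < b" using a ab by simp

lemma tau_add: "tau D (x + y) \<le> 2 powr b * (tau D x + tau D y)"
proof (cases "x = 0 \<or> y = 0")
  case True
  have "1 * t \<le> 2 powr b * t" if "0 \<le> t" for t :: real
    using that b by (intro mult_right_mono ge_one_powr_ge_zero) auto
  then show ?thesis using True tau_nonneg[OF a b D] tau_zero[OF a b D] by auto
next
  case False
  let ?t = "tau D x + tau D y"
  have t: "0 < ?t" "tau D x \<le> ?t" "tau D y \<le> ?t"
    using False tau_polar(1)[OF a b D, of x] tau_polar(1)[OF a b D, of y] by auto
  have "tau D (\<Sum>i\<in>(UNIV :: bool set). if i then x else y) \<le> real (card (UNIV :: bool set)) powr b * ?t"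
    using t by (intro tau_sum_le[OF a b D]) auto
  then show ?thesis by (simp add: UNIV_bool add.commute)
qed

lemma box_gauge_le_iff:
  assumes "0 < t"
  shows "box_gauge D A \<le> ennreal t \<longleftrightarrow>
    (\<forall>u. infnorm u \<le> 1 \<longrightarrow> norm (mat_powr (1 / t) D *v (transpose A *v u)) \<le> 1)"
  using tau_le_iff[OF a b D assms] assms by (simp add: box_gauge_def SUP_le_iff)

lemma box_gauge_scale_le:
  assumes "1 \<le> c"
  shows "box_gauge D (c *\<^sub>R A) \<le> ennreal (c powr b) * box_gauge D A"
  unfolding box_gauge_def[of D "c *\<^sub>R A"]
proof (rule SUP_least)
  fix u :: "real^'m" assume u: "u \<in> {u. infnorm u \<le> 1}"
  have "tau D (transpose (c *\<^sub>R A) *v u) \<le> c powr b * tau D (transpose A *v u)"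
    using tau_scale_le[OF a b D assms] by (simp add: transpose_scaleR scaleR_matrix_vector_mult)
  then have "ennreal (tau D (transpose (c *\<^sub>R A) *v u)) \<le> ennreal (c powr b) * ennreal (tau D (transpose A *v u))"
    using tau_nonneg[OF a b D] by (simp add: ennreal_mult[symmetric] ennreal_leI)
  also have "\<dots> \<le> ennreal (c powr b) * box_gauge D A"
    using u by (intro mult_left_mono tau_le_box_gauge) auto
  finally show "ennreal (tau D (transpose (c *\<^sub>R A) *v u)) \<le> ennreal (c powr b) * box_gauge D A" .
qed

lemma box_gauge_scale_ge:
  assumes "1 \<le> c"
  shows "ennreal (c powr a) * box_gauge D A \<le> box_gauge D (c *\<^sub>R A)"
proof -
  have "ennreal (c powr a) * box_gauge D A
      = (SUP u\<in>{u. infnorm u \<le> 1}. ennreal (c powr a) * ennreal (tau D (transpose A *v u)))"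
    unfolding box_gauge_def by (rule SUP_mult_left_ennreal)
  also have "\<dots> \<le> box_gauge D (c *\<^sub>R A)"
  proof (rule SUP_least)
    fix u :: "real^'m" assume u: "u \<in> {u. infnorm u \<le> 1}"
    have "ennreal (c powr a) * ennreal (tau D (transpose A *v u)) \<le> ennreal (tau D (transpose (c *\<^sub>R A) *v u))"
      using tau_scale_ge[OF a b D assms] tau_nonneg[OF a b D]
      by (simp add: transpose_scaleR scaleR_matrix_vector_mult ennreal_mult[symmetric] ennreal_leI)
    also have "\<dots> \<le> box_gauge D (c *\<^sub>R A)" using u by (intro tau_le_box_gauge) simp
    finally show "ennreal (c powr a) * ennreal (tau D (transpose A *v u)) \<le> box_gauge D (c *\<^sub>R A)" .
  qed
  finally show ?thesis .
qed

lemma box_gauge_add: "box_gauge D (A + C) \<le> ennreal (2 powr b) * (box_gauge D A + box_gauge D C)"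
  unfolding box_gauge_def[of D "A + C"]
proof (rule SUP_least)
  fix u :: "real^'m" assume u: "u \<in> {u. infnorm u \<le> 1}"
  have "tau D (transpose (A + C) *v u) \<le> 2 powr b * (tau D (transpose A *v u) + tau D (transpose C *v u))"
    using tau_add by (simp add: transpose_add matrix_vector_mult_add_rdistrib)
  then have "ennreal (tau D (transpose (A + C) *v u))
      \<le> ennreal (2 powr b) * (ennreal (tau D (transpose A *v u)) + ennreal (tau D (transpose C *v u)))"
    using tau_nonneg[OF a b D] by (simp add: ennreal_mult[symmetric] ennreal_plus[symmetric] ennreal_leI del: ennreal_plus)
  also have "\<dots> \<le> ennreal (2 powr b) * (box_gauge D A + box_gauge D C)"
    using u by (intro mult_left_mono add_mono tau_le_box_gauge) auto
  finally show "ennreal (tau D (transpose (A + C) *v u)) \<le> ennreal (2 powr b) * (box_gauge D A + box_gauge D C)" .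
qed

lemma box_gauge_minus: "box_gauge D (- A) = box_gauge D A"
  unfolding box_gauge_def by (simp add: transpose_uminus uminus_matrix_vector_mult tau_minus[OF a b D])

text \<open>An intersection of closed conditions, one for each \<open>u\<close> in the cube.\<close>

lemma closed_box_gauge_le:
  assumes "0 < t"
  shows "closed {A. box_gauge D A \<le> ennreal t}"
proof -
  have cl: "closed {A. norm (mat_powr (1 / t) D *v (transpose A *v u)) \<le> 1}" for u :: "real^'m"
  proof -
    have "continuous_on UNIV (\<lambda>A. norm (mat_powr (1 / t) D *v (\<Sum>i\<in>UNIV. u $ i *\<^sub>R (A :: real^'m^'m) $ i)))"
      by (intro continuous_on_norm continuous_on_compose2[OF matrix_vector_mult_linear_continuous_on[of UNIV]]
          continuous_on_sum continuous_on_scaleR continuous_on_const continuous_on_component continuous_on_id) simp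
    then show ?thesis
      unfolding transpose_matrix_vector_sum by (intro closed_Collect_le continuous_on_const)
  qed
  have "closed (\<Inter>u\<in>{u :: real^'m. infnorm u \<le> 1}. {A. norm (mat_powr (1 / t) D *v (transpose A *v u)) \<le> 1})"
    by (intro closed_INT ballI cl)
  also have "(\<Inter>u\<in>{u :: real^'m. infnorm u \<le> 1}. {A. norm (mat_powr (1 / t) D *v (transpose A *v u)) \<le> 1})
      = {A. box_gauge D A \<le> ennreal t}"
    using box_gauge_le_iff[OF assms] by blast
  finally show ?thesis .
qed

text \<open>Every image of the cube vector has norm at most \<open>m\<close> times the norm of the matrix.\<close>

lemma box_gauge_upper:
  "box_gauge D A \<le> ennreal (real CARD('m) powr b * max (norm A powr a) (norm A powr b))"
  unfolding box_gauge_def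
proof (rule SUP_least)
  fix u :: "real^'m" assume u: "u \<in> {u. infnorm u \<le> 1}"
  define m where "m = real CARD('m)"
  have m: "1 \<le> m" by (simp add: m_def Suc_leI)
  let ?w = "transpose A *v u"
  have ui: "\<bar>u $ i\<bar> \<le> 1" for i using u component_le_infnorm_cart[of u i] by simp
  have "norm ?w \<le> (\<Sum>i\<in>UNIV. norm (u $ i *\<^sub>R A $ i))"
    unfolding transpose_matrix_vector_sum by (rule norm_sum)
  also have "\<dots> \<le> (\<Sum>i\<in>(UNIV :: 'm set). 1 * norm A)"
    unfolding norm_scaleR using ui by (intro sum_mono mult_mono Finite_Cartesian_Product.norm_nth_le) auto
  also have "\<dots> = m * norm A" by (simp add: m_def)
  finally have w: "norm ?w \<le> m * norm A" .
  have mm: "m powr a \<le> m powr b" "0 < m powr b" using m ab by (auto intro: powr_mono)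
  have "tau D ?w \<le> max (norm ?w powr a) (norm ?w powr b)" by (rule tau_norm_bounds(2)[OF a b D ab])
  also have "\<dots> \<le> max ((m * norm A) powr a) ((m * norm A) powr b)"
    using w a b by (intro max.mono powr_mono2) auto
  also have "\<dots> \<le> m powr b * max (norm A powr a) (norm A powr b)"
  proof (rule max.boundedI)
    have "(m * norm A) powr a \<le> m powr b * norm A powr a"
      using m mm by (simp add: powr_mult mult_right_mono)
    also have "\<dots> \<le> m powr b * max (norm A powr a) (norm A powr b)" by (intro mult_left_mono) auto
    finally show "(m * norm A) powr a \<le> m powr b * max (norm A powr a) (norm A powr b)" .
    show "(m * norm A) powr b \<le> m powr b * max (norm A powr a) (norm A powr b)"
      using m by (simp add: powr_mult mult_left_mono)
  qed
  finally show "ennreal (tau D ?w) \<le> ennreal (real CARD('m) powr b * max (norm A powr a) (norm A powr b))"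
    by (simp add: m_def ennreal_leI)
qed

text \<open>Some row carries the fraction \<open>1/m\<close> of the norm, and a row is the image of a coordinate vector under
  the transpose.\<close>

lemma box_gauge_lower:
  "ennreal ((1 / real CARD('m)) powr b * min (norm A powr a) (norm A powr b)) \<le> box_gauge D A"
proof -
  define m where "m = real CARD('m)"
  have m: "1 \<le> m" by (simp add: m_def Suc_leI)
  have "\<exists>i. norm A \<le> m * norm (A $ i)"
  proof (rule ccontr)
    assume "\<not> (\<exists>i. norm A \<le> m * norm (A $ i))"
    then have lt: "norm (A $ i) < norm A / m" for i using m by (simp add: field_simps not_le)
    have "norm A \<le> (\<Sum>i\<in>UNIV. norm (A $ i))"
      unfolding norm_vec_def by (rule L2_set_le_sum) simp
    also have "\<dots> < (\<Sum>i\<in>(UNIV :: 'm set). norm A / m)" using lt by (intro sum_strict_mono) auto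
    also have "\<dots> = norm A" using m by (simp add: m_def)
    finally show False by simp
  qed
  then obtain i where i: "norm A \<le> m * norm (A $ i)" by blast
  have w: "transpose A *v axis i 1 = A $ i"
    by (simp add: matrix_vector_mult_basis column_transpose row_def vec_eq_iff)
  have im: "norm A / m \<le> norm (A $ i)" using i m by (simp add: field_simps)
  have mm: "(1 / m) powr b \<le> (1 / m) powr a" "0 \<le> (1 / m) powr b" using m ab by (auto intro: powr_mono')
  have "(1 / m) powr b * min (norm A powr a) (norm A powr b)
      \<le> min ((norm A / m) powr a) ((norm A / m) powr b)"
  proof (rule min.boundedI)
    have "(1 / m) powr b * min (norm A powr a) (norm A powr b) \<le> (1 / m) powr a * norm A powr a"
      using mm by (intro mult_mono) auto
    then show "(1 / m) powr b * min (norm A powr a) (norm A powr b) \<le> (norm A / m) powr a"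
      using m by (simp add: powr_divide)
    have "(1 / m) powr b * min (norm A powr a) (norm A powr b) \<le> (1 / m) powr b * norm A powr b"
      by (intro mult_left_mono) auto
    then show "(1 / m) powr b * min (norm A powr a) (norm A powr b) \<le> (norm A / m) powr b"
      using m by (simp add: powr_divide)
  qed
  also have "\<dots> \<le> min (norm (A $ i) powr a) (norm (A $ i) powr b)"
    using im a b m by (intro min.mono powr_mono2) auto
  also have "\<dots> \<le> tau D (A $ i)" by (rule tau_norm_bounds(1)[OF a b D ab])
  finally have "ennreal ((1 / real CARD('m)) powr b * min (norm A powr a) (norm A powr b)) \<le> ennreal (tau D (A $ i))"
    by (simp add: m_def ennreal_leI)
  also have "\<dots> \<le> box_gauge D A" using tau_le_box_gauge[OF infnorm_axis_le, of D A i] unfolding w .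
  finally show ?thesis .
qed

text \<open>A vector of the cube is a combination of the coordinate vectors with coefficients in \<open>[-1, 1]\<close>.
  This exchanges the supremum over \<open>u\<close> and the integral over \<open>s\<close>, up to a constant.\<close>

lemma box_gauge_le_sum_axes:
  "box_gauge D A \<le> ennreal (real CARD('m) powr b) * (\<Sum>i\<in>UNIV. ennreal (tau D (transpose A *v axis i 1)))"
  unfolding box_gauge_def
proof (rule SUP_least)
  fix u :: "real^'m" assume u: "u \<in> {u. infnorm u \<le> 1}"
  define t where "t = (\<Sum>i\<in>UNIV. tau D (A $ i))"
  have w: "transpose A *v axis i 1 = A $ i" for i
    by (simp add: matrix_vector_mult_basis column_transpose row_def vec_eq_iff)
  have ui: "\<bar>u $ i\<bar> \<le> 1" for i using u component_le_infnorm_cart[of u i] by simp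
  have le: "tau D (u $ i *\<^sub>R A $ i) \<le> t" for i
  proof -
    have "tau D (u $ i *\<^sub>R A $ i) \<le> tau D (A $ i)" by (rule tau_shrink[OF a b D ui])
    also have "\<dots> \<le> t"
      unfolding t_def by (rule member_le_sum) (auto simp: tau_nonneg[OF a b D])
    finally show ?thesis .
  qed
  have "tau D (transpose A *v u) \<le> real CARD('m) powr b * t"
  proof (cases "t = 0")
    case True
    then have "tau D (A $ i) = 0" for i
      using tau_nonneg[OF a b D] by (simp add: t_def sum_nonneg_eq_0_iff)
    then have "A $ i = 0" for i using tau_polar(1)[OF a b D, of "A $ i"] by force
    then show ?thesis using True by (simp add: transpose_matrix_vector_sum tau_zero[OF a b D])
  next
    case False
    then have "0 < t" using tau_nonneg[OF a b D] by (simp add: t_def sum_nonneg less_le)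
    then show ?thesis
      unfolding transpose_matrix_vector_sum using le by (intro tau_sum_le[OF a b D]) auto
  qed
  then have "ennreal (tau D (transpose A *v u)) \<le> ennreal (real CARD('m) powr b * t)" by (rule ennreal_leI)
  also have "\<dots> = ennreal (real CARD('m) powr b) * (\<Sum>i\<in>UNIV. ennreal (tau D (transpose A *v axis i 1)))"
    unfolding w using tau_nonneg[OF a b D] by (simp add: ennreal_mult t_def sum_nonneg sum_ennreal)
  finally show "ennreal (tau D (transpose A *v u))
      \<le> ennreal (real CARD('m) powr b) * (\<Sum>i\<in>UNIV. ennreal (tau D (transpose A *v axis i 1)))" .
qed

end

context
  fixes a b :: real and \<nu> :: "'s measure" and B :: "'s \<Rightarrow> real^'m^'m"
  assumes a: "0 < a" and ab: "a \<le> b"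
    and B[measurable]: "B \<in> borel_measurable \<nu>" and pin: "\<And>s. s \<in> space \<nu> \<Longrightarrow> pinched a b (B s)"
begin

text \<open>By continuity in \<open>u\<close> a countable dense subset of the cube decides whether the supremum is at most \<open>t\<close>.\<close>

lemma borel_measurable_box_gauge:
  assumes f[measurable]: "f \<in> borel_measurable \<nu>"
  shows "(\<lambda>s. box_gauge (B s) (f s)) \<in> borel_measurable \<nu>"
proof (rule borel_measurableI_le)
  fix y :: ennreal
  obtain T :: "(real^'m) set" where T: "countable T" "T \<subseteq> {u. infnorm u \<le> 1}" "{u. infnorm u \<le> 1} \<subseteq> closure T"
    using separable[of "{u :: real^'m. infnorm u \<le> 1}"] by blast
  have pos: "{s \<in> space \<nu>. box_gauge (B s) (f s) \<le> ennreal t} \<in> sets \<nu>" if t: "0 < t" for t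
  proof -
    have m: "(\<lambda>s. norm (mat_powr (1 / t) (B s) *v (transpose (f s) *v u))) \<in> borel_measurable \<nu>" for u :: "real^'m"
      by (intro measurable_compose[OF _ borel_measurable_norm] borel_measurable_matrix_vector_mult borel_measurable_mat_powr
          borel_measurable_transpose) measurable
    have dense: "(\<forall>u. infnorm u \<le> 1 \<longrightarrow> norm (E *v (A *v u)) \<le> 1) \<longleftrightarrow> (\<forall>u\<in>T. norm (E *v (A *v u)) \<le> 1)"
      for E A :: "real^'m^'m"
    proof (intro iffI ballI allI impI)
      fix u :: "real^'m" assume *: "\<forall>u\<in>T. norm (E *v (A *v u)) \<le> 1" and u: "infnorm u \<le> 1"
      have "continuous_on UNIV (\<lambda>u. norm ((E ** A) *v u))"
        by (intro continuous_on_norm matrix_vector_mult_linear_continuous_on)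
      then have "closed {u. norm ((E ** A) *v u) \<le> 1}" by (intro closed_Collect_le continuous_on_const)
      then have "closure T \<subseteq> {u. norm ((E ** A) *v u) \<le> 1}"
        using * by (intro closure_minimal) (auto simp: matrix_vector_mul_assoc)
      then show "norm (E *v (A *v u)) \<le> 1" using T(3) u by (auto simp: matrix_vector_mul_assoc)
    qed (use T(2) in auto)
    have "{s \<in> space \<nu>. box_gauge (B s) (f s) \<le> ennreal t}
        = {s \<in> space \<nu>. \<forall>u\<in>T. norm (mat_powr (1 / t) (B s) *v (transpose (f s) *v u)) \<le> 1}"
      using box_gauge_le_iff[OF a ab pin t] dense by blast
    also have "\<dots> \<in> sets \<nu>"
      by (intro sets.sets_Collect_countable_All'[OF _ T(1)] borel_measurable_le m borel_measurable_const)
    finally show ?thesis .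
  qed
  show "{s \<in> space \<nu>. box_gauge (B s) (f s) \<le> y} \<in> sets \<nu>"
  proof (cases "y = 0")
    case True
    have "(box_gauge (B s) (f s) \<le> y) \<longleftrightarrow> (\<forall>n. box_gauge (B s) (f s) \<le> ennreal (1 / real (Suc n)))" for s
    proof
      assume *: "\<forall>n. box_gauge (B s) (f s) \<le> ennreal (1 / real (Suc n))"
      have "(\<lambda>n. ennreal (1 / real (Suc n))) \<longlonglongrightarrow> ennreal 0"
        by (intro tendsto_ennrealI LIMSEQ_Suc[OF lim_1_over_n])
      then have "box_gauge (B s) (f s) \<le> ennreal 0" using * by (intro LIMSEQ_le_const) auto
      then show "box_gauge (B s) (f s) \<le> y" using True by simp
    qed (simp add: True)
    then have "{s \<in> space \<nu>. box_gauge (B s) (f s) \<le> y}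
        = (\<Inter>n. {s \<in> space \<nu>. box_gauge (B s) (f s) \<le> ennreal (1 / real (Suc n))})" by auto
    also have "\<dots> \<in> sets \<nu>" using pos by (intro sets.countable_INT) auto
    finally show ?thesis .
  next
    case False
    show ?thesis
    proof (cases y)
      case (real t)
      then show ?thesis using pos[of t] False by (cases "t = 0") auto
    next
      case top
      then show ?thesis by simp
    qed
  qed
qed

lemma scaling_modular_box_gauge:
  "scaling_modular \<nu> (\<lambda>s. box_gauge (B s)) a b (2 powr b) ((1 / real CARD('m)) powr b) (real CARD('m) powr b)"
proof
  show "1 \<le> 2 powr b" using a ab by (intro ge_one_powr_ge_zero) auto
  show "0 < (1 / real CARD('m)) powr b" by simp
  show "0 < a" "a \<le> b" by (rule a ab)+
  show "(\<lambda>s. box_gauge (B s) (f s)) \<in> borel_measurable \<nu>" if "f \<in> borel_measurable \<nu>" for f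
    by (rule borel_measurable_box_gauge[OF that])
  fix s assume "s \<in> space \<nu>"
  note s = a ab pin[OF this]
  fix c t :: real and v w
  show "box_gauge (B s) (c *\<^sub>R v) \<le> ennreal (c powr b) * box_gauge (B s) v" if "1 \<le> c"
    by (rule box_gauge_scale_le[OF s that])
  show "ennreal (c powr a) * box_gauge (B s) v \<le> box_gauge (B s) (c *\<^sub>R v)" if "1 \<le> c"
    by (rule box_gauge_scale_ge[OF s that])
  show "box_gauge (B s) (v + w) \<le> ennreal (2 powr b) * (box_gauge (B s) v + box_gauge (B s) w)"
    by (rule box_gauge_add[OF s])
  show "box_gauge (B s) (- v) = box_gauge (B s) v"
    by (rule box_gauge_minus[OF s])
  show "closed {v. box_gauge (B s) v \<le> ennreal t}" if "0 < t"
    by (rule closed_box_gauge_le[OF s that])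
  show "box_gauge (B s) v \<le> ennreal (real CARD('m) powr b * max (norm v powr a) (norm v powr b))"
    by (rule box_gauge_upper[OF s])
  show "ennreal ((1 / real CARD('m)) powr b * min (norm v powr a) (norm v powr b)) \<le> box_gauge (B s) v"
    by (rule box_gauge_lower[OF s])
qed

end

section \<open>The Levy exponent is comparable to the polar radius\<close>

text \<open>The lower bound is the Taylor expansion of order 4 on \<open>[-1, 1]\<close>.\<close>

lemma one_minus_cos_bounds:
  fixes y :: real
  shows "1 - cos y \<le> y\<^sup>2 / 2" and "\<bar>y\<bar> \<le> 1 \<Longrightarrow> y\<^sup>2 / 3 \<le> 1 - cos y"
proof -
  show "1 - cos y \<le> y\<^sup>2 / 2"
  proof -
    have "(sin (y / 2))\<^sup>2 \<le> (y / 2)\<^sup>2"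
      using abs_sin_x_le_abs_x[of "y / 2"] by (simp only: abs_le_square_iff)
    moreover have "cos y = 1 - 2 * (sin (y / 2))\<^sup>2" using cos_double_sin[of "y / 2"] by simp
    ultimately show ?thesis by (simp add: power_divide)
  qed
  assume y: "\<bar>y\<bar> \<le> 1"
  obtain t where "cos y = (\<Sum>m<4. cos_coeff m * y ^ m) + (cos (t + 1/2 * real 4 * pi) / fact 4) * y ^ 4"
    using Maclaurin_cos_expansion[of y 4] by blast
  moreover have "(\<Sum>m<4. cos_coeff m * y ^ m) = 1 - y\<^sup>2 / 2"
  proof -
    have "{..<4 :: nat} = {0, 1, 2, 3}" by auto
    then show ?thesis by (simp add: cos_coeff_def)
  qed
  moreover have "(cos (t + 1/2 * real 4 * pi) / fact 4) * y ^ 4 \<le> 1 / 6 * y\<^sup>2"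
  proof (rule mult_mono)
    have "cos (t + 1/2 * real 4 * pi) \<le> 4" using cos_le_one[of "t + 1/2 * real 4 * pi"] by linarith
    then show "cos (t + 1/2 * real 4 * pi) / fact 4 \<le> 1 / 6" by (simp add: fact_numeral)
    have "y ^ 4 = y\<^sup>2 * y\<^sup>2" by (simp add: power_numeral_reduce)
    also have "\<dots> \<le> 1 * y\<^sup>2" using y by (intro mult_right_mono) (simp_all add: abs_square_le_1)
    finally show "y ^ 4 \<le> y\<^sup>2" by simp
  qed simp_all
  ultimately show "y\<^sup>2 / 3 \<le> 1 - cos y" by simp
qed

lemma spectral_measure_identity_measurable:
  fixes \<sigma> :: "(real^'m) measure"
  assumes "spectral_measure \<sigma>"
  shows "(\<lambda>\<theta>. \<theta>) \<in> borel_measurable \<sigma>" "space \<sigma> = sphere 0 1" "finite_measure \<sigma>"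
proof -
  have s: "sets \<sigma> = sets (restrict_space borel (sphere 0 1))" and "finite_measure \<sigma>"
    using assms by (auto simp: spectral_measure_def)
  then show "finite_measure \<sigma>" by simp
  show "space \<sigma> = sphere 0 1" using sets_eq_imp_space_eq[OF s] by (simp add: space_restrict_space)
  have "(\<lambda>\<theta>. \<theta>) \<in> borel_measurable (restrict_space borel (sphere 0 1 :: (real^'m) set))"
    by (intro measurable_restrict_space1) simp
  then show "(\<lambda>\<theta>. \<theta>) \<in> borel_measurable \<sigma>"
    using measurable_cong_sets[OF s refl] by blast
qed

text \<open>The quadratic form is continuous on the unit sphere, hence it attains its minimum there.  If it
  vanished at some \<open>w\<close>, the open complement of the hyperplane orthogonal to \<open>w\<close> would be a null set, and
  the support would not span.\<close>

lemma spectral_measure_nondegenerate: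
  fixes \<sigma> :: "(real^'m) measure"
  assumes \<sigma>: "spectral_measure \<sigma>"
  shows "\<exists>\<kappa>>0. \<forall>w. ennreal (\<kappa> * (norm w)\<^sup>2) \<le> (\<integral>\<^sup>+ \<theta>. ennreal ((\<theta> \<bullet> w)\<^sup>2) \<partial>\<sigma>)"
proof -
  note id[measurable] = spectral_measure_identity_measurable(1)[OF \<sigma>]
  interpret finite_measure \<sigma> using spectral_measure_identity_measurable(3)[OF \<sigma>] .
  have sp: "norm \<theta> = 1" if "\<theta> \<in> space \<sigma>" for \<theta>
    using that spectral_measure_identity_measurable(2)[OF \<sigma>] by simp
  have int1: "integrable \<sigma> (\<lambda>\<theta>. \<theta> $ i * \<theta> $ j)" for i j
  proof (rule integrable_const_bound[where B = 1])
    show "AE \<theta> in \<sigma>. norm (\<theta> $ i * \<theta> $ j) \<le> 1"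
    proof (intro AE_I2)
      fix \<theta> assume "\<theta> \<in> space \<sigma>"
      then have "\<bar>\<theta> $ i\<bar> \<le> 1" "\<bar>\<theta> $ j\<bar> \<le> 1"
        using sp component_le_norm_cart[of \<theta> i] component_le_norm_cart[of \<theta> j] by auto
      then show "norm (\<theta> $ i * \<theta> $ j) \<le> 1" by (simp add: abs_mult mult_le_one)
    qed
    have "(\<lambda>\<theta>. (\<theta> \<bullet> axis i 1) * (\<theta> \<bullet> axis j 1)) \<in> borel_measurable \<sigma>" by measurable
    then show "(\<lambda>\<theta>. \<theta> $ i * \<theta> $ j) \<in> borel_measurable \<sigma>" by (simp add: inner_axis)
  qed
  have sq: "(\<theta> \<bullet> w)\<^sup>2 = (\<Sum>i\<in>UNIV. \<Sum>j\<in>UNIV. w $ i * w $ j * (\<theta> $ i * \<theta> $ j))" for \<theta> w :: "real^'m"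
    by (simp add: inner_vec_def power2_eq_square sum_product mult_ac)
  have int: "integrable \<sigma> (\<lambda>\<theta>. (\<theta> \<bullet> w)\<^sup>2)" for w
    unfolding sq by (intro Bochner_Integration.integrable_sum integrable_mult_right int1)
  define q where "q w = (\<integral>\<theta>. (\<theta> \<bullet> w)\<^sup>2 \<partial>\<sigma>)" for w
  have q_sum: "q w = (\<Sum>i\<in>UNIV. \<Sum>j\<in>UNIV. w $ i * w $ j * (\<integral>\<theta>. \<theta> $ i * \<theta> $ j \<partial>\<sigma>))" for w
    unfolding q_def sq
    by (simp add: Bochner_Integration.integral_sum Bochner_Integration.integrable_sum int1)
  have cont: "continuous_on (sphere 0 1) q"
    unfolding q_sum
    by (intro continuous_on_sum continuous_on_mult continuous_on_component continuous_on_id continuous_on_const)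
  have q_nonneg: "0 \<le> q w" for w unfolding q_def by simp
  have q_pos: "0 < q w" if w: "w \<noteq> 0" for w
  proof (rule ccontr)
    assume "\<not> 0 < q w"
    then have "q w = 0" using q_nonneg[of w] by simp
    then have ae: "AE \<theta> in \<sigma>. (\<theta> \<bullet> w)\<^sup>2 = 0"
      unfolding q_def using integral_nonneg_eq_0_iff_AE[OF int[of w]] by simp
    define U where "U = {\<theta>. \<theta> \<bullet> w \<noteq> 0}"
    have "closed {\<theta>. \<theta> \<bullet> w = 0}" using closed_hyperplane[of w 0] by (simp add: inner_commute)
    then have "open (- {\<theta>. \<theta> \<bullet> w = 0})" by (rule open_Compl)
    moreover have "- {\<theta>. \<theta> \<bullet> w = 0} = U" by (auto simp: U_def)
    ultimately have "open U" by simp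
    have set: "{\<theta> \<in> space \<sigma>. \<theta> \<bullet> w \<noteq> 0} \<in> sets \<sigma>" by measurable
    have "emeasure \<sigma> {\<theta> \<in> space \<sigma>. \<theta> \<bullet> w \<noteq> 0} = 0"
      using ae AE_iff_measurable[OF set, of "\<lambda>\<theta>. (\<theta> \<bullet> w)\<^sup>2 = 0"] by simp
    then have U0: "emeasure \<sigma> (U \<inter> space \<sigma>) = 0" by (simp add: U_def Int_def conj_commute)
    have "msupport \<sigma> \<subseteq> {\<theta>. w \<bullet> \<theta> = 0}"
    proof
      fix \<theta> assume "\<theta> \<in> msupport \<sigma>"
      then have "\<theta> \<notin> U" using \<open>open U\<close> U0 by (auto simp: msupport_def)
      then show "\<theta> \<in> {\<theta>. w \<bullet> \<theta> = 0}" by (simp add: U_def inner_commute)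
    qed
    then have "span (msupport \<sigma>) \<subseteq> {\<theta>. w \<bullet> \<theta> = 0}"
      by (rule span_minimal) (rule subspace_hyperplane)
    moreover have "span (msupport \<sigma>) = UNIV" using \<sigma> by (simp add: spectral_measure_def)
    ultimately have "w \<bullet> w = 0" by blast
    then show False using w by simp
  qed
  have "(axis undefined 1 :: real^'m) \<in> sphere 0 1" by simp
  then have ne: "sphere (0 :: real^'m) 1 \<noteq> {}" by blast
  obtain w0 where w0: "w0 \<in> sphere 0 1" and min: "\<And>w. w \<in> sphere 0 1 \<Longrightarrow> q w0 \<le> q w"
    using continuous_attains_inf[OF compact_sphere ne cont] by blast
  have "w0 \<noteq> 0" using w0 by auto
  have "q w0 * (norm w)\<^sup>2 \<le> q w" for w
  proof (cases "w = 0")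
    case False
    have "q w0 \<le> q ((1 / norm w) *\<^sub>R w)" using False by (intro min) simp
    also have "\<dots> = (1 / norm w)\<^sup>2 * q w"
      by (simp add: q_def power_mult_distrib power_divide)
    finally show ?thesis using False by (simp add: field_simps power2_eq_square)
  qed (simp add: q_def)
  moreover have "ennreal (q w) = (\<integral>\<^sup>+ \<theta>. ennreal ((\<theta> \<bullet> w)\<^sup>2) \<partial>\<sigma>)" for w
    unfolding q_def by (rule nn_integral_eq_integral[symmetric, OF int]) simp
  ultimately show ?thesis using q_pos[OF \<open>w0 \<noteq> 0\<close>] by (metis ennreal_leI)
qed

text \<open>The exponent with the sign reversed, as an iterated integral of a nonnegative function; in this form
  it depends measurably on \<open>D\<close> and \<open>u\<close>.\<close>

definition levy_nn :: "(real^'m) measure \<Rightarrow> real^'m^'m \<Rightarrow> real^'m \<Rightarrow> ennreal" where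
  "levy_nn \<sigma> D u = (\<integral>\<^sup>+ r. (\<integral>\<^sup>+ \<theta>. ennreal (1 - cos ((mat_powr r D *v \<theta>) \<bullet> u)) \<partial>\<sigma>)
     * (indicator {0<..} r * ennreal (1 / r\<^sup>2)) \<partial>lborel)"

context
  fixes \<sigma> :: "(real^'m) measure"
  assumes \<sigma>: "spectral_measure \<sigma>"
begin

lemma id_meas[measurable]: "(\<lambda>\<theta>. \<theta>) \<in> borel_measurable \<sigma>"
  by (rule spectral_measure_identity_measurable(1)[OF \<sigma>])

lemma polar_measurable:
  "(\<lambda>(r, \<theta>). mat_powr r D *v \<theta>) \<in> borel_measurable (borel \<Otimes>\<^sub>M \<sigma>)"
proof -
  have "(\<lambda>p. mat_powr (fst p) D *v snd p) \<in> borel_measurable (borel \<Otimes>\<^sub>M \<sigma>)"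
    using measurable_compose[OF measurable_snd id_meas]
    by (intro borel_measurable_matrix_vector_mult borel_measurable_mat_powr) simp_all
  then show ?thesis by (simp add: split_beta')
qed

text \<open>The set function in the definition of the Levy measure is the image of a product measure under the
  polar coordinate map, so it is countably additive and the measure generated by it takes the same
  values.\<close>

lemma levy_measure_nn_integral:
  assumes g[measurable]: "g \<in> borel_measurable borel"
  shows "sets (levy_measure \<sigma> D) = sets borel"
    and "(\<integral>\<^sup>+ x. g x \<partial>levy_measure \<sigma> D)
      = (\<integral>\<^sup>+ r. (\<integral>\<^sup>+ \<theta>. g (mat_powr r D *v \<theta>) \<partial>\<sigma>) * (indicator {0<..} r * ennreal (1 / r\<^sup>2)) \<partial>lborel)"
proof -
  interpret finite_measure \<sigma> using spectral_measure_identity_measurable(3)[OF \<sigma>] .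
  define \<rho> :: "real measure" where "\<rho> = density lborel (\<lambda>r. indicator {0<..} r * ennreal (1 / r\<^sup>2))"
  have s\<rho>: "sets \<rho> = sets borel" by (simp add: \<rho>_def)
  define \<mu> where "\<mu> = distr (\<rho> \<Otimes>\<^sub>M \<sigma>) borel (\<lambda>(r, \<theta>). mat_powr r D *v \<theta>)"
  have pm[measurable]: "(\<lambda>(r, \<theta>). mat_powr r D *v \<theta>) \<in> borel_measurable (\<rho> \<Otimes>\<^sub>M \<sigma>)"
    using polar_measurable[of D] measurable_cong_sets[OF sets_pair_measure_cong[OF s\<rho> refl] refl] by blast
  have nn: "(\<integral>\<^sup>+ x. h x \<partial>\<mu>) = (\<integral>\<^sup>+ r. (\<integral>\<^sup>+ \<theta>. h (mat_powr r D *v \<theta>) \<partial>\<sigma>) * (indicator {0<..} r * ennreal (1 / r\<^sup>2)) \<partial>lborel)"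
    if [measurable]: "h \<in> borel_measurable borel" for h
  proof -
    have hp: "(\<lambda>(r, \<theta>). h (mat_powr r D *v \<theta>)) \<in> borel_measurable (borel \<Otimes>\<^sub>M \<sigma>)"
      using measurable_compose[OF polar_measurable that] by (simp add: split_beta')
    have hp': "(\<lambda>(r, \<theta>). h (mat_powr r D *v \<theta>)) \<in> borel_measurable (\<rho> \<Otimes>\<^sub>M \<sigma>)"
      using measurable_compose[OF pm that] by (simp add: split_beta')
    have im: "(\<lambda>r. \<integral>\<^sup>+ \<theta>. h (mat_powr r D *v \<theta>) \<partial>\<sigma>) \<in> borel_measurable borel"
      by (rule borel_measurable_nn_integral[OF hp])
    have "(\<integral>\<^sup>+ x. h x \<partial>\<mu>) = (\<integral>\<^sup>+ p. h (case p of (r, \<theta>) \<Rightarrow> mat_powr r D *v \<theta>) \<partial>(\<rho> \<Otimes>\<^sub>M \<sigma>))"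
      unfolding \<mu>_def by (rule nn_integral_distr[OF pm]) simp
    also have "\<dots> = (\<integral>\<^sup>+ p. (case p of (r, \<theta>) \<Rightarrow> h (mat_powr r D *v \<theta>)) \<partial>(\<rho> \<Otimes>\<^sub>M \<sigma>))"
      by (intro nn_integral_cong) (simp add: split_beta')
    also have "\<dots> = (\<integral>\<^sup>+ r. \<integral>\<^sup>+ \<theta>. h (mat_powr r D *v \<theta>) \<partial>\<sigma> \<partial>\<rho>)"
      using nn_integral_fst[OF hp'] by simp
    also have "\<dots> = (\<integral>\<^sup>+ r. (indicator {0<..} r * ennreal (1 / r\<^sup>2)) * (\<integral>\<^sup>+ \<theta>. h (mat_powr r D *v \<theta>) \<partial>\<sigma>) \<partial>lborel)"
    proof -
      have "(\<lambda>r. indicator {0<..} r * ennreal (1 / r\<^sup>2)) \<in> borel_measurable (lborel :: real measure)" by measurable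
      moreover have "(\<lambda>r. \<integral>\<^sup>+ \<theta>. h (mat_powr r D *v \<theta>) \<partial>\<sigma>) \<in> borel_measurable lborel" using im by simp
      ultimately show ?thesis unfolding \<rho>_def by (rule nn_integral_density)
    qed
    finally show ?thesis by (simp add: mult.commute)
  qed
  have "measure_of UNIV (sets borel) (emeasure \<mu>) = \<mu>"
    using measure_of_of_measure[of \<mu>] by (simp add: \<mu>_def)
  moreover have "levy_measure \<sigma> D = measure_of UNIV (sets borel) (emeasure \<mu>)"
    unfolding levy_measure_def
  proof (rule measure_of_eq)
    fix C :: "(real^'m) set" assume "C \<in> sigma_sets UNIV (sets borel)"
    then have C: "C \<in> sets borel" using sets.sigma_sets_eq[of "borel :: (real^'m) measure"] by simp
    have "emeasure \<mu> C = (\<integral>\<^sup>+ x. indicator C x \<partial>\<mu>)" using C by (simp add: \<mu>_def)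
    also have "\<dots> = (\<integral>\<^sup>+ r. (\<integral>\<^sup>+ \<theta>. indicator C (mat_powr r D *v \<theta>) \<partial>\<sigma>) * (indicator {0<..} r * ennreal (1 / r\<^sup>2)) \<partial>lborel)"
      using C by (intro nn) simp
    finally show "(\<integral>\<^sup>+ r\<in>{0<..}. ((\<integral>\<^sup>+ \<theta>. indicator C (mat_powr r D *v \<theta>) \<partial>\<sigma>) * ennreal (1 / r\<^sup>2)) \<partial>lborel) = emeasure \<mu> C"
      by (simp add: mult_ac)
  qed simp
  ultimately have eq: "levy_measure \<sigma> D = \<mu>" by simp
  show "sets (levy_measure \<sigma> D) = sets borel" by (simp add: eq \<mu>_def)
  show "(\<integral>\<^sup>+ x. g x \<partial>levy_measure \<sigma> D)
      = (\<integral>\<^sup>+ r. (\<integral>\<^sup>+ \<theta>. g (mat_powr r D *v \<theta>) \<partial>\<sigma>) * (indicator {0<..} r * ennreal (1 / r\<^sup>2)) \<partial>lborel)"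
    unfolding eq by (rule nn[OF g])
qed

lemma levy_exponent_eq: "levy_exponent \<sigma> D u = - enn2real (levy_nn \<sigma> D u)"
proof -
  have s: "sets (levy_measure \<sigma> D) = sets borel" by (rule levy_measure_nn_integral(1)[of "\<lambda>x. 0"]) simp
  have m: "(\<lambda>x. 1 - cos (x \<bullet> u)) \<in> borel_measurable (levy_measure \<sigma> D)"
    unfolding measurable_cong_sets[OF s refl] by measurable
  have "levy_exponent \<sigma> D u = - (\<integral>x. 1 - cos (x \<bullet> u) \<partial>levy_measure \<sigma> D)"
    unfolding levy_exponent_def by (subst Bochner_Integration.integral_minus[symmetric]) simp
  also have "(\<integral>x. 1 - cos (x \<bullet> u) \<partial>levy_measure \<sigma> D)
      = enn2real (\<integral>\<^sup>+ x. ennreal (1 - cos (x \<bullet> u)) \<partial>levy_measure \<sigma> D)"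
    by (rule integral_eq_nn_integral[OF m]) simp
  also have "(\<integral>\<^sup>+ x. ennreal (1 - cos (x \<bullet> u)) \<partial>levy_measure \<sigma> D) = levy_nn \<sigma> D u"
    unfolding levy_nn_def by (rule levy_measure_nn_integral(2)) measurable
  finally show ?thesis .
qed

lemma borel_measurable_levy_nn:
  fixes B :: "'s \<Rightarrow> real^'m^'m"
  assumes B: "B \<in> borel_measurable \<nu>" and g: "g \<in> borel_measurable \<nu>"
  shows "(\<lambda>s. levy_nn \<sigma> (B s) (g s)) \<in> borel_measurable \<nu>"
proof -
  interpret finite_measure \<sigma> using spectral_measure_identity_measurable(3)[OF \<sigma>] .
  have "(\<lambda>p. mat_powr (snd (fst p)) (B (fst (fst p))) *v snd p) \<in> borel_measurable ((\<nu> \<Otimes>\<^sub>M lborel) \<Otimes>\<^sub>M \<sigma>)"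
  proof (intro borel_measurable_matrix_vector_mult borel_measurable_mat_powr)
    show "(\<lambda>p. B (fst (fst p))) \<in> borel_measurable ((\<nu> \<Otimes>\<^sub>M lborel) \<Otimes>\<^sub>M \<sigma>)"
      by (rule measurable_compose[OF _ B]) measurable
    show "(\<lambda>p. snd (fst p)) \<in> borel_measurable ((\<nu> \<Otimes>\<^sub>M lborel) \<Otimes>\<^sub>M \<sigma>)" by measurable
    show "snd \<in> borel_measurable ((\<nu> \<Otimes>\<^sub>M lborel) \<Otimes>\<^sub>M \<sigma>)"
      using measurable_compose[OF measurable_snd id_meas] by simp
  qed
  moreover have "(\<lambda>p. g (fst (fst p))) \<in> borel_measurable ((\<nu> \<Otimes>\<^sub>M lborel) \<Otimes>\<^sub>M \<sigma>)"
    by (rule measurable_compose[OF _ g]) measurable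
  ultimately have "(\<lambda>p. ennreal (1 - cos ((mat_powr (snd (fst p)) (B (fst (fst p))) *v snd p) \<bullet> g (fst (fst p)))))
      \<in> borel_measurable ((\<nu> \<Otimes>\<^sub>M lborel) \<Otimes>\<^sub>M \<sigma>)" by measurable
  then have "case_prod (\<lambda>q \<theta>. ennreal (1 - cos ((mat_powr (snd q) (B (fst q)) *v \<theta>) \<bullet> g (fst q))))
      \<in> borel_measurable ((\<nu> \<Otimes>\<^sub>M lborel) \<Otimes>\<^sub>M \<sigma>)" by (simp add: split_beta')
  from borel_measurable_nn_integral[OF this]
  have "case_prod (\<lambda>s r. (\<integral>\<^sup>+ \<theta>. ennreal (1 - cos ((mat_powr r (B s) *v \<theta>) \<bullet> g s)) \<partial>\<sigma>)
      * (indicator {0<..} r * ennreal (1 / r\<^sup>2))) \<in> borel_measurable (\<nu> \<Otimes>\<^sub>M lborel)"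
    by (simp add: split_beta')
  from lborel.borel_measurable_nn_integral[OF this] show ?thesis unfolding levy_nn_def .
qed

text \<open>With \<open>t = tau D u\<close>, the vector \<open>r\<^sup>Du\<close> has norm at most \<open>(rt)\<close> to the power \<open>1/b\<close> for \<open>r \<le> 1/t\<close>.  On that
  range \<open>1 - cos y \<le> y\<^sup>2/2\<close> leaves the power \<open>2/b - 2 > -1\<close> of \<open>r\<close>, and on the rest \<open>1 - cos y \<le> 2\<close>
  leaves \<open>r\<close> to the power \<open>-2\<close>.  Both integrals are multiples of \<open>t\<close>.\<close>

lemma levy_nn_upper:
  assumes a: "0 < a" "a \<le> b" and b2: "b < 2"
  shows "\<exists>K>0. \<forall>D u. pinched a b D \<longrightarrow> levy_nn \<sigma> D u \<le> ennreal (K * tau D u)"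
proof -
  interpret finite_measure \<sigma> using spectral_measure_identity_measurable(3)[OF \<sigma>] .
  have b: "0 < b" using a by simp
  define S where "S = measure \<sigma> (space \<sigma>)"
  define p where "p = 2 / b - 2"
  have p: "-1 < p" using b b2 by (simp add: p_def field_simps)
  define K where "K = (1 / (2 * (p + 1)) + 2) * S + 1"
  have S: "S \<ge> 0" by (simp add: S_def)
  have K: "K > 0" using p S unfolding K_def by (intro add_nonneg_pos mult_nonneg_nonneg add_nonneg_nonneg) simp_all
  have "levy_nn \<sigma> D u \<le> ennreal (K * tau D u)" if D: "pinched a b D" for D u
  proof (cases "u = 0")
    case True
    then show ?thesis by (simp add: levy_nn_def)
  next
    case False
    define t where "t = tau D u"
    define \<omega> where "\<omega> = mat_powr (1 / t) D *v u"
    have t: "0 < t" and \<omega>: "norm \<omega> = 1" using tau_polar[OF a(1) b D False] by (auto simp: t_def \<omega>_def)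
    have rD: "mat_powr r D *v u = mat_powr (r * t) D *v \<omega>" if "0 < r" for r
      unfolding \<omega>_def using that t mat_powr_mult[OF a(1) b D, of "r * t" "1 / t" u] by simp
    let ?I = "\<lambda>r. \<integral>\<^sup>+ \<theta>. ennreal (1 - cos ((mat_powr r D *v \<theta>) \<bullet> u)) \<partial>\<sigma>"
    have inner: "?I r \<le> ennreal (S * c)"
      if c: "0 \<le> c" "\<And>\<theta>. norm \<theta> = 1 \<Longrightarrow> 1 - cos ((mat_powr r D *v \<theta>) \<bullet> u) \<le> c" for r c
    proof -
      have "?I r \<le> (\<integral>\<^sup>+ \<theta>. ennreal c \<partial>\<sigma>)"
        using c(2) spectral_measure_identity_measurable(2)[OF \<sigma>]
        by (intro nn_integral_mono ennreal_leI) auto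
      also have "\<dots> = ennreal (S * c)"
        using c(1) by (simp add: S_def emeasure_eq_measure ennreal_mult mult.commute)
      finally show ?thesis .
    qed
    have near: "?I r * ennreal (1 / r\<^sup>2) \<le> ennreal (S / 2 * t powr (2 / b) * r powr p)" if r: "0 < r" "r \<le> 1 / t" for r
    proof -
      have rt: "0 < r * t" "r * t \<le> 1" using r t by (auto simp: field_simps)
      have "1 - cos ((mat_powr r D *v \<theta>) \<bullet> u) \<le> (r * t) powr (2 / b) / 2" if \<theta>: "norm \<theta> = 1" for \<theta>
      proof -
        have "\<bar>(mat_powr r D *v \<theta>) \<bullet> u\<bar> = \<bar>\<theta> \<bullet> (mat_powr (r * t) D *v \<omega>)\<bar>"
          using mat_powr_symmetric[OF a(1) b D r(1)] rD[OF r(1)] by simp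
        also have "\<dots> \<le> norm (mat_powr (r * t) D *v \<omega>)"
          using Cauchy_Schwarz_ineq2[of \<theta> "mat_powr (r * t) D *v \<omega>"] \<theta> by simp
        also have "\<dots> \<le> (r * t) powr (1 / b)"
          using norm_mat_powr_contract(2)[OF a(1) b D rt, of \<omega>] \<omega> by simp
        finally have "((mat_powr r D *v \<theta>) \<bullet> u)\<^sup>2 \<le> ((r * t) powr (1 / b))\<^sup>2"
          using power_mono[of "\<bar>(mat_powr r D *v \<theta>) \<bullet> u\<bar>" _ 2] by simp
        also have "\<dots> = (r * t) powr (2 / b)"
          unfolding power2_eq_square powr_add[symmetric] by simp
        finally show ?thesis using one_minus_cos_bounds(1)[of "(mat_powr r D *v \<theta>) \<bullet> u"] by simp
      qed
      from inner[OF _ this] have "?I r \<le> ennreal (S * ((r * t) powr (2 / b) / 2))" by simp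
      then have "?I r * ennreal (1 / r\<^sup>2) \<le> ennreal (S * ((r * t) powr (2 / b) / 2)) * ennreal (1 / r\<^sup>2)"
        by (rule mult_right_mono) simp
      also have "\<dots> = ennreal (S * ((r * t) powr (2 / b) / 2) * (1 / r\<^sup>2))"
        using S by (simp add: ennreal_mult[symmetric])
      also have "(r * t) powr (2 / b) / r\<^sup>2 = t powr (2 / b) * r powr p"
        using r t by (simp add: p_def powr_mult powr_diff powr_numeral)
      then have "S * ((r * t) powr (2 / b) / 2) * (1 / r\<^sup>2) = S / 2 * t powr (2 / b) * r powr p"
        by (simp add: field_simps)
      finally show ?thesis .
    qed
    have far: "?I r * ennreal (1 / r\<^sup>2) \<le> ennreal (2 * S * r powr - 2)" if r: "1 / t \<le> r" for r
    proof -
      have "0 < r" using r t by (meson less_le_trans divide_pos_pos zero_less_one)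
      have "1 - cos x \<le> 2" for x :: real using cos_ge_minus_one[of x] by linarith
      then have "?I r \<le> ennreal (S * 2)" by (intro inner) auto
      then have "?I r * ennreal (1 / r\<^sup>2) \<le> ennreal (S * 2) * ennreal (1 / r\<^sup>2)"
        by (rule mult_right_mono) simp
      also have "\<dots> = ennreal (2 * S * r powr - 2)"
        using S \<open>0 < r\<close> by (simp add: ennreal_mult[symmetric] powr_minus powr_numeral divide_inverse mult_ac)
      finally show ?thesis .
    qed
    have i1: "(\<integral>\<^sup>+ r. indicator {0..1 / t} r * (S / 2 * t powr (2 / b) * r powr p) \<partial>lborel)
        = ennreal (S / 2 * t powr (2 / b) * ((1 / t) powr (p + 1) / (p + 1)))"
      using S t p has_integral_mult_right[OF has_integral_powr_from_0[OF p, of "1 / t"], of "S / 2 * t powr (2 / b)"]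
      by (intro nn_integral_has_integral_lebesgue) simp_all
    have i2: "(\<integral>\<^sup>+ r. indicator {1 / t..} r * (2 * S * r powr - 2) \<partial>lborel)
        = ennreal (2 * S * (- ((1 / t) powr (-2 + 1)) / (-2 + 1)))"
      using S t has_integral_mult_right[OF has_integral_powr_to_inf[of "-2" "1 / t"], of "2 * S"]
      by (intro nn_integral_has_integral_lebesgue) simp_all
    have "levy_nn \<sigma> D u \<le> (\<integral>\<^sup>+ r. ennreal (indicator {0..1 / t} r * (S / 2 * t powr (2 / b) * r powr p))
        + ennreal (indicator {1 / t..} r * (2 * S * r powr - 2)) \<partial>lborel)"
      unfolding levy_nn_def
    proof (rule nn_integral_mono)
      fix r :: real
      show "?I r * (indicator {0<..} r * ennreal (1 / r\<^sup>2))
          \<le> ennreal (indicator {0..1 / t} r * (S / 2 * t powr (2 / b) * r powr p))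
            + ennreal (indicator {1 / t..} r * (2 * S * r powr - 2))"
      proof (cases "r \<le> 0")
        case True
        then show ?thesis by simp
      next
        case False
        then have r: "0 < r" by simp
        show ?thesis
        proof (cases "r \<le> 1 / t")
          case True
          have "?I r * (indicator {0<..} r * ennreal (1 / r\<^sup>2)) = ?I r * ennreal (1 / r\<^sup>2)" using r by simp
          also have "\<dots> \<le> ennreal (indicator {0..1 / t} r * (S / 2 * t powr (2 / b) * r powr p))"
            using near[OF r True] r True by simp
          also have "\<dots> \<le> \<dots> + ennreal (indicator {1 / t..} r * (2 * S * r powr - 2))"
            by (rule add_increasing2) simp_all
          finally show ?thesis .
        next
          case False
          then have "1 / t \<le> r" by simp
          have "?I r * (indicator {0<..} r * ennreal (1 / r\<^sup>2)) = ?I r * ennreal (1 / r\<^sup>2)" using r by simp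
          also have "\<dots> \<le> ennreal (indicator {1 / t..} r * (2 * S * r powr - 2))"
            using far[OF \<open>1 / t \<le> r\<close>] \<open>1 / t \<le> r\<close> by simp
          also have "\<dots> \<le> ennreal (indicator {0..1 / t} r * (S / 2 * t powr (2 / b) * r powr p)) + \<dots>"
            by (rule add_increasing) simp_all
          finally show ?thesis .
        qed
      qed
    qed
    also have "\<dots> = (\<integral>\<^sup>+ r. ennreal (indicator {0..1 / t} r * (S / 2 * t powr (2 / b) * r powr p)) \<partial>lborel)
        + (\<integral>\<^sup>+ r. ennreal (indicator {1 / t..} r * (2 * S * r powr - 2)) \<partial>lborel)"
      by (rule nn_integral_add) measurable
    also have "\<dots> = ennreal (S / 2 * t powr (2 / b) * ((1 / t) powr (p + 1) / (p + 1)))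
        + ennreal (2 * S * (- ((1 / t) powr (-2 + 1)) / (-2 + 1)))"
      by (simp only: i1 i2)
    also have "S / 2 * t powr (2 / b) * ((1 / t) powr (p + 1) / (p + 1)) = S / (2 * (p + 1)) * t"
    proof -
      have "t powr (2 / b) * (1 / t) powr (p + 1) = t powr (2 / b) / t powr (2 / b - 1)"
        using t by (simp add: p_def powr_divide)
      also have "\<dots> = t" using t by (simp add: powr_diff)
      finally have e: "t powr (2 / b) * (1 / t) powr (p + 1) = t" .
      have "S / 2 * t powr (2 / b) * ((1 / t) powr (p + 1) / (p + 1))
          = S / (2 * (p + 1)) * (t powr (2 / b) * (1 / t) powr (p + 1))" by simp
      then show ?thesis by (simp only: e)
    qed
    also have "2 * S * (- ((1 / t) powr (-2 + 1)) / (-2 + 1)) = 2 * S * t"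
      using t by (simp add: powr_minus powr_one)
    also have "ennreal (S / (2 * (p + 1)) * t) + ennreal (2 * S * t) = ennreal ((1 / (2 * (p + 1)) + 2) * S * t)"
      using S t p by (simp add: ennreal_plus[symmetric] distrib_right del: ennreal_plus)
    also have "\<dots> \<le> ennreal (K * t)"
      using t by (intro ennreal_leI) (simp add: K_def distrib_right)
    finally show ?thesis by (simp add: t_def)
  qed
  then show ?thesis using K by blast
qed

text \<open>For \<open>r\<close> between \<open>1/(2t)\<close> and \<open>1/t\<close> with \<open>t = tau D u\<close>, the vector \<open>r\<^sup>Du\<close> has norm at most 1 and
  bounded away from 0; there \<open>1 - cos y\<close> is comparable to \<open>y\<^sup>2\<close> and nondegeneracy applies.\<close>

lemma levy_nn_lower:
  assumes a: "0 < a" "a \<le> b"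
  shows "\<exists>K>0. \<forall>D u. pinched a b D \<longrightarrow> ennreal (K * tau D u) \<le> levy_nn \<sigma> D u"
proof -
  have b: "0 < b" using a by simp
  obtain \<kappa> where \<kappa>: "0 < \<kappa>" "\<And>w. ennreal (\<kappa> * (norm w)\<^sup>2) \<le> (\<integral>\<^sup>+ \<theta>. ennreal ((\<theta> \<bullet> w)\<^sup>2) \<partial>\<sigma>)"
    using spectral_measure_nondegenerate[OF \<sigma>] by blast
  define q where "q = (1 / 2 :: real) powr (1 / a)"
  have q: "0 < q" by (simp add: q_def)
  define K where "K = \<kappa> * q\<^sup>2 / 6"
  have K: "K > 0" using \<kappa> q by (simp add: K_def)
  have "ennreal (K * tau D u) \<le> levy_nn \<sigma> D u" if D: "pinched a b D" for D u
  proof (cases "u = 0")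
    case True
    then show ?thesis by (simp add: tau_zero[OF a(1) b D])
  next
    case False
    define t where "t = tau D u"
    define \<omega> where "\<omega> = mat_powr (1 / t) D *v u"
    have t: "0 < t" and \<omega>: "norm \<omega> = 1" using tau_polar[OF a(1) b D False] by (auto simp: t_def \<omega>_def)
    have rD: "mat_powr r D *v u = mat_powr (r * t) D *v \<omega>" if "0 < r" for r
      unfolding \<omega>_def using that t mat_powr_mult[OF a(1) b D, of "r * t" "1 / t" u] by simp
    let ?I = "\<lambda>r. \<integral>\<^sup>+ \<theta>. ennreal (1 - cos ((mat_powr r D *v \<theta>) \<bullet> u)) \<partial>\<sigma>"
    have low: "ennreal (\<kappa> * q\<^sup>2 / 3 * t\<^sup>2) \<le> ?I r * ennreal (1 / r\<^sup>2)" if r: "1 / (2 * t) \<le> r" "r \<le> 1 / t" for r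
    proof -
      have r0: "0 < r" using r t by (meson less_le_trans divide_pos_pos zero_less_one mult_pos_pos zero_less_numeral)
      have rt: "0 < r * t" "r * t \<le> 1" "1 / 2 \<le> r * t" using r r0 t by (auto simp: field_simps)
      define w where "w = mat_powr (r * t) D *v \<omega>"
      have w1: "norm w \<le> 1"
      proof -
        have "norm w \<le> (r * t) powr (1 / b)"
          using norm_mat_powr_contract(2)[OF a(1) b D rt(1,2), of \<omega>] \<omega> by (simp add: w_def)
        also have "\<dots> \<le> 1" using rt b by (intro powr_le1) simp_all
        finally show ?thesis .
      qed
      have w2: "q \<le> norm w"
      proof -
        have "q \<le> (r * t) powr (1 / a)" unfolding q_def using rt a by (intro powr_mono2) simp_all
        also have "\<dots> \<le> norm w"
          using norm_mat_powr_contract(1)[OF a(1) b D rt(1,2), of \<omega>] \<omega> by (simp add: w_def)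
        finally show ?thesis .
      qed
      have inn: "(mat_powr r D *v \<theta>) \<bullet> u = \<theta> \<bullet> w" for \<theta>
        using mat_powr_symmetric[OF a(1) b D r0] rD[OF r0] by (simp add: w_def)
      have "ennreal (\<kappa> * q\<^sup>2 / 3) \<le> ennreal (1 / 3 * (\<kappa> * (norm w)\<^sup>2))"
        using \<kappa> q w2 by (intro ennreal_leI) (simp add: power_mono)
      also have "\<dots> = ennreal (1 / 3) * ennreal (\<kappa> * (norm w)\<^sup>2)"
        using \<kappa> by (subst ennreal_mult) simp_all
      also have "\<dots> \<le> ennreal (1 / 3) * (\<integral>\<^sup>+ \<theta>. ennreal ((\<theta> \<bullet> w)\<^sup>2) \<partial>\<sigma>)"
        by (intro mult_left_mono \<kappa>(2)) simp
      also have "\<dots> = (\<integral>\<^sup>+ \<theta>. ennreal (1 / 3) * ennreal ((\<theta> \<bullet> w)\<^sup>2) \<partial>\<sigma>)"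
        by (rule nn_integral_cmult[symmetric]) measurable
      also have "\<dots> \<le> ?I r"
      proof (rule nn_integral_mono)
        fix \<theta> assume "\<theta> \<in> space \<sigma>"
        then have "norm \<theta> = 1" using spectral_measure_identity_measurable(2)[OF \<sigma>] by simp
        then have "\<bar>\<theta> \<bullet> w\<bar> \<le> 1" using Cauchy_Schwarz_ineq2[of \<theta> w] w1 by simp
        from one_minus_cos_bounds(2)[OF this]
        show "ennreal (1 / 3) * ennreal ((\<theta> \<bullet> w)\<^sup>2) \<le> ennreal (1 - cos ((mat_powr r D *v \<theta>) \<bullet> u))"
          unfolding inn by (subst ennreal_mult[symmetric]) (simp_all add: ennreal_leI)
      qed
      finally have I: "ennreal (\<kappa> * q\<^sup>2 / 3) \<le> ?I r" .
      have "r * r \<le> (1 / t) * (1 / t)" using r r0 t by (intro mult_mono) simp_all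
      then have "t\<^sup>2 \<le> 1 / r\<^sup>2" using r0 t by (simp add: field_simps power2_eq_square)
      then have "ennreal (\<kappa> * q\<^sup>2 / 3) * ennreal (t\<^sup>2) \<le> ?I r * ennreal (1 / r\<^sup>2)"
        using I by (intro mult_mono ennreal_leI) simp_all
      moreover have "ennreal (\<kappa> * q\<^sup>2 / 3 * t\<^sup>2) = ennreal (\<kappa> * q\<^sup>2 / 3) * ennreal (t\<^sup>2)"
        using \<kappa> by (intro ennreal_mult) simp_all
      ultimately show ?thesis by (simp only:)
    qed
    have "ennreal (K * t) = (\<integral>\<^sup>+ r. ennreal (\<kappa> * q\<^sup>2 / 3 * t\<^sup>2) * indicator {1 / (2 * t)..1 / t} r \<partial>lborel)"
    proof -
      have "1 / t - 1 / (2 * t) = 1 / (2 * t)" by (simp add: field_simps)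
      moreover have "1 / (2 * t) \<le> 1 / t" using t by (simp add: field_simps)
      ultimately have "emeasure lborel {1 / (2 * t)..1 / t} = ennreal (1 / (2 * t))" by simp
      then have "(\<integral>\<^sup>+ r. ennreal (\<kappa> * q\<^sup>2 / 3 * t\<^sup>2) * indicator {1 / (2 * t)..1 / t} r \<partial>lborel)
          = ennreal (\<kappa> * q\<^sup>2 / 3 * t\<^sup>2) * ennreal (1 / (2 * t))"
        by (subst nn_integral_cmult_indicator) simp_all
      also have "\<dots> = ennreal (\<kappa> * q\<^sup>2 / 3 * t\<^sup>2 * (1 / (2 * t)))"
        using \<kappa> t by (subst ennreal_mult) simp_all
      also have "\<kappa> * q\<^sup>2 / 3 * t\<^sup>2 * (1 / (2 * t)) = K * t"
        using t by (simp add: K_def power2_eq_square)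
      finally show ?thesis by simp
    qed
    also have "\<dots> \<le> levy_nn \<sigma> D u"
      unfolding levy_nn_def
    proof (rule nn_integral_mono)
      fix r :: real
      show "ennreal (\<kappa> * q\<^sup>2 / 3 * t\<^sup>2) * indicator {1 / (2 * t)..1 / t} r
          \<le> ?I r * (indicator {0<..} r * ennreal (1 / r\<^sup>2))"
      proof (cases "r \<in> {1 / (2 * t)..1 / t}")
        case True
        then have "0 < r" using t by (auto intro: less_le_trans[of 0 "1 / (2 * t)"])
        then show ?thesis using low[of r] True by simp
      qed simp
    qed
    finally show ?thesis by (simp add: t_def)
  qed
  then show ?thesis using K by blast
qed

end

section \<open>Random integrals of simple functions\<close>

lemma disjoint_sum_indicator_at:
  fixes R :: "'i \<Rightarrow> 'v::real_vector"
  assumes "finite I" "disjoint_family_on A I" "i \<in> I" "s \<in> A i"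
  shows "(\<Sum>j\<in>I. indicat_real (A j) s *\<^sub>R R j) = R i"
proof -
  have "(\<Sum>j\<in>I. indicat_real (A j) s *\<^sub>R R j) = (\<Sum>j\<in>I. if j = i then R i else 0)"
  proof (rule sum.cong[OF refl])
    fix j assume "j \<in> I"
    show "indicat_real (A j) s *\<^sub>R R j = (if j = i then R i else 0)"
      using assms \<open>j \<in> I\<close> by (cases "j = i") (auto simp: disjoint_family_on_def indicator_def)
  qed
  also have "\<dots> = R i" using assms by simp
  finally show ?thesis .
qed

lemma disjoint_sum_indicator_outside:
  fixes R :: "'i \<Rightarrow> 'v::real_vector"
  assumes "\<And>i. i \<in> I \<Longrightarrow> s \<notin> A i"
  shows "(\<Sum>j\<in>I. indicat_real (A j) s *\<^sub>R R j) = 0"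
  using assms by (intro sum.neutral) simp

lemma simple_fn_iff:
  fixes F :: "'s \<Rightarrow> real^'m^'m"
  shows "simple_fn \<nu> F \<longleftrightarrow> simple_function \<nu> F \<and> emeasure \<nu> {s \<in> space \<nu>. F s \<noteq> 0} < \<infinity>"
proof
  assume "simple_fn \<nu> F"
  then obtain n R A where rep: "simple_rep \<nu> F n R A"
    unfolding simple_fn_def by blast
  have A: "\<And>j. j < n \<Longrightarrow> A j \<in> fin_sets \<nu>"
    and F: "\<And>s. s \<in> space \<nu> \<Longrightarrow> F s = (\<Sum>j<n. indicat_real (A j) s *\<^sub>R R j)"
    using rep by (auto simp: simple_rep_def)
  have As: "A j \<in> sets \<nu>" "emeasure \<nu> (A j) < \<infinity>" if "j < n" for j
    using A[OF that] by (auto simp: fin_sets_def)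
  have "simple_function \<nu> (\<lambda>s. \<Sum>j<n. indicat_real (A j) s *\<^sub>R R j)"
    using As by (intro simple_function_sum simple_function_compose1[of _ _ "\<lambda>x. x *\<^sub>R _"] simple_function_indicator) simp
  then have sF: "simple_function \<nu> F" using F by (subst simple_function_cong) auto
  have "{s \<in> space \<nu>. F s \<noteq> 0} \<subseteq> (\<Union>j<n. A j)"
  proof
    fix s assume s: "s \<in> {s \<in> space \<nu>. F s \<noteq> 0}"
    show "s \<in> (\<Union>j<n. A j)"
    proof (rule ccontr)
      assume "s \<notin> (\<Union>j<n. A j)"
      then have "(\<Sum>j<n. indicat_real (A j) s *\<^sub>R R j) = 0"
        by (intro disjoint_sum_indicator_outside) auto
      moreover have "F s = (\<Sum>j<n. indicat_real (A j) s *\<^sub>R R j)" using s by (intro F) simp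
      ultimately have "F s = 0" by (simp only:)
      then show False using s by simp
    qed
  qed
  then have "emeasure \<nu> {s \<in> space \<nu>. F s \<noteq> 0} \<le> emeasure \<nu> (\<Union>j<n. A j)"
    using As by (intro emeasure_mono sets.finite_UN) auto
  also have "\<dots> \<le> (\<Sum>j<n. emeasure \<nu> (A j))" using As by (intro emeasure_subadditive_finite) auto
  also have "\<dots> < \<infinity>" using As by (simp add: ennreal_sum_less_top)
  finally show "simple_function \<nu> F \<and> emeasure \<nu> {s \<in> space \<nu>. F s \<noteq> 0} < \<infinity>" using sF by simp
next
  assume *: "simple_function \<nu> F \<and> emeasure \<nu> {s \<in> space \<nu>. F s \<noteq> 0} < \<infinity>"
  define V where "V = F ` space \<nu> - {0}"
  define L where "L v = F -` {v} \<inter> space \<nu>" for v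
  have fin: "finite V" using * by (auto simp: V_def simple_function_def)
  obtain h where h: "bij_betw h {0..<card V} V" using ex_bij_betw_nat_finite[OF fin] by blast
  have L: "L v \<in> fin_sets \<nu>" if "v \<in> V" for v
  proof -
    have m: "L v \<in> sets \<nu>" using * that by (auto simp: L_def V_def simple_function_def)
    have sup: "{s \<in> space \<nu>. F s \<noteq> 0} \<in> sets \<nu>"
    proof -
      have "{s \<in> space \<nu>. F s \<noteq> 0} = (\<Union>v\<in>V. L v)" by (auto simp: L_def V_def)
      also have "\<dots> \<in> sets \<nu>"
        using fin * by (intro sets.finite_UN) (auto simp: L_def V_def simple_function_def)
      finally show ?thesis .
    qed
    have "L v \<subseteq> {s \<in> space \<nu>. F s \<noteq> 0}" using that by (auto simp: L_def V_def)
    then have "emeasure \<nu> (L v) \<le> emeasure \<nu> {s \<in> space \<nu>. F s \<noteq> 0}" by (intro emeasure_mono sup)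
    then show ?thesis using m * by (auto simp: fin_sets_def le_less_trans)
  qed
  have inj: "inj_on h {..<card V}" and hV: "h ` {..<card V} = V"
    using h by (auto simp: bij_betw_def atLeast0LessThan)
  have dis: "disjoint_family_on (\<lambda>j. L (h j)) {..<card V}"
    using inj by (auto simp: disjoint_family_on_def L_def inj_on_def)
  have "F s = (\<Sum>j<card V. indicat_real (L (h j)) s *\<^sub>R h j)" if s: "s \<in> space \<nu>" for s
  proof (cases "F s = 0")
    case True
    have "(\<Sum>j<card V. indicat_real (L (h j)) s *\<^sub>R h j) = 0"
      using True hV by (intro disjoint_sum_indicator_outside) (auto simp: L_def V_def)
    then show ?thesis using True by simp
  next
    case False
    then have "F s \<in> V" using s by (auto simp: V_def)
    then obtain j where j: "j < card V" "h j = F s" using hV by (metis imageE lessThan_iff)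
    have "(\<Sum>j<card V. indicat_real (L (h j)) s *\<^sub>R h j) = h j"
      by (rule disjoint_sum_indicator_at[OF _ dis]) (use j s in \<open>auto simp: L_def\<close>)
    then show ?thesis using j by simp
  qed
  then have "simple_rep \<nu> F (card V) h (\<lambda>j. L (h j))"
    unfolding simple_rep_def using dis L hV by blast
  then show "simple_fn \<nu> F" unfolding simple_fn_def by blast
qed

locale os_isrm =
  fixes \<nu> :: "'s measure" and B :: "'s \<Rightarrow> real^'m^'m" and \<sigma> :: "(real^'m) measure"
    and P :: "'w measure" and M :: "'s set \<Rightarrow> 'w \<Rightarrow> real^'m" and a b :: real
  assumes sigma_finite_\<nu>: "sigma_finite_measure \<nu>"
    and B_measurable: "B \<in> borel_measurable \<nu>"
    and B_pinched: "\<And>s. s \<in> space \<nu> \<Longrightarrow> pinched a b (B s)"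
    and a_gt_0: "0 < a" and a_le_b: "a \<le> b" and b_less_2: "b < 2"
    and spectral: "spectral_measure \<sigma>"
    and isrm: "multi_os_isrm \<nu> B \<sigma> P M"
begin

sublocale prob_space P using isrm by (simp add: multi_os_isrm_def)

sublocale scaling_modular \<nu> "\<lambda>s. box_gauge (B s)" a b "2 powr b" "(1 / real CARD('m)) powr b" "real CARD('m) powr b"
  by (rule scaling_modular_box_gauge[OF a_gt_0 a_le_b B_measurable B_pinched])

lemma M_measurable: "A \<in> fin_sets \<nu> \<Longrightarrow> M A \<in> borel_measurable P"
  using isrm by (simp add: multi_os_isrm_def)

lemma fin_sets_subset: "A \<in> fin_sets \<nu> \<Longrightarrow> C \<in> sets \<nu> \<Longrightarrow> C \<subseteq> A \<Longrightarrow> C \<in> fin_sets \<nu>"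
  using emeasure_mono[of C A \<nu>] by (auto simp: fin_sets_def le_less_trans)

lemma fin_sets_empty: "{} \<in> fin_sets \<nu>" by (simp add: fin_sets_def)

lemma fin_sets_sets: "A \<in> fin_sets \<nu> \<Longrightarrow> A \<in> sets \<nu>" by (simp add: fin_sets_def)

lemma fin_sets_UN:
  assumes "finite I" "\<And>i. i \<in> I \<Longrightarrow> A i \<in> fin_sets \<nu>"
  shows "(\<Union>i\<in>I. A i) \<in> fin_sets \<nu>"
proof -
  have "emeasure \<nu> (\<Union>i\<in>I. A i) \<le> (\<Sum>i\<in>I. emeasure \<nu> (A i))"
    using assms by (intro emeasure_subadditive_finite) (auto simp: fin_sets_def)
  also have "\<dots> < \<infinity>" using assms by (auto simp: ennreal_sum_less_top fin_sets_def)
  finally show ?thesis using assms by (auto simp: fin_sets_def)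
qed

lemma M_sigma_additive:
  fixes A :: "nat \<Rightarrow> 's set"
  assumes "\<And>i. A i \<in> fin_sets \<nu>" "disjoint_family A" "(\<Union>i. A i) \<in> fin_sets \<nu>"
  shows "AE \<omega> in P. (\<lambda>i. M (A i) \<omega>) sums M (\<Union>i. A i) \<omega>"
proof -
  have "range A \<subseteq> fin_sets \<nu>" using assms(1) by blast
  then show ?thesis using isrm assms(2,3) unfolding multi_os_isrm_def by blast
qed

text \<open>A constant sequence is summable only if it is zero.\<close>

lemma M_empty: "AE \<omega> in P. M {} \<omega> = 0"
proof -
  have "AE \<omega> in P. (\<lambda>i :: nat. M {} \<omega>) sums M (\<Union>i :: nat. {}) \<omega>"
    by (rule M_sigma_additive) (auto simp: fin_sets_empty disjoint_family_on_def)
  then show ?thesis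
  proof (rule AE_mp, intro AE_I2 impI)
    fix \<omega> assume "(\<lambda>i :: nat. M {} \<omega>) sums M (\<Union>i :: nat. {}) \<omega>"
    then have "summable (\<lambda>i :: nat. M {} \<omega>)" by (rule sums_summable)
    then show "M {} \<omega> = 0" by (simp add: summable_const_iff)
  qed
qed

lemma M_Un:
  assumes A: "A \<in> fin_sets \<nu>" and C: "C \<in> fin_sets \<nu>" and dis: "A \<inter> C = {}"
  shows "AE \<omega> in P. M (A \<union> C) \<omega> = M A \<omega> + M C \<omega>"
proof -
  define E where "E i = (if i = 0 then A else if i = Suc 0 then C else {})" for i :: nat
  have UE: "(\<Union>i. E i) = A \<union> C"
  proof
    show "(\<Union>i. E i) \<subseteq> A \<union> C" by (auto simp: E_def split: if_splits)
    have "E 0 = A" "E (Suc 0) = C" by (simp_all add: E_def)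
    then show "A \<union> C \<subseteq> (\<Union>i. E i)" by blast
  qed
  have "(\<Union>i\<in>{0, Suc 0}. E i) \<in> fin_sets \<nu>"
    using A C by (intro fin_sets_UN) (auto simp: E_def)
  then have U: "A \<union> C \<in> fin_sets \<nu>" by (simp add: E_def Un_commute)
  have "AE \<omega> in P. (\<lambda>i. M (E i) \<omega>) sums M (\<Union>i. E i) \<omega>"
    using A C dis fin_sets_empty U UE
    by (intro M_sigma_additive) (auto simp: E_def disjoint_family_on_def)
  with M_empty show ?thesis
  proof eventually_elim
    case (elim \<omega>)
    have "(\<lambda>i. M (E i) \<omega>) sums (\<Sum>i\<in>{0, Suc 0}. M (E i) \<omega>)"
      using elim(1) by (intro sums_finite) (auto simp: E_def)
    then show ?case using elim(2) sums_unique2 unfolding UE by (fastforce simp: E_def)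
  qed
qed

lemma M_finite_UN:
  assumes "finite I" "\<And>i. i \<in> I \<Longrightarrow> A i \<in> fin_sets \<nu>" "disjoint_family_on A I"
  shows "AE \<omega> in P. M (\<Union>i\<in>I. A i) \<omega> = (\<Sum>i\<in>I. M (A i) \<omega>)"
  using assms
proof (induction I rule: finite_induct)
  case empty
  then show ?case using M_empty by simp
next
  case (insert i I)
  have d: "disjoint_family_on A I" "A i \<inter> (\<Union>j\<in>I. A j) = {}"
    using insert.prems(2) insert.hyps(2) by (auto simp: disjoint_family_on_def)
  have "AE \<omega> in P. M (\<Union>j\<in>I. A j) \<omega> = (\<Sum>j\<in>I. M (A j) \<omega>)"
    using insert.IH insert.prems(1) d by simp
  moreover have "AE \<omega> in P. M (A i \<union> (\<Union>j\<in>I. A j)) \<omega> = M (A i) \<omega> + M (\<Union>j\<in>I. A j) \<omega>"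
    using insert.prems(1) insert.hyps(1) d(2) by (intro M_Un fin_sets_UN) auto
  ultimately show ?case
  proof eventually_elim
    case (elim \<omega>)
    then show ?case using insert.hyps by simp
  qed
qed

text \<open>The part of \<open>A i\<close> outside all \<open>C j\<close> contributes nothing: it is empty, or the common function vanishes
  there and \<open>R i = 0\<close>.\<close>

lemma simple_sum_refine:
  assumes I: "finite I" "\<And>i. i \<in> I \<Longrightarrow> A i \<in> fin_sets \<nu>" "disjoint_family_on A I"
    and J: "finite J" "\<And>j. j \<in> J \<Longrightarrow> C j \<in> fin_sets \<nu>" "disjoint_family_on C J"
    and eq: "\<And>s. s \<in> space \<nu> \<Longrightarrow>
      (\<Sum>i\<in>I. indicat_real (A i) s *\<^sub>R R i) = (\<Sum>j\<in>J. indicat_real (C j) s *\<^sub>R (Q j :: real^'m^'m))"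
  shows "AE \<omega> in P. (\<Sum>i\<in>I. R i *v M (A i) \<omega>) = (\<Sum>i\<in>I. \<Sum>j\<in>J. R i *v M (A i \<inter> C j) \<omega>)"
proof -
  have "AE \<omega> in P. \<forall>i\<in>I. R i *v M (A i) \<omega> = (\<Sum>j\<in>J. R i *v M (A i \<inter> C j) \<omega>)"
  proof (subst AE_finite_all[OF I(1)], intro ballI)
    fix i assume i: "i \<in> I"
    let ?D = "A i - (\<Union>j\<in>J. C j)"
    have int: "A i \<inter> C j \<in> fin_sets \<nu>" if "j \<in> J" for j
      using fin_sets_sets[OF I(2)[OF i]] fin_sets_sets[OF J(2)[OF that]]
      by (intro fin_sets_subset[OF I(2)[OF i]]) auto
    have D: "?D \<in> fin_sets \<nu>"
      using fin_sets_sets[OF I(2)[OF i]] fin_sets_sets[OF fin_sets_UN[OF J(1,2)]]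
      by (intro fin_sets_subset[OF I(2)[OF i]]) auto
    have "AE \<omega> in P. M (\<Union>j\<in>J. A i \<inter> C j) \<omega> = (\<Sum>j\<in>J. M (A i \<inter> C j) \<omega>)"
    proof (rule M_finite_UN[OF J(1) int])
      show "disjoint_family_on (\<lambda>j. A i \<inter> C j) J" using J(3) unfolding disjoint_family_on_def by blast
    qed
    moreover have "AE \<omega> in P. M ((\<Union>j\<in>J. A i \<inter> C j) \<union> ?D) \<omega> = M (\<Union>j\<in>J. A i \<inter> C j) \<omega> + M ?D \<omega>"
      using int J D by (intro M_Un fin_sets_UN) auto
    moreover have "(\<Union>j\<in>J. A i \<inter> C j) \<union> ?D = A i" by blast
    moreover have "AE \<omega> in P. R i *v M ?D \<omega> = 0"
    proof (cases "?D = {}")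
      case True
      show ?thesis unfolding True using M_empty by eventually_elim simp
    next
      case False
      then obtain s where s: "s \<in> A i" "\<And>j. j \<in> J \<Longrightarrow> s \<notin> C j" by blast
      have "s \<in> space \<nu>" using s(1) fin_sets_sets[OF I(2)[OF i]] sets.sets_into_space by blast
      then have "R i = 0"
        using eq[of s] disjoint_sum_indicator_at[OF I(1,3) i s(1), of R]
          disjoint_sum_indicator_outside[of J s C Q] s(2) by simp
      then show ?thesis by simp
    qed
    ultimately show "AE \<omega> in P. R i *v M (A i) \<omega> = (\<Sum>j\<in>J. R i *v M (A i \<inter> C j) \<omega>)"
    proof -
      assume 1: "AE \<omega> in P. M (\<Union>j\<in>J. A i \<inter> C j) \<omega> = (\<Sum>j\<in>J. M (A i \<inter> C j) \<omega>)"
        and 2: "AE \<omega> in P. M ((\<Union>j\<in>J. A i \<inter> C j) \<union> ?D) \<omega> = M (\<Union>j\<in>J. A i \<inter> C j) \<omega> + M ?D \<omega>"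
        and 3: "(\<Union>j\<in>J. A i \<inter> C j) \<union> ?D = A i" and 4: "AE \<omega> in P. R i *v M ?D \<omega> = 0"
      from 1 2 4 show ?thesis unfolding 3
        by eventually_elim
          (simp add: matrix_vector_right_distrib linear_sum[OF matrix_vector_mul_linear])
    qed
  qed
  then show ?thesis by eventually_elim simp
qed

text \<open>Refine both representations to the sets \<open>A i \<inter> C j\<close>; where these are nonempty, the coefficients agree.\<close>

lemma simple_sum_unique:
  assumes I: "finite I" "\<And>i. i \<in> I \<Longrightarrow> A i \<in> fin_sets \<nu>" "disjoint_family_on A I"
    and J: "finite J" "\<And>j. j \<in> J \<Longrightarrow> C j \<in> fin_sets \<nu>" "disjoint_family_on C J"
    and eq: "\<And>s. s \<in> space \<nu> \<Longrightarrow>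
      (\<Sum>i\<in>I. indicat_real (A i) s *\<^sub>R R i) = (\<Sum>j\<in>J. indicat_real (C j) s *\<^sub>R (Q j :: real^'m^'m))"
  shows "AE \<omega> in P. (\<Sum>i\<in>I. R i *v M (A i) \<omega>) = (\<Sum>j\<in>J. Q j *v M (C j) \<omega>)"
proof -
  have 1: "AE \<omega> in P. (\<Sum>i\<in>I. R i *v M (A i) \<omega>) = (\<Sum>i\<in>I. \<Sum>j\<in>J. R i *v M (A i \<inter> C j) \<omega>)"
    by (rule simple_sum_refine[OF I J eq])
  have 2: "AE \<omega> in P. (\<Sum>j\<in>J. Q j *v M (C j) \<omega>) = (\<Sum>j\<in>J. \<Sum>i\<in>I. Q j *v M (C j \<inter> A i) \<omega>)"
    by (rule simple_sum_refine[OF J I eq[symmetric]])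
  have 3: "AE \<omega> in P. \<forall>i\<in>I. \<forall>j\<in>J. R i *v M (A i \<inter> C j) \<omega> = Q j *v M (A i \<inter> C j) \<omega>"
  proof (subst AE_finite_all[OF I(1)], intro ballI, subst AE_finite_all[OF J(1)], intro ballI)
    fix i j assume ij: "i \<in> I" "j \<in> J"
    show "AE \<omega> in P. R i *v M (A i \<inter> C j) \<omega> = Q j *v M (A i \<inter> C j) \<omega>"
    proof (cases "A i \<inter> C j = {}")
      case True
      show ?thesis unfolding True using M_empty by eventually_elim simp
    next
      case False
      then obtain s where s: "s \<in> A i" "s \<in> C j" by blast
      have "s \<in> space \<nu>" using s(1) fin_sets_sets[OF I(2)[OF ij(1)]] sets.sets_into_space by blast
      then have "R i = Q j"
        using eq[of s] disjoint_sum_indicator_at[OF I(1,3) ij(1) s(1), of R]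
          disjoint_sum_indicator_at[OF J(1,3) ij(2) s(2), of Q] by simp
      then show ?thesis by simp
    qed
  qed
  from 1 2 3 show ?thesis
  proof eventually_elim
    case (elim \<omega>)
    have "(\<Sum>i\<in>I. \<Sum>j\<in>J. R i *v M (A i \<inter> C j) \<omega>) = (\<Sum>i\<in>I. \<Sum>j\<in>J. Q j *v M (C j \<inter> A i) \<omega>)"
      using elim(3) by (intro sum.cong) (auto simp: Int_commute)
    also have "\<dots> = (\<Sum>j\<in>J. \<Sum>i\<in>I. Q j *v M (C j \<inter> A i) \<omega>)" by (rule sum.swap)
    finally show ?case using elim(1,2) by simp
  qed
qed

abbreviation sint :: "('s \<Rightarrow> real^'m^'m) \<Rightarrow> 'w \<Rightarrow> real^'m" where
  "sint \<equiv> simple_integral \<nu> M"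

lemma simple_integral_rep:
  assumes "simple_fn \<nu> F"
  obtains n R A where "simple_rep \<nu> F n R A"
    "sint F = (\<lambda>\<omega>. \<Sum>j<n. R j *v M (A j) \<omega>)"
proof -
  have "\<exists>X n R A. simple_rep \<nu> F n R A \<and> X = (\<lambda>\<omega>. \<Sum>j<n. R j *v M (A j) \<omega>)"
    using assms by (auto simp: simple_fn_def)
  from someI_ex[OF this] show thesis unfolding simple_integral_def[symmetric] using that by blast
qed

lemma simple_integral_eq_sum:
  assumes F: "simple_fn \<nu> F"
    and I: "finite I" "\<And>i. i \<in> I \<Longrightarrow> A i \<in> fin_sets \<nu>" "disjoint_family_on A I"
    and eq: "\<And>s. s \<in> space \<nu> \<Longrightarrow> F s = (\<Sum>i\<in>I. indicat_real (A i) s *\<^sub>R R i)"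
  shows "AE \<omega> in P. sint F \<omega> = (\<Sum>i\<in>I. R i *v M (A i) \<omega>)"
proof -
  obtain n Q C where rep: "simple_rep \<nu> F n Q C"
    and X: "sint F = (\<lambda>\<omega>. \<Sum>j<n. Q j *v M (C j) \<omega>)"
    using simple_integral_rep[OF F] .
  show ?thesis unfolding X
    using rep I eq by (intro simple_sum_unique) (auto simp: simple_rep_def)
qed

lemma simple_integral_measurable:
  assumes "simple_fn \<nu> F"
  shows "sint F \<in> borel_measurable P"
proof -
  obtain n Q C where rep: "simple_rep \<nu> F n Q C"
    and X: "sint F = (\<lambda>\<omega>. \<Sum>j<n. Q j *v M (C j) \<omega>)"
    using simple_integral_rep[OF assms] .
  show ?thesis unfolding X using rep
    by (intro borel_measurable_sum borel_measurable_matrix_vector_mult M_measurable borel_measurable_const)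
       (auto simp: simple_rep_def)
qed

text \<open>The joint level sets of \<open>F\<close> and \<open>F'\<close> represent \<open>F\<close>, \<open>F'\<close> and their difference simultaneously.\<close>

lemma simple_fn_diff:
  assumes "simple_fn \<nu> F" "simple_fn \<nu> F'"
  shows "simple_fn \<nu> (\<lambda>s. F s - F' s)"
    and "AE \<omega> in P. sint (\<lambda>s. F s - F' s) \<omega> = sint F \<omega> - sint F' \<omega>"
proof -
  have sF: "simple_function \<nu> F" "simple_function \<nu> F'"
    and fin: "emeasure \<nu> {s \<in> space \<nu>. F s \<noteq> 0} < \<infinity>" "emeasure \<nu> {s \<in> space \<nu>. F' s \<noteq> 0} < \<infinity>"
    using assms by (auto simp: simple_fn_iff)
  have [measurable]: "F \<in> borel_measurable \<nu>" "F' \<in> borel_measurable \<nu>"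
    using sF by (auto intro: borel_measurable_simple_function)
  have Z: "{s \<in> space \<nu>. F s \<noteq> 0} \<in> fin_sets \<nu>" "{s \<in> space \<nu>. F' s \<noteq> 0} \<in> fin_sets \<nu>"
    using fin by (auto simp: fin_sets_def)
  let ?W = "{s \<in> space \<nu>. F s \<noteq> 0 \<or> F' s \<noteq> 0}"
  have "(\<Union>i\<in>UNIV. if i then {s \<in> space \<nu>. F s \<noteq> 0} else {s \<in> space \<nu>. F' s \<noteq> 0}) \<in> fin_sets \<nu>"
    using Z by (intro fin_sets_UN) auto
  moreover have "(\<Union>i\<in>UNIV. if i then {s \<in> space \<nu>. F s \<noteq> 0} else {s \<in> space \<nu>. F' s \<noteq> 0}) = ?W"
    by (auto simp: UNIV_bool)
  ultimately have W: "?W \<in> fin_sets \<nu>" by simp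
  have sd: "simple_function \<nu> (\<lambda>s. F s - F' s)" by (intro simple_function_diff sF)
  have "{s \<in> space \<nu>. F s - F' s \<noteq> 0} \<in> fin_sets \<nu>" by (rule fin_sets_subset[OF W]) auto
  then show D: "simple_fn \<nu> (\<lambda>s. F s - F' s)" using sd by (simp add: simple_fn_iff fin_sets_def)
  define I where "I = (\<lambda>s. (F s, F' s)) ` space \<nu> - {(0, 0)}"
  define L where "L p = {s \<in> space \<nu>. F s = fst p \<and> F' s = snd p}" for p
  have "finite (F ` space \<nu> \<times> F' ` space \<nu>)" using sF by (simp add: simple_function_def)
  then have I: "finite I" by (rule rev_finite_subset) (auto simp: I_def)
  have L: "L p \<in> fin_sets \<nu>" if "p \<in> I" for p
    by (rule fin_sets_subset[OF W]) (use that in \<open>auto simp: L_def I_def\<close>)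
  have dis: "disjoint_family_on L I" by (auto simp: disjoint_family_on_def L_def prod_eq_iff)
  have expand: "\<phi> (F s) (F' s) = (\<Sum>p\<in>I. indicat_real (L p) s *\<^sub>R \<phi> (fst p) (snd p))"
    if "\<phi> 0 0 = 0" and s: "s \<in> space \<nu>" for \<phi> :: "real^'m^'m \<Rightarrow> real^'m^'m \<Rightarrow> real^'m^'m" and s
  proof (cases "(F s, F' s) \<in> I")
    case True
    then show ?thesis
      using disjoint_sum_indicator_at[OF I dis True, of s "\<lambda>p. \<phi> (fst p) (snd p)"] s by (simp add: L_def)
  next
    case False
    then have z: "F s = 0" "F' s = 0" using s by (auto simp: I_def)
    have "(\<Sum>p\<in>I. indicat_real (L p) s *\<^sub>R \<phi> (fst p) (snd p)) = 0"
      using z by (intro disjoint_sum_indicator_outside) (auto simp: L_def I_def)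
    then show ?thesis using z that by simp
  qed
  have "AE \<omega> in P. sint (\<lambda>s. F s - F' s) \<omega> = (\<Sum>p\<in>I. (fst p - snd p) *v M (L p) \<omega>)"
    by (rule simple_integral_eq_sum[OF D I L dis]) (use expand[of "\<lambda>x y. x - y"] in simp_all)
  moreover have "AE \<omega> in P. sint F \<omega> = (\<Sum>p\<in>I. fst p *v M (L p) \<omega>)"
    by (rule simple_integral_eq_sum[OF assms(1) I L dis]) (use expand[of "\<lambda>x y. x"] in simp_all)
  moreover have "AE \<omega> in P. sint F' \<omega> = (\<Sum>p\<in>I. snd p *v M (L p) \<omega>)"
    by (rule simple_integral_eq_sum[OF assms(2) I L dis]) (use expand[of "\<lambda>x y. y"] in simp_all)
  ultimately show "AE \<omega> in P. sint (\<lambda>s. F s - F' s) \<omega>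
      = sint F \<omega> - sint F' \<omega>"
    by eventually_elim (simp add: matrix_vector_mult_diff_rdistrib sum_subtractf)
qed

text \<open>The negative logarithm of the characteristic function of the integral.\<close>

definition exponent :: "('s \<Rightarrow> real^'m^'m) \<Rightarrow> real^'m \<Rightarrow> ennreal" where
  "exponent F u = (\<integral>\<^sup>+ s. levy_nn \<sigma> (B s) (transpose (F s) *v u) \<partial>\<nu>)"

lemma tau_bounded:
  assumes "s \<in> space \<nu>"
  shows "tau (B s) x \<le> max (norm x powr a) (norm x powr b)"
  using tau_norm_bounds(2)[OF a_gt_0 b_pos B_pinched[OF assms] a_le_b] .

lemma levy_nn_zero: "levy_nn \<sigma> D 0 = 0" by (simp add: levy_nn_def)

text \<open>At a fixed argument the exponents are bounded uniformly in \<open>s\<close>, because the polar radius is; so they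
  are integrable over sets of finite measure.\<close>

lemma set_integral_levy_exponent:
  assumes A: "A \<in> fin_sets \<nu>"
  shows "(\<integral>\<^sup>+ s. indicator A s * levy_nn \<sigma> (B s) w \<partial>\<nu>) < \<infinity>"
    and "(LINT s:A|\<nu>. levy_exponent \<sigma> (B s) w) = - enn2real (\<integral>\<^sup>+ s. indicator A s * levy_nn \<sigma> (B s) w \<partial>\<nu>)"
proof -
  obtain K where K: "K > 0" "\<And>D u. pinched a b D \<Longrightarrow> levy_nn \<sigma> D u \<le> ennreal (K * tau D u)"
    using levy_nn_upper[OF spectral a_gt_0 a_le_b b_less_2] by blast
  define c where "c = K * max (norm w powr a) (norm w powr b)"
  have le: "levy_nn \<sigma> (B s) w \<le> ennreal c" if "s \<in> space \<nu>" for s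
  proof -
    have "levy_nn \<sigma> (B s) w \<le> ennreal (K * tau (B s) w)" by (rule K(2)[OF B_pinched[OF that]])
    also have "\<dots> \<le> ennreal c"
      unfolding c_def using tau_bounded[OF that, of w] K(1) by (intro ennreal_leI mult_left_mono) simp_all
    finally show ?thesis .
  qed
  have [measurable]: "(\<lambda>s. levy_nn \<sigma> (B s) w) \<in> borel_measurable \<nu>"
    by (intro borel_measurable_levy_nn[OF spectral B_measurable]) simp
  have [measurable]: "A \<in> sets \<nu>" using A fin_sets_sets by blast
  have "(\<integral>\<^sup>+ s. indicator A s * levy_nn \<sigma> (B s) w \<partial>\<nu>) \<le> (\<integral>\<^sup>+ s. ennreal c * indicator A s \<partial>\<nu>)"
    using le by (intro nn_integral_mono) (auto simp: indicator_def)
  also have "\<dots> = ennreal c * emeasure \<nu> A" by (rule nn_integral_cmult_indicator) simp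
  also have "\<dots> < \<infinity>" using A by (auto simp: fin_sets_def ennreal_mult_less_top)
  finally show "(\<integral>\<^sup>+ s. indicator A s * levy_nn \<sigma> (B s) w \<partial>\<nu>) < \<infinity>" .
  have "(LINT s:A|\<nu>. levy_exponent \<sigma> (B s) w) = (\<integral>s. - (indicat_real A s * enn2real (levy_nn \<sigma> (B s) w)) \<partial>\<nu>)"
    unfolding set_lebesgue_integral_def by (simp add: levy_exponent_eq[OF spectral])
  also have "\<dots> = - (\<integral>s. indicat_real A s * enn2real (levy_nn \<sigma> (B s) w) \<partial>\<nu>)"
    by (rule Bochner_Integration.integral_minus)
  also have "(\<integral>s. indicat_real A s * enn2real (levy_nn \<sigma> (B s) w) \<partial>\<nu>)
      = enn2real (\<integral>\<^sup>+ s. ennreal (indicat_real A s * enn2real (levy_nn \<sigma> (B s) w)) \<partial>\<nu>)"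
    by (rule integral_eq_nn_integral) simp_all
  also have "(\<integral>\<^sup>+ s. ennreal (indicat_real A s * enn2real (levy_nn \<sigma> (B s) w)) \<partial>\<nu>)
      = (\<integral>\<^sup>+ s. indicator A s * levy_nn \<sigma> (B s) w \<partial>\<nu>)"
  proof (rule nn_integral_cong)
    fix s assume "s \<in> space \<nu>"
    then have "levy_nn \<sigma> (B s) w < \<infinity>" using le[of s] by (auto simp: le_less_trans)
    then show "ennreal (indicat_real A s * enn2real (levy_nn \<sigma> (B s) w)) = indicator A s * levy_nn \<sigma> (B s) w"
      by (cases "s \<in> A") simp_all
  qed
  finally show "(LINT s:A|\<nu>. levy_exponent \<sigma> (B s) w) = - enn2real (\<integral>\<^sup>+ s. indicator A s * levy_nn \<sigma> (B s) w \<partial>\<nu>)" .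
qed

lemma exponent_simple:
  assumes rep: "simple_rep \<nu> F n R A"
  shows "exponent F u = (\<Sum>j<n. \<integral>\<^sup>+ s. indicator (A j) s * levy_nn \<sigma> (B s) (transpose (R j) *v u) \<partial>\<nu>)"
proof -
  have A: "\<And>j. j < n \<Longrightarrow> A j \<in> fin_sets \<nu>" and dis: "disjoint_family_on A {..<n}"
    and F: "\<And>s. s \<in> space \<nu> \<Longrightarrow> F s = (\<Sum>j<n. indicat_real (A j) s *\<^sub>R R j)"
    using rep by (auto simp: simple_rep_def)
  have "exponent F u = (\<integral>\<^sup>+ s. (\<Sum>j<n. indicator (A j) s * levy_nn \<sigma> (B s) (transpose (R j) *v u)) \<partial>\<nu>)"
    unfolding exponent_def
  proof (rule nn_integral_cong)
    fix s assume s: "s \<in> space \<nu>"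
    show "levy_nn \<sigma> (B s) (transpose (F s) *v u)
        = (\<Sum>j<n. indicator (A j) s * levy_nn \<sigma> (B s) (transpose (R j) *v u))"
    proof (cases "\<exists>j<n. s \<in> A j")
      case True
      then obtain j where j: "j < n" "s \<in> A j" by blast
      have "F s = R j" using F[OF s] disjoint_sum_indicator_at[OF _ dis, of j s R] j by simp
      moreover have "(\<Sum>i<n. indicator (A i) s * levy_nn \<sigma> (B s) (transpose (R i) *v u))
          = (\<Sum>i<n. if i = j then levy_nn \<sigma> (B s) (transpose (R j) *v u) else 0)"
      proof (rule sum.cong[OF refl])
        fix i assume "i \<in> {..<n}"
        then show "indicator (A i) s * levy_nn \<sigma> (B s) (transpose (R i) *v u)
            = (if i = j then levy_nn \<sigma> (B s) (transpose (R j) *v u) else 0)"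
          using dis j by (cases "i = j") (auto simp: disjoint_family_on_def indicator_def)
      qed
      ultimately show ?thesis using j by simp
    next
      case False
      then have "F s = 0" using F[OF s] disjoint_sum_indicator_outside[of "{..<n}" s A R] by auto
      moreover have "(\<Sum>j<n. indicator (A j) s * levy_nn \<sigma> (B s) (transpose (R j) *v u)) = 0"
        using False by (intro sum.neutral) auto
      moreover have "transpose (0 :: real^'m^'m) *v u = 0"
        by (simp add: transpose_matrix_vector_sum)
      ultimately show ?thesis by (simp add: levy_nn_zero)
    qed
  qed
  also have "\<dots> = (\<Sum>j<n. \<integral>\<^sup>+ s. indicator (A j) s * levy_nn \<sigma> (B s) (transpose (R j) *v u) \<partial>\<nu>)"
    using A fin_sets_sets
    by (intro nn_integral_sum borel_measurable_times_ennreal borel_measurable_indicator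
        borel_measurable_levy_nn[OF spectral B_measurable] borel_measurable_const) auto
  finally show ?thesis .
qed

text \<open>By independence the characteristic function factorizes over the level sets.  The finite family is
  extended by empty sets to a disjoint sequence.\<close>

lemma simple_integral_char:
  assumes F: "simple_fn \<nu> F"
  shows "exponent F u < \<infinity>"
    and "(\<integral>\<omega>. iexp (u \<bullet> sint F \<omega>) \<partial>P) = complex_of_real (exp (- enn2real (exponent F u)))"
proof -
  obtain n R A where rep: "simple_rep \<nu> F n R A"
    and X: "sint F = (\<lambda>\<omega>. \<Sum>j<n. R j *v M (A j) \<omega>)"
    using simple_integral_rep[OF F] .
  have A: "\<And>j. j < n \<Longrightarrow> A j \<in> fin_sets \<nu>" and dis: "disjoint_family_on A {..<n}"
    using rep by (auto simp: simple_rep_def)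
  define w where "w j = transpose (R j) *v u" for j
  define L where "L j = (\<integral>\<^sup>+ s. indicator (A j) s * levy_nn \<sigma> (B s) (w j) \<partial>\<nu>)" for j
  have L: "L j < \<infinity>" if "j < n" for j unfolding L_def by (rule set_integral_levy_exponent(1)[OF A[OF that]])
  have ex: "exponent F u = (\<Sum>j<n. L j)" using exponent_simple[OF rep] by (simp add: L_def w_def)
  then show "exponent F u < \<infinity>" using L by (simp add: ennreal_sum_less_top)
  define E where "E j = (if j < n then A j else {})" for j
  have "range E \<subseteq> fin_sets \<nu>" using A fin_sets_empty by (auto simp: E_def)
  moreover have "disjoint_family E" using dis by (auto simp: E_def disjoint_family_on_def)
  ultimately have "indep_vars (\<lambda>_. borel) (\<lambda>i. M (E i)) UNIV"
    using isrm unfolding multi_os_isrm_def by blast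
  then have ind: "indep_vars (\<lambda>_. borel) (\<lambda>i. M (E i)) {..<n}" by (rule indep_vars_subset) simp
  have ind': "indep_vars (\<lambda>_. borel) (\<lambda>j \<omega>. iexp (w j \<bullet> M (E j) \<omega>)) {..<n}"
    by (rule indep_vars_compose2[OF ind, where Y = "\<lambda>j x. iexp (w j \<bullet> x)"]) measurable
  have int: "integrable P (\<lambda>\<omega>. iexp (w j \<bullet> M (E j) \<omega>))" if "j < n" for j
  proof (rule integrable_const_bound[where B = 1])
    have [measurable]: "M (E j) \<in> borel_measurable P" using A[OF that] that by (simp add: E_def M_measurable)
    show "(\<lambda>\<omega>. iexp (w j \<bullet> M (E j) \<omega>)) \<in> borel_measurable P" by measurable
  qed (simp add: norm_exp_i_times)
  have "(\<integral>\<omega>. iexp (u \<bullet> sint F \<omega>) \<partial>P) = (\<integral>\<omega>. (\<Prod>j<n. iexp (w j \<bullet> M (E j) \<omega>)) \<partial>P)"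
  proof (rule Bochner_Integration.integral_cong[OF refl])
    fix \<omega>
    have "u \<bullet> sint F \<omega> = (\<Sum>j<n. w j \<bullet> M (E j) \<omega>)"
      unfolding X inner_sum_right
    proof (rule sum.cong[OF refl])
      fix j assume "j \<in> {..<n}"
      then show "u \<bullet> (R j *v M (A j) \<omega>) = w j \<bullet> M (E j) \<omega>"
        using inner_matrix_vector_transpose[of "R j" "M (A j) \<omega>" u] by (simp add: w_def E_def inner_commute)
    qed
    then show "iexp (u \<bullet> sint F \<omega>) = (\<Prod>j<n. iexp (w j \<bullet> M (E j) \<omega>))"
      by (simp add: exp_sum sum_distrib_left)
  qed
  also have "\<dots> = (\<Prod>j<n. \<integral>\<omega>. iexp (w j \<bullet> M (E j) \<omega>) \<partial>P)"
    by (rule indep_vars_lebesgue_integral[OF _ ind' int]) auto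
  also have "\<dots> = (\<Prod>j<n. complex_of_real (exp (- enn2real (L j))))"
  proof (rule prod.cong[OF refl])
    fix j assume "j \<in> {..<n}"
    then have j: "j < n" by simp
    have "(\<integral>\<omega>. iexp (w j \<bullet> M (A j) \<omega>) \<partial>P)
        = complex_of_real (exp (LINT s:A j|\<nu>. levy_exponent \<sigma> (B s) (w j)))"
      using isrm A[OF j] unfolding multi_os_isrm_def by blast
    then show "(\<integral>\<omega>. iexp (w j \<bullet> M (E j) \<omega>) \<partial>P) = complex_of_real (exp (- enn2real (L j)))"
      using j set_integral_levy_exponent(2)[OF A[OF j]] by (simp add: E_def L_def)
  qed
  also have "\<dots> = complex_of_real (exp (\<Sum>j<n. - enn2real (L j)))"
    by (simp add: exp_sum)
  also have "(\<Sum>j<n. - enn2real (L j)) = - enn2real (exponent F u)"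
    unfolding ex using L enn2real_sum[of "{..<n}" L] by (simp add: sum_negf)
  finally show "(\<integral>\<omega>. iexp (u \<bullet> sint F \<omega>) \<partial>P) = complex_of_real (exp (- enn2real (exponent F u)))" .
qed

end

section \<open>Truncation inequalities and convergence in probability\<close>

lemma one_minus_cos_le_abs: "1 - cos y \<le> \<bar>y\<bar>" for y :: real
proof (cases "\<bar>y\<bar> \<le> 2")
  case True
  have "\<bar>y\<bar> * \<bar>y\<bar> \<le> 2 * \<bar>y\<bar>" using True by (intro mult_right_mono) simp_all
  then have "y\<^sup>2 / 2 \<le> \<bar>y\<bar>" by (simp add: power2_eq_square)
  then show ?thesis using one_minus_cos_bounds(1)[of y] by linarith
next
  case False
  then show ?thesis using cos_ge_minus_one[of y] by linarith
qed

text \<open>The integral is \<open>1 - sin y / y\<close>.  Averaging over frequencies avoids the zeros of \<open>1 - cos\<close>.\<close>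

lemma nn_integral_one_minus_cos_ge:
  fixes y :: real
  assumes y: "2 \<le> \<bar>y\<bar>"
  shows "ennreal (1 / 2) \<le> (\<integral>\<^sup>+ t. ennreal (indicat_real {0..1} t * (1 - cos (t * y))) \<partial>lborel)"
proof -
  have y0: "y \<noteq> 0" using y by auto
  have "((\<lambda>t. 1 - cos (t * y)) has_integral (1 - sin (1 * y) / y - (0 - sin (0 * y) / y))) {0..1}"
  proof (rule fundamental_theorem_of_calculus)
    fix t :: real
    show "((\<lambda>t. t - sin (t * y) / y) has_vector_derivative 1 - cos (t * y)) (at t within {0..1})"
      unfolding has_real_derivative_iff_has_vector_derivative[symmetric]
      by (rule derivative_eq_intros refl | use y0 in simp)+
  qed simp
  then have "(\<integral>\<^sup>+ t. ennreal (indicat_real {0..1} t * (1 - cos (t * y))) \<partial>lborel) = ennreal (1 - sin y / y)"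
    using nn_integral_has_integral_lebesgue[of "{0..1}" "\<lambda>t. 1 - cos (t * y)"] by simp
  moreover have "sin y / y \<le> 1 / 2"
  proof -
    have "sin y / y \<le> \<bar>sin y\<bar> / \<bar>y\<bar>" using abs_ge_self[of "sin y / y"] by (simp add: abs_divide)
    also have "\<dots> \<le> 1 / 2" using y by (intro frac_le) simp_all
    finally show ?thesis .
  qed
  then have "1 / 2 \<le> 1 - sin y / y" by simp
  ultimately show ?thesis by (simp only: ennreal_leI)
qed

lemma one_minus_exp_le_imp:
  fixes x \<eta> :: real
  assumes "0 \<le> \<eta>" "\<eta> \<le> 1 / 2" "1 - exp (- x) \<le> \<eta>"
  shows "x \<le> 2 * \<eta>"
proof (rule ccontr)
  assume "\<not> x \<le> 2 * \<eta>"
  then have x: "2 * \<eta> < x" by simp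
  have "1 + 2 * \<eta> \<le> exp (2 * \<eta>)" by (rule exp_ge_add_one_self)
  also have "\<dots> < exp x" using x by simp
  finally have gt: "1 + 2 * \<eta> < exp x" .
  have "1 \<le> (1 - \<eta>) * (1 + 2 * \<eta>)"
  proof -
    have "0 \<le> \<eta> * (1 - 2 * \<eta>)" using assms by (intro mult_nonneg_nonneg) simp_all
    then show ?thesis by (simp add: algebra_simps)
  qed
  also have "\<dots> < (1 - \<eta>) * exp x" using gt assms by (intro mult_strict_left_mono) simp_all
  finally have "exp (- x) < 1 - \<eta>" by (simp add: exp_minus field_simps)
  then show False using assms by simp
qed

context prob_space
begin

abbreviation tail :: "('a \<Rightarrow> 'b::real_normed_vector) \<Rightarrow> real \<Rightarrow> real" where
  "tail X d \<equiv> prob {\<omega> \<in> space M. d \<le> norm (X \<omega>)}"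

lemma prob_norm_triangle:
  fixes X Y :: "'a \<Rightarrow> 'b::{second_countable_topology, real_normed_vector}"
  assumes [measurable]: "X \<in> borel_measurable M" "Y \<in> borel_measurable M"
  shows "tail X \<delta>
    \<le> tail Y (\<delta> / 2) + tail (\<lambda>\<omega>. X \<omega> - Y \<omega>) (\<delta> / 2)"
proof -
  have "tail X \<delta>
      \<le> prob ({\<omega> \<in> space M. \<delta> / 2 \<le> norm (Y \<omega>)} \<union> {\<omega> \<in> space M. \<delta> / 2 \<le> norm (X \<omega> - Y \<omega>)})"
  proof (rule finite_measure_mono)
    show "{\<omega> \<in> space M. \<delta> \<le> norm (X \<omega>)}
      \<subseteq> {\<omega> \<in> space M. \<delta> / 2 \<le> norm (Y \<omega>)} \<union> {\<omega> \<in> space M. \<delta> / 2 \<le> norm (X \<omega> - Y \<omega>)}"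
    proof
      fix \<omega> assume "\<omega> \<in> {\<omega> \<in> space M. \<delta> \<le> norm (X \<omega>)}"
      then show "\<omega> \<in> {\<omega> \<in> space M. \<delta> / 2 \<le> norm (Y \<omega>)} \<union> {\<omega> \<in> space M. \<delta> / 2 \<le> norm (X \<omega> - Y \<omega>)}"
        using norm_triangle_sub[of "X \<omega>" "Y \<omega>"] by (auto simp: not_le)
    qed
  qed measurable
  also have "\<dots> \<le> tail Y (\<delta> / 2) + tail (\<lambda>\<omega>. X \<omega> - Y \<omega>) (\<delta> / 2)"
    by (rule measure_Un_le) measurable
  finally show ?thesis .
qed

lemma prob_norm_cong_AE:
  fixes X Y :: "'a \<Rightarrow> 'b::{second_countable_topology, real_normed_vector}"
  assumes [measurable]: "X \<in> borel_measurable M" "Y \<in> borel_measurable M"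
    and ae: "AE \<omega> in M. X \<omega> = Y \<omega>"
  shows "tail X \<delta> = tail Y \<delta>"
proof (rule measure_eq_AE)
  show "AE \<omega> in M. (\<omega> \<in> {\<omega> \<in> space M. \<delta> \<le> norm (X \<omega>)}) = (\<omega> \<in> {\<omega> \<in> space M. \<delta> \<le> norm (Y \<omega>)})"
    using ae by eventually_elim simp
qed measurable

lemma conv_in_prob_minus:
  fixes X :: "nat \<Rightarrow> 'a \<Rightarrow> 'b::{second_countable_topology, real_normed_vector}"
  assumes [measurable]: "\<And>n. X n \<in> borel_measurable M" "\<And>n. X' n \<in> borel_measurable M"
      "Y \<in> borel_measurable M" "Y' \<in> borel_measurable M"
    and c: "conv_in_prob M X Y" "conv_in_prob M X' Y'"
  shows "conv_in_prob M (\<lambda>n \<omega>. X n \<omega> - X' n \<omega>) (\<lambda>\<omega>. Y \<omega> - Y' \<omega>)"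
  unfolding conv_in_prob_def
proof (intro allI impI)
  fix \<epsilon> :: real assume e: "\<epsilon> > 0"
  let ?p = "\<lambda>n. tail (\<lambda>\<omega>. X n \<omega> - Y \<omega>) (\<epsilon> / 2)"
  let ?q = "\<lambda>n. tail (\<lambda>\<omega>. X' n \<omega> - Y' \<omega>) (\<epsilon> / 2)"
  have lim: "(\<lambda>n. ?q n + ?p n) \<longlonglongrightarrow> 0 + 0"
    by (intro tendsto_add c(1)[unfolded conv_in_prob_def, rule_format] c(2)[unfolded conv_in_prob_def, rule_format])
       (use e in simp_all)
  have le: "tail (\<lambda>\<omega>. X n \<omega> - X' n \<omega> - (Y \<omega> - Y' \<omega>)) \<epsilon> \<le> ?q n + ?p n" for n
  proof -
    have "tail (\<lambda>\<omega>. X n \<omega> - X' n \<omega> - (Y \<omega> - Y' \<omega>)) \<epsilon>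
      \<le> tail (\<lambda>\<omega>. Y' \<omega> - X' n \<omega>) (\<epsilon> / 2)
        + tail (\<lambda>\<omega>. X n \<omega> - X' n \<omega> - (Y \<omega> - Y' \<omega>) - (Y' \<omega> - X' n \<omega>)) (\<epsilon> / 2)"
      by (rule prob_norm_triangle) measurable
    also have "\<dots> = ?q n + ?p n" by (simp add: norm_minus_commute algebra_simps)
    finally show ?thesis .
  qed
  show "(\<lambda>n. tail (\<lambda>\<omega>. X n \<omega> - X' n \<omega> - (Y \<omega> - Y' \<omega>)) \<epsilon>) \<longlonglongrightarrow> 0"
    by (rule tendsto_sandwich[OF _ _ tendsto_const[of 0] lim[simplified]])
      (use le in \<open>simp_all add: always_eventually\<close>)
qed

lemma conv_in_prob_cong_AE:
  fixes X :: "nat \<Rightarrow> 'a \<Rightarrow> 'b::{second_countable_topology, real_normed_vector}"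
  assumes [measurable]: "\<And>n. X n \<in> borel_measurable M" "\<And>n. X' n \<in> borel_measurable M" "Y \<in> borel_measurable M"
    and ae: "\<And>n. AE \<omega> in M. X n \<omega> = X' n \<omega>" and c: "conv_in_prob M X Y"
  shows "conv_in_prob M X' Y"
proof -
  have "tail (\<lambda>\<omega>. X n \<omega> - Y \<omega>) \<epsilon> = tail (\<lambda>\<omega>. X' n \<omega> - Y \<omega>) \<epsilon>" for n \<epsilon>
    by (rule prob_norm_cong_AE) (measurable, use ae[of n] in \<open>auto elim: eventually_mono\<close>)
  then show ?thesis using c unfolding conv_in_prob_def by simp
qed

lemma nn_integral_min_norm_le:
  fixes X :: "'a \<Rightarrow> 'b::{second_countable_topology, real_normed_vector}"
  assumes [measurable]: "X \<in> borel_measurable M" and e: "0 \<le> e"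
  shows "(\<integral>\<^sup>+ \<omega>. ennreal (min 1 (norm (X \<omega>))) \<partial>M) \<le> ennreal (e + tail X e)"
proof -
  let ?A = "{\<omega> \<in> space M. e \<le> norm (X \<omega>)}"
  have "(\<integral>\<^sup>+ \<omega>. ennreal (min 1 (norm (X \<omega>))) \<partial>M) \<le> (\<integral>\<^sup>+ \<omega>. ennreal e + indicator ?A \<omega> \<partial>M)"
  proof (rule nn_integral_mono)
    fix \<omega> assume w: "\<omega> \<in> space M"
    show "ennreal (min 1 (norm (X \<omega>))) \<le> ennreal e + indicator ?A \<omega>"
    proof (cases "\<omega> \<in> ?A")
      case True
      have "ennreal (min 1 (norm (X \<omega>))) \<le> ennreal 1" by (rule ennreal_leI) simp
      also have "\<dots> \<le> ennreal e + 1" by simp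
      finally show ?thesis using True by simp
    next
      case False
      then have "norm (X \<omega>) < e" using w by simp
      then have "ennreal (min 1 (norm (X \<omega>))) \<le> ennreal e" by (intro ennreal_leI) simp
      then show ?thesis using False by simp
    qed
  qed
  also have "\<dots> = ennreal e + emeasure M ?A"
    by (subst nn_integral_add) (simp_all add: emeasure_space_1)
  also have "\<dots> = ennreal (e + prob ?A)" using e by (simp add: emeasure_eq_measure)
  finally show ?thesis .
qed

lemma prob_norm_le_nn_integral_min:
  fixes X :: "'a \<Rightarrow> 'b::{second_countable_topology, real_normed_vector}"
  assumes [measurable]: "X \<in> borel_measurable M" and e: "0 < e" "e \<le> 1"
  shows "ennreal (e * tail X e) \<le> (\<integral>\<^sup>+ \<omega>. ennreal (min 1 (norm (X \<omega>))) \<partial>M)"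
proof -
  let ?A = "{\<omega> \<in> space M. e \<le> norm (X \<omega>)}"
  have "ennreal (e * prob ?A) = (\<integral>\<^sup>+ \<omega>. ennreal e * indicator ?A \<omega> \<partial>M)"
    using e by (subst nn_integral_cmult_indicator) (simp_all add: emeasure_eq_measure ennreal_mult)
  also have "\<dots> \<le> (\<integral>\<^sup>+ \<omega>. ennreal (min 1 (norm (X \<omega>))) \<partial>M)"
    using e by (intro nn_integral_mono) (auto simp: indicator_def intro!: ennreal_leI)
  finally show ?thesis .
qed

text \<open>A fast subsequence converges almost surely by the Borel-Cantelli lemma; the expectation of the
  truncated distance metrizes convergence in probability and, by Fatou's lemma, transfers the Cauchy bound to the
  limit.\<close>

theorem Cauchy_in_prob_convergent:
  fixes X :: "nat \<Rightarrow> 'a \<Rightarrow> 'b::{second_countable_topology, banach}"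
  assumes X[measurable]: "\<And>n. X n \<in> borel_measurable M"
    and cauchy: "\<And>e. e > 0 \<Longrightarrow> \<exists>k. \<forall>m\<ge>k. \<forall>n\<ge>k. tail (\<lambda>\<omega>. X m \<omega> - X n \<omega>) e \<le> e"
  shows "\<exists>Y\<in>borel_measurable M. conv_in_prob M X Y"
proof -
  have "\<exists>k. \<forall>m\<ge>k. \<forall>n\<ge>k. tail (\<lambda>\<omega>. X m \<omega> - X n \<omega>) ((1 / 2) ^ j) \<le> (1 / 2) ^ j" for j :: nat
    by (rule cauchy) simp
  then obtain k where k: "\<And>j m n. m \<ge> k j \<Longrightarrow> n \<ge> k j \<Longrightarrow>
      tail (\<lambda>\<omega>. X m \<omega> - X n \<omega>) ((1 / 2) ^ j) \<le> (1 / 2) ^ j" by metis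
  define r where "r j = j + (\<Sum>i\<le>j. k i)" for j
  have r: "r j \<ge> k j" "r (Suc j) \<ge> k j" "r j \<ge> j" for j
    using member_le_sum[of j "{..j}" k] by (auto simp: r_def)
  let ?A = "\<lambda>j. {\<omega> \<in> space M. (1 / 2) ^ j \<le> norm (X (r (Suc j)) \<omega> - X (r j) \<omega>)}"
  have "AE \<omega> in M. \<forall>\<^sub>F j in sequentially. \<omega> \<in> space M - ?A j"
  proof (rule borel_cantelli_AE1)
    show "summable (\<lambda>j. prob (?A j))"
    proof (rule summable_comparison_test)
      show "\<exists>N. \<forall>j\<ge>N. norm (prob (?A j)) \<le> (1 / 2) ^ j" using k[OF r(2) r(1)] by auto
    qed (simp add: summable_geometric)
  qed (simp_all add: emeasure_eq_measure)
  then have ae: "AE \<omega> in M. convergent (\<lambda>j. X (r j) \<omega>)"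
  proof (rule AE_mp, intro AE_I2 impI)
    fix \<omega> assume w: "\<omega> \<in> space M" and ev0: "\<forall>\<^sub>F j in sequentially. \<omega> \<in> space M - ?A j"
    from ev0 have ev: "\<forall>\<^sub>F j in sequentially. norm (X (r (Suc j)) \<omega> - X (r j) \<omega>) \<le> (1 / 2) ^ j"
      by (rule eventually_mono) (use w in auto)
    have "summable (\<lambda>j. X (r (Suc j)) \<omega> - X (r j) \<omega>)"
      by (rule summable_comparison_test_ev[OF ev]) (simp add: summable_geometric)
    then have "convergent (\<lambda>n. \<Sum>j<n. X (r (Suc j)) \<omega> - X (r j) \<omega>)" by (simp add: summable_iff_convergent)
    then have "convergent (\<lambda>n. X (r n) \<omega> - X (r 0) \<omega>)"
      by (simp add: sum_lessThan_telescope[where f = "\<lambda>j. X (r j) \<omega>"])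
    then have "convergent (\<lambda>n. X (r n) \<omega> - X (r 0) \<omega> + X (r 0) \<omega>)"
      by (rule convergent_add[OF _ convergent_const])
    then show "convergent (\<lambda>j. X (r j) \<omega>)" by simp
  qed
  define Y where "Y \<omega> = lim (\<lambda>j. X (r j) \<omega>)" for \<omega>
  have Y[measurable]: "Y \<in> borel_measurable M" unfolding Y_def by measurable
  have lim: "AE \<omega> in M. (\<lambda>j. X (r j) \<omega>) \<longlonglongrightarrow> Y \<omega>"
    using ae by (rule AE_mp) (simp add: Y_def convergent_LIMSEQ_iff)
  have bound: "\<exists>k. \<forall>n\<ge>k. (\<integral>\<^sup>+ \<omega>. ennreal (min 1 (norm (X n \<omega> - Y \<omega>))) \<partial>M) \<le> ennreal (2 * e)" if e: "e > 0" for e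
  proof -
    obtain k where k: "\<And>m n. m \<ge> k \<Longrightarrow> n \<ge> k \<Longrightarrow> tail (\<lambda>\<omega>. X m \<omega> - X n \<omega>) e \<le> e"
      using cauchy[OF e] by blast
    have "(\<integral>\<^sup>+ \<omega>. ennreal (min 1 (norm (X n \<omega> - Y \<omega>))) \<partial>M) \<le> ennreal (2 * e)" if n: "n \<ge> k" for n
    proof -
      have "(\<integral>\<^sup>+ \<omega>. ennreal (min 1 (norm (X n \<omega> - Y \<omega>))) \<partial>M)
          = (\<integral>\<^sup>+ \<omega>. liminf (\<lambda>j. ennreal (min 1 (norm (X n \<omega> - X (r j) \<omega>)))) \<partial>M)"
      proof (rule nn_integral_cong_AE, use lim in \<open>rule AE_mp\<close>, intro AE_I2 impI)
        fix \<omega> assume "(\<lambda>j. X (r j) \<omega>) \<longlonglongrightarrow> Y \<omega>"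
        then have "(\<lambda>j. ennreal (min 1 (norm (X n \<omega> - X (r j) \<omega>)))) \<longlonglongrightarrow> ennreal (min 1 (norm (X n \<omega> - Y \<omega>)))"
          by (intro tendsto_ennrealI tendsto_min tendsto_norm tendsto_diff tendsto_const)
        then show "ennreal (min 1 (norm (X n \<omega> - Y \<omega>))) = liminf (\<lambda>j. ennreal (min 1 (norm (X n \<omega> - X (r j) \<omega>))))"
          by (rule lim_imp_Liminf[symmetric, rotated]) simp
      qed
      also have "\<dots> \<le> liminf (\<lambda>j. \<integral>\<^sup>+ \<omega>. ennreal (min 1 (norm (X n \<omega> - X (r j) \<omega>))) \<partial>M)"
        by (rule nn_integral_liminf) measurable
      also have "\<dots> \<le> limsup (\<lambda>j. \<integral>\<^sup>+ \<omega>. ennreal (min 1 (norm (X n \<omega> - X (r j) \<omega>))) \<partial>M)"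
        by (rule Liminf_le_Limsup) simp
      also have "\<dots> \<le> ennreal (2 * e)"
      proof (rule Limsup_bounded)
        show "\<forall>\<^sub>F j in sequentially. (\<integral>\<^sup>+ \<omega>. ennreal (min 1 (norm (X n \<omega> - X (r j) \<omega>))) \<partial>M) \<le> ennreal (2 * e)"
          using eventually_ge_at_top[of k]
        proof eventually_elim
          case (elim j)
          then have "r j \<ge> k" using r(3)[of j] by simp
          have "(\<integral>\<^sup>+ \<omega>. ennreal (min 1 (norm (X n \<omega> - X (r j) \<omega>))) \<partial>M)
              \<le> ennreal (e + tail (\<lambda>\<omega>. X n \<omega> - X (r j) \<omega>) e)"
            using e by (intro nn_integral_min_norm_le) simp_all
          also have "\<dots> \<le> ennreal (2 * e)" using k[OF n \<open>r j \<ge> k\<close>] by (intro ennreal_leI) simp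
          finally show ?case .
        qed
      qed
      finally show ?thesis .
    qed
    then show ?thesis by blast
  qed
  have "conv_in_prob M X Y"
    unfolding conv_in_prob_def
  proof (intro allI impI, rule LIMSEQ_I)
    fix \<epsilon> d :: real assume e: "\<epsilon> > 0" and d: "d > 0"
    define c where "c = min 1 \<epsilon>"
    have c: "0 < c" "c \<le> 1" "c \<le> \<epsilon>" using e by (auto simp: c_def)
    obtain k where k: "\<And>n. n \<ge> k \<Longrightarrow> (\<integral>\<^sup>+ \<omega>. ennreal (min 1 (norm (X n \<omega> - Y \<omega>))) \<partial>M) \<le> ennreal (2 * (c * d / 4))"
      using bound[of "c * d / 4"] c d by auto
    have "norm (tail (\<lambda>\<omega>. X n \<omega> - Y \<omega>) \<epsilon> - 0) < d" if n: "n \<ge> k" for n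
    proof -
      have "tail (\<lambda>\<omega>. X n \<omega> - Y \<omega>) \<epsilon> \<le> tail (\<lambda>\<omega>. X n \<omega> - Y \<omega>) c"
        using c by (intro finite_measure_mono) auto
      moreover have "ennreal (c * tail (\<lambda>\<omega>. X n \<omega> - Y \<omega>) c)
          \<le> (\<integral>\<^sup>+ \<omega>. ennreal (min 1 (norm (X n \<omega> - Y \<omega>))) \<partial>M)"
        using c by (intro prob_norm_le_nn_integral_min) simp_all
      from order_trans[OF this k[OF n]]
      have "c * tail (\<lambda>\<omega>. X n \<omega> - Y \<omega>) c \<le> c * (d / 2)"
        using c d by simp
      then have "tail (\<lambda>\<omega>. X n \<omega> - Y \<omega>) c \<le> d / 2" using c by simp
      ultimately show ?thesis using d by simp
    qed
    then show "\<exists>no. \<forall>n\<ge>no. norm (tail (\<lambda>\<omega>. X n \<omega> - Y \<omega>) \<epsilon> - 0) < d" by blast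
  qed
  then show ?thesis using Y by blast
qed

end

section \<open>The integral and the modular\<close>

context os_isrm
begin

lemma exponent_upper:
  "\<exists>K>0. \<forall>f\<in>borel_measurable \<nu>. \<forall>l>0. \<forall>u. infnorm u \<le> 1 / l \<longrightarrow> exponent f u \<le> ennreal K * H f l"
proof -
  obtain K where K: "K > 0" "\<And>D u. pinched a b D \<Longrightarrow> levy_nn \<sigma> D u \<le> ennreal (K * tau D u)"
    using levy_nn_upper[OF spectral a_gt_0 a_le_b b_less_2] by blast
  have "exponent f u \<le> ennreal K * H f l"
    if f: "f \<in> borel_measurable \<nu>" and l: "l > 0" and u: "infnorm u \<le> 1 / l" for f l u
  proof -
    have lu: "infnorm (l *\<^sub>R u) \<le> 1" using u l by (simp add: infnorm_mul field_simps)
    have "exponent f u \<le> (\<integral>\<^sup>+ s. ennreal K * box_gauge (B s) ((1 / l) *\<^sub>R f s) \<partial>\<nu>)"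
      unfolding exponent_def
    proof (rule nn_integral_mono)
      fix s assume s: "s \<in> space \<nu>"
      have w: "transpose (f s) *v u = transpose ((1 / l) *\<^sub>R f s) *v (l *\<^sub>R u)"
        using l by (simp add: transpose_scaleR scaleR_matrix_vector_mult matrix_vector_mult_scaleR)
      have "levy_nn \<sigma> (B s) (transpose (f s) *v u) \<le> ennreal (K * tau (B s) (transpose (f s) *v u))"
        by (rule K(2)[OF B_pinched[OF s]])
      also have "\<dots> = ennreal K * ennreal (tau (B s) (transpose (f s) *v u))"
        using K(1) tau_nonneg[OF a_gt_0 b_pos B_pinched[OF s]] by (intro ennreal_mult) simp_all
      also have "\<dots> \<le> ennreal K * box_gauge (B s) ((1 / l) *\<^sub>R f s)"
        unfolding w by (intro mult_left_mono tau_le_box_gauge lu) simp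
      finally show "levy_nn \<sigma> (B s) (transpose (f s) *v u) \<le> ennreal K * box_gauge (B s) ((1 / l) *\<^sub>R f s)" .
    qed
    also have "\<dots> = ennreal K * H f l"
      unfolding H_def by (rule nn_integral_cmult[OF H_measurable_integrand[OF f]])
    finally show ?thesis .
  qed
  then show ?thesis using K(1) by blast
qed

lemma exponent_lower:
  "\<exists>K>0. \<forall>f\<in>borel_measurable \<nu>. \<forall>l>0. H f l \<le> ennreal K * (\<Sum>i\<in>UNIV. exponent f ((1 / l) *\<^sub>R axis i 1))"
proof -
  obtain K where K: "K > 0" "\<And>D u. pinched a b D \<Longrightarrow> ennreal (K * tau D u) \<le> levy_nn \<sigma> D u"
    using levy_nn_lower[OF spectral a_gt_0 a_le_b] by blast
  define c where "c = real CARD('m) powr b / K"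
  have c: "c > 0" using K by (simp add: c_def)
  have "H f l \<le> ennreal c * (\<Sum>i\<in>UNIV. exponent f ((1 / l) *\<^sub>R axis i 1))"
    if f: "f \<in> borel_measurable \<nu>" and l: "l > 0" for f l
  proof -
    let ?w = "\<lambda>i s. transpose (f s) *v ((1 / l) *\<^sub>R axis i 1)"
    have wm: "?w i \<in> borel_measurable \<nu>" for i
      using borel_measurable_matrix_vector_mult[OF borel_measurable_transpose[OF f] borel_measurable_const] .
    have lm: "(\<lambda>s. levy_nn \<sigma> (B s) (?w i s)) \<in> borel_measurable \<nu>" for i
      by (rule borel_measurable_levy_nn[OF spectral B_measurable wm])
    have "H f l \<le> (\<integral>\<^sup>+ s. ennreal c * (\<Sum>i\<in>UNIV. levy_nn \<sigma> (B s) (?w i s)) \<partial>\<nu>)"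
      unfolding H_def
    proof (rule nn_integral_mono)
      fix s assume s: "s \<in> space \<nu>"
      have w: "transpose ((1 / l) *\<^sub>R f s) *v axis i 1 = ?w i s" for i
        by (simp add: transpose_scaleR scaleR_matrix_vector_mult matrix_vector_mult_scaleR)
      have 1: "ennreal (tau (B s) (?w i s)) \<le> ennreal (1 / K) * levy_nn \<sigma> (B s) (?w i s)" for i
      proof -
        have "ennreal (tau (B s) (?w i s)) = ennreal (1 / K) * ennreal (K * tau (B s) (?w i s))"
          using K(1) tau_nonneg[OF a_gt_0 b_pos B_pinched[OF s]] by (subst ennreal_mult[symmetric]) simp_all
        also have "\<dots> \<le> ennreal (1 / K) * levy_nn \<sigma> (B s) (?w i s)"
          by (intro mult_left_mono K(2)[OF B_pinched[OF s]]) simp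
        finally show ?thesis .
      qed
      have "box_gauge (B s) ((1 / l) *\<^sub>R f s)
          \<le> ennreal (real CARD('m) powr b) * (\<Sum>i\<in>UNIV. ennreal (tau (B s) (?w i s)))"
        using box_gauge_le_sum_axes[OF a_gt_0 a_le_b B_pinched[OF s], of "(1 / l) *\<^sub>R f s"] unfolding w .
      also have "\<dots> \<le> ennreal (real CARD('m) powr b) * (\<Sum>i\<in>UNIV. ennreal (1 / K) * levy_nn \<sigma> (B s) (?w i s))"
        by (intro mult_left_mono sum_mono 1) simp
      also have "\<dots> = (ennreal (real CARD('m) powr b) * ennreal (1 / K)) * (\<Sum>i\<in>UNIV. levy_nn \<sigma> (B s) (?w i s))"
        by (simp only: sum_distrib_left[symmetric] mult.assoc)
      also have "ennreal (real CARD('m) powr b) * ennreal (1 / K) = ennreal c"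
        unfolding c_def using K(1) by (subst ennreal_mult[symmetric]) simp_all
      finally show "box_gauge (B s) ((1 / l) *\<^sub>R f s) \<le> ennreal c * (\<Sum>i\<in>UNIV. levy_nn \<sigma> (B s) (?w i s))" .
    qed
    also have "\<dots> = ennreal c * (\<Sum>i\<in>UNIV. exponent f ((1 / l) *\<^sub>R axis i 1))"
      unfolding exponent_def using lm by (subst nn_integral_cmult) (simp_all add: nn_integral_sum)
    finally show ?thesis .
  qed
  then show ?thesis using c by blast
qed

lemma simple_fn_borel: "simple_fn \<nu> F \<Longrightarrow> F \<in> borel_measurable \<nu>"
  using borel_measurable_simple_function by (auto simp: simple_fn_iff)

lemma simple_fn_in_V:
  assumes F: "simple_fn \<nu> F"
  shows "F \<in> V"
proof -
  obtain K where K: "K > 0"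
    "\<And>f l. f \<in> borel_measurable \<nu> \<Longrightarrow> l > 0 \<Longrightarrow> H f l \<le> ennreal K * (\<Sum>i\<in>UNIV. exponent f ((1 / l) *\<^sub>R axis i 1))"
    using exponent_lower by blast
  have "H F 1 \<le> ennreal K * (\<Sum>i\<in>UNIV. exponent F ((1 / 1) *\<^sub>R axis i 1))"
    by (rule K(2)[OF simple_fn_borel[OF F]]) simp
  also have "\<dots> < \<infinity>"
    using simple_integral_char(1)[OF F] by (simp add: ennreal_mult_less_top ennreal_sum_less_top)
  finally show ?thesis using simple_fn_borel[OF F] by (auto simp: V_def intro!: exI[of _ 1])
qed

lemma simple_integral_cos:
  assumes F: "simple_fn \<nu> F"
  shows "(\<integral>\<^sup>+ \<omega>. ennreal (1 - cos (u \<bullet> sint F \<omega>)) \<partial>P)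
    = ennreal (1 - exp (- enn2real (exponent F u)))"
proof -
  let ?X = "sint F"
  have X[measurable]: "?X \<in> borel_measurable P" by (rule simple_integral_measurable[OF F])
  have int: "integrable P (\<lambda>\<omega>. iexp (u \<bullet> ?X \<omega>))"
    by (rule integrable_const_bound[where B = 1]) (simp_all add: norm_exp_i_times)
  have "(\<integral>\<omega>. cos (u \<bullet> ?X \<omega>) \<partial>P) = (\<integral>\<omega>. Re (iexp (u \<bullet> ?X \<omega>)) \<partial>P)"
    by (intro Bochner_Integration.integral_cong refl) (simp add: Re_exp)
  also have "\<dots> = Re (\<integral>\<omega>. iexp (u \<bullet> ?X \<omega>) \<partial>P)" by (rule integral_Re[OF int])
  also have "\<dots> = exp (- enn2real (exponent F u))" unfolding simple_integral_char(2)[OF F] by simp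
  finally have E: "(\<integral>\<omega>. cos (u \<bullet> ?X \<omega>) \<partial>P) = exp (- enn2real (exponent F u))" .
  have intc: "integrable P (\<lambda>\<omega>. cos (u \<bullet> ?X \<omega>))"
    by (rule integrable_const_bound[where B = 1]) simp_all
  have "(\<integral>\<^sup>+ \<omega>. ennreal (1 - cos (u \<bullet> ?X \<omega>)) \<partial>P) = ennreal (\<integral>\<omega>. 1 - cos (u \<bullet> ?X \<omega>) \<partial>P)"
    using intc by (intro nn_integral_eq_integral) simp_all
  also have "(\<integral>\<omega>. 1 - cos (u \<bullet> ?X \<omega>) \<partial>P) = 1 - exp (- enn2real (exponent F u))"
    using intc E by (simp add: prob_space)
  finally show ?thesis .
qed

text \<open>Markov's inequality for the average of \<open>1 - cos (t c X\<^sub>i)\<close> over \<open>t\<close> in \<open>[0, 1]\<close>, coordinate by coordinate: its mean is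
  at most the average of the exponents, hence a multiple of the modular.\<close>

lemma simple_integral_tail:
  "\<exists>L\<ge>1. \<forall>F. simple_fn \<nu> F \<longrightarrow> (\<forall>\<delta>>0.
    ennreal (tail (sint F) \<delta>) \<le> ennreal L * H F \<delta>)"
proof -
  obtain K where K: "K > 0"
    "\<And>f l u. f \<in> borel_measurable \<nu> \<Longrightarrow> l > 0 \<Longrightarrow> infnorm u \<le> 1 / l \<Longrightarrow> exponent f u \<le> ennreal K * H f l"
    using exponent_upper by blast
  interpret PL: pair_sigma_finite P "lborel :: real measure" by unfold_locales
  define m where "m = real CARD('m)"
  have m: "m \<ge> 1" by (simp add: m_def Suc_leI)
  define L where "L = max 1 (2 * m * K * (2 * m) powr b)"
  have "ennreal (tail (sint F) \<delta>) \<le> ennreal L * H F \<delta>"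
    if F: "simple_fn \<nu> F" and \<delta>: "\<delta> > 0" for F \<delta>
  proof -
    let ?X = "sint F"
    have X[measurable]: "?X \<in> borel_measurable P" by (rule simple_integral_measurable[OF F])
    \<comment> \<open>if the norm is at least \<open>\<delta>\<close>, \<open>c\<close> times some coordinate has absolute value at least 2\<close>
    define c where "c = 2 * m / \<delta>"
    have c: "c > 0" using m \<delta> by (simp add: c_def)
    have Fm: "F \<in> borel_measurable \<nu>" by (rule simple_fn_borel[OF F])
    let ?A = "\<lambda>i. {\<omega> \<in> space P. 2 \<le> \<bar>c * (?X \<omega> \<bullet> axis i 1)\<bar>}"
    have coord: "ennreal (prob (?A i)) \<le> ennreal (2 * K) * H F (\<delta> / (2 * m))" for i
    proof -
      let ?y = "\<lambda>\<omega>. c * (?X \<omega> \<bullet> axis i 1)"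
      have mean: "(\<integral>\<^sup>+ \<omega>. ennreal (1 - cos (t * ?y \<omega>)) \<partial>P) \<le> ennreal K * H F (1 / c)" if t: "0 \<le> t" "t \<le> 1" for t
      proof -
        let ?u = "(t * c) *\<^sub>R axis i 1 :: real^'m"
        have "infnorm ?u = t * c * infnorm (axis i 1 :: real^'m)" using t c by (simp add: infnorm_mul)
        also have "\<dots> \<le> 1 * c * 1" using t c infnorm_axis_le[of i] by (intro mult_mono) (simp_all add: infnorm_pos_le)
        finally have "infnorm ?u \<le> 1 / (1 / c)" by simp
        then have ex: "exponent F ?u \<le> ennreal K * H F (1 / c)" using c by (intro K(2)[OF Fm]) simp_all
        have "(\<integral>\<^sup>+ \<omega>. ennreal (1 - cos (t * ?y \<omega>)) \<partial>P) = (\<integral>\<^sup>+ \<omega>. ennreal (1 - cos (?u \<bullet> ?X \<omega>)) \<partial>P)"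
          by (intro nn_integral_cong) (simp add: inner_commute mult.assoc)
        also have "\<dots> = ennreal (1 - exp (- enn2real (exponent F ?u)))" by (rule simple_integral_cos[OF F])
        also have "\<dots> \<le> ennreal (enn2real (exponent F ?u))"
          using exp_ge_add_one_self[of "- enn2real (exponent F ?u)"] by (intro ennreal_leI) linarith
        also have "\<dots> = exponent F ?u" using simple_integral_char(1)[OF F, of ?u] by simp
        finally show ?thesis using ex by simp
      qed
      have meas: "(\<lambda>(\<omega>, t). ennreal (indicat_real {0..1} t * (1 - cos (t * ?y \<omega>)))) \<in> borel_measurable (P \<Otimes>\<^sub>M lborel)"
        by measurable
      have "ennreal (prob (?A i) * (1 / 2)) = ennreal (1 / 2) * ennreal (prob (?A i))"
        by (subst ennreal_mult[symmetric]) (simp_all add: mult.commute)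
      also have "\<dots> = (\<integral>\<^sup>+ \<omega>. ennreal (1 / 2) * indicator (?A i) \<omega> \<partial>P)"
        by (subst nn_integral_cmult_indicator) (simp_all add: emeasure_eq_measure)
      also have "\<dots> \<le> (\<integral>\<^sup>+ \<omega>. (\<integral>\<^sup>+ t. ennreal (indicat_real {0..1} t * (1 - cos (t * ?y \<omega>))) \<partial>lborel) \<partial>P)"
      proof (rule nn_integral_mono)
        fix \<omega>
        show "ennreal (1 / 2) * indicator (?A i) \<omega>
            \<le> (\<integral>\<^sup>+ t. ennreal (indicat_real {0..1} t * (1 - cos (t * ?y \<omega>))) \<partial>lborel)"
        proof (cases "\<omega> \<in> ?A i")
          case True
          then have "2 \<le> \<bar>?y \<omega>\<bar>" by simp
          from nn_integral_one_minus_cos_ge[OF this] show ?thesis using True by simp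
        qed simp
      qed
      also have "\<dots> = (\<integral>\<^sup>+ t. (\<integral>\<^sup>+ \<omega>. ennreal (indicat_real {0..1} t * (1 - cos (t * ?y \<omega>))) \<partial>P) \<partial>lborel)"
        by (rule PL.Fubini'[OF meas, symmetric])
      also have "\<dots> \<le> (\<integral>\<^sup>+ t. ennreal K * H F (1 / c) * indicator {0..1 :: real} t \<partial>lborel)"
      proof (rule nn_integral_mono)
        fix t :: real
        show "(\<integral>\<^sup>+ \<omega>. ennreal (indicat_real {0..1} t * (1 - cos (t * ?y \<omega>))) \<partial>P)
            \<le> ennreal K * H F (1 / c) * indicator {0..1} t"
          using mean[of t] by (cases "t \<in> {0..1}") simp_all
      qed
      also have "\<dots> = ennreal K * H F (1 / c)" by (subst nn_integral_cmult_indicator) simp_all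
      finally have half: "ennreal (prob (?A i) * (1 / 2)) \<le> ennreal K * H F (1 / c)" .
      have "ennreal (prob (?A i)) = ennreal 2 * ennreal (prob (?A i) * (1 / 2))"
        by (subst ennreal_mult[symmetric]) simp_all
      also have "\<dots> \<le> ennreal 2 * (ennreal K * H F (1 / c))" by (rule mult_left_mono[OF half]) simp
      also have "\<dots> = ennreal (2 * K) * H F (\<delta> / (2 * m))"
        using K(1) by (simp add: ennreal_mult mult.assoc c_def)
      finally show ?thesis .
    qed
    have sub: "{\<omega> \<in> space P. \<delta> \<le> norm (?X \<omega>)} \<subseteq> (\<Union>i\<in>UNIV. ?A i)"
    proof
      fix \<omega> assume w: "\<omega> \<in> {\<omega> \<in> space P. \<delta> \<le> norm (?X \<omega>)}"
      have "\<exists>i. \<delta> / m \<le> \<bar>?X \<omega> $ i\<bar>"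
      proof (rule ccontr)
        assume "\<not> (\<exists>i. \<delta> / m \<le> \<bar>?X \<omega> $ i\<bar>)"
        then have lt: "\<bar>?X \<omega> $ i\<bar> < \<delta> / m" for i by (simp add: not_le)
        have "norm (?X \<omega>) \<le> (\<Sum>i\<in>UNIV. \<bar>?X \<omega> $ i\<bar>)" by (rule norm_le_l1_cart)
        also have "\<dots> < (\<Sum>i\<in>(UNIV :: 'm set). \<delta> / m)" using lt by (intro sum_strict_mono) simp_all
        also have "\<dots> = \<delta>" using m by (simp add: m_def)
        finally show False using w by simp
      qed
      then obtain i where i: "\<delta> / m \<le> \<bar>?X \<omega> $ i\<bar>" by blast
      have "2 = c * (\<delta> / m)" using m \<delta> by (simp add: c_def)
      also have "\<dots> \<le> c * \<bar>?X \<omega> $ i\<bar>" using i c by (intro mult_left_mono) simp_all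
      also have "\<dots> = \<bar>c * (?X \<omega> \<bullet> axis i 1)\<bar>" using c by (simp add: abs_mult inner_axis)
      finally show "\<omega> \<in> (\<Union>i\<in>UNIV. ?A i)" using w by blast
    qed
    have Am: "?A i \<in> sets P" for i by measurable
    have "ennreal (tail ?X \<delta>) \<le> emeasure P (\<Union>i\<in>UNIV. ?A i)"
      unfolding emeasure_eq_measure[symmetric] using sub Am by (intro emeasure_mono) auto
    also have "\<dots> \<le> (\<Sum>i\<in>UNIV. emeasure P (?A i))"
      using Am by (intro emeasure_subadditive_finite) auto
    also have "\<dots> \<le> (\<Sum>i\<in>(UNIV :: 'm set). ennreal (2 * K) * H F (\<delta> / (2 * m)))"
      by (intro sum_mono) (use coord in \<open>simp add: emeasure_eq_measure\<close>)
    also have "\<dots> = ennreal m * (ennreal (2 * K) * H F (\<delta> / (2 * m)))"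
      by (simp add: m_def ennreal_of_nat_eq_real_of_nat)
    also have "\<dots> \<le> ennreal m * (ennreal (2 * K) * (ennreal ((2 * m) powr b) * H F \<delta>))"
    proof (intro mult_left_mono)
      have "H F (\<delta> / (2 * m)) \<le> ennreal ((\<delta> / (\<delta> / (2 * m))) powr b) * H F \<delta>"
        using m \<delta> by (intro H_scale_le[OF Fm]) (simp_all add: field_simps)
      moreover have "\<delta> / (\<delta> / (2 * m)) = 2 * m" using m \<delta> by simp
      ultimately show "H F (\<delta> / (2 * m)) \<le> ennreal ((2 * m) powr b) * H F \<delta>" by (simp only:)
    qed simp_all
    also have "\<dots> = ennreal (m * (2 * K * (2 * m) powr b)) * H F \<delta>"
      using m K(1) by (simp add: ennreal_mult mult.assoc)
    also have "\<dots> \<le> ennreal L * H F \<delta>"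
      by (intro mult_right_mono ennreal_leI) (simp_all add: L_def mult_ac)
    finally show ?thesis .
  qed
  moreover have "L \<ge> 1" by (simp add: L_def)
  ultimately show ?thesis by blast
qed

text \<open>If \<open>I(F)\<close> is small in probability, its characteristic function is close to 1 at the points
  \<open>e\<^sub>i / l\<close>, so the exponents there are small, and they dominate the modular.\<close>

lemma simple_integral_small_imp_N_small:
  assumes e: "e > 0"
  shows "\<exists>\<delta>>0. \<forall>F. simple_fn \<nu> F \<longrightarrow>
    tail (sint F) \<delta> \<le> \<delta> \<longrightarrow> N F < e"
proof -
  obtain K where K: "K > 0"
    "\<And>f l. f \<in> borel_measurable \<nu> \<Longrightarrow> l > 0 \<Longrightarrow> H f l \<le> ennreal K * (\<Sum>i\<in>UNIV. exponent f ((1 / l) *\<^sub>R axis i 1))"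
    using exponent_lower by blast
  define l where "l = e / 2"
  have l: "l > 0" "l < e" using e by (auto simp: l_def)
  define m where "m = real CARD('m)"
  have m: "m \<ge> 1" by (simp add: m_def Suc_leI)
  \<comment> \<open>then \<open>m\<close> exponents of size \<open>2\<eta>\<close>, multiplied by \<open>K\<close>, sum to at most 1\<close>
  define \<eta> where "\<eta> = min (1 / 2) (1 / (2 * m * K))"
  have \<eta>: "0 < \<eta>" "\<eta> \<le> 1 / 2" "K * m * (2 * \<eta>) \<le> 1"
  proof -
    show "0 < \<eta>" "\<eta> \<le> 1 / 2" using m K by (auto simp: \<eta>_def)
    have "\<eta> \<le> 1 / (2 * m * K)" by (simp add: \<eta>_def)
    then show "K * m * (2 * \<eta>) \<le> 1" using m K(1) by (simp add: field_simps)
  qed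
  define \<delta> where "\<delta> = \<eta> / (1 / l + 2)"
  have den: "1 / l + 2 > 0" using l by (simp add: add_pos_pos)
  have \<delta>: "\<delta> > 0" "\<delta> / l + 2 * \<delta> = \<eta>"
  proof -
    show "\<delta> > 0" using \<eta> den by (simp add: \<delta>_def)
    have "\<delta> / l + 2 * \<delta> = \<delta> * (1 / l + 2)" by (simp add: algebra_simps)
    also have "\<dots> = \<eta>" using den by (simp add: \<delta>_def)
    finally show "\<delta> / l + 2 * \<delta> = \<eta>" .
  qed
  have "N F < e" if F: "simple_fn \<nu> F"
    and small: "tail (sint F) \<delta> \<le> \<delta>" for F
  proof -
    let ?X = "sint F"
    have X[measurable]: "?X \<in> borel_measurable P" by (rule simple_integral_measurable[OF F])
    let ?A = "{\<omega> \<in> space P. \<delta> \<le> norm (?X \<omega>)}"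
    have ex: "exponent F ((1 / l) *\<^sub>R axis i 1) \<le> ennreal (2 * \<eta>)" for i
    proof -
      let ?u = "(1 / l) *\<^sub>R axis i 1 :: real^'m"
      have "ennreal (1 - exp (- enn2real (exponent F ?u))) = (\<integral>\<^sup>+ \<omega>. ennreal (1 - cos (?u \<bullet> ?X \<omega>)) \<partial>P)"
        by (rule simple_integral_cos[OF F, symmetric])
      also have "\<dots> \<le> (\<integral>\<^sup>+ \<omega>. ennreal (\<delta> / l) + ennreal 2 * indicator ?A \<omega> \<partial>P)"
      proof (rule nn_integral_mono)
        fix \<omega> assume w: "\<omega> \<in> space P"
        show "ennreal (1 - cos (?u \<bullet> ?X \<omega>)) \<le> ennreal (\<delta> / l) + ennreal 2 * indicator ?A \<omega>"
        proof (cases "\<omega> \<in> ?A")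
          case True
          have "ennreal (1 - cos (?u \<bullet> ?X \<omega>)) \<le> ennreal 2"
            using cos_ge_minus_one[of "?u \<bullet> ?X \<omega>"] by (intro ennreal_leI) linarith
          also have "\<dots> \<le> ennreal (\<delta> / l) + ennreal 2" by simp
          finally show ?thesis using True by simp
        next
          case False
          have "\<bar>?u \<bullet> ?X \<omega>\<bar> = \<bar>?X \<omega> $ i\<bar> / l" using l by (simp add: inner_axis' abs_mult)
          also have "\<dots> \<le> norm (?X \<omega>) / l" using l component_le_norm_cart[of "?X \<omega>" i] by (intro divide_right_mono) simp_all
          also have "\<dots> \<le> \<delta> / l" using False w l by (intro divide_right_mono) simp_all
          finally have "1 - cos (?u \<bullet> ?X \<omega>) \<le> \<delta> / l" using one_minus_cos_le_abs[of "?u \<bullet> ?X \<omega>"] by linarith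
          then have "ennreal (1 - cos (?u \<bullet> ?X \<omega>)) \<le> ennreal (\<delta> / l)" by (rule ennreal_leI)
          then show ?thesis using False by simp
        qed
      qed
      also have "\<dots> = ennreal (\<delta> / l) + ennreal 2 * emeasure P ?A"
        by (subst nn_integral_add) (simp_all add: emeasure_space_1 nn_integral_cmult_indicator)
      also have "\<dots> = ennreal (\<delta> / l + 2 * prob ?A)"
        using \<delta> l by (simp add: emeasure_eq_measure ennreal_mult)
      also have "\<dots> \<le> ennreal \<eta>" using small \<delta>(2) by (intro ennreal_leI) linarith
      finally have "1 - exp (- enn2real (exponent F ?u)) \<le> \<eta>" using \<eta> by simp
      from one_minus_exp_le_imp[OF _ \<eta>(2) this] \<eta> have "enn2real (exponent F ?u) \<le> 2 * \<eta>" by simp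
      then have "ennreal (enn2real (exponent F ?u)) \<le> ennreal (2 * \<eta>)" by (rule ennreal_leI)
      then show ?thesis using simple_integral_char(1)[OF F, of ?u] by simp
    qed
    have "H F l \<le> ennreal K * (\<Sum>i\<in>UNIV. exponent F ((1 / l) *\<^sub>R axis i 1))"
      by (rule K(2)[OF simple_fn_borel[OF F] l(1)])
    also have "\<dots> \<le> ennreal K * (\<Sum>i\<in>(UNIV :: 'm set). ennreal (2 * \<eta>))"
      by (intro mult_left_mono sum_mono ex) simp
    also have "\<dots> = ennreal K * (ennreal m * ennreal (2 * \<eta>))"
      by (simp add: m_def ennreal_of_nat_eq_real_of_nat)
    also have "\<dots> = ennreal (K * m * (2 * \<eta>))"
      using K(1) m \<eta> by (simp add: ennreal_mult mult.assoc)
    also have "\<dots> \<le> 1" using \<eta>(3) by simp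
    finally have "N F \<le> l" by (rule N_le[OF l(1)])
    then show ?thesis using l(2) by simp
  qed
  then show ?thesis using \<delta>(1) by blast
qed

text \<open>This relation collects what the passage to the limit needs: an integral is a limit in
  probability along simple functions that converge to the integrand in the quasi-norm.\<close>

definition represents :: "('s \<Rightarrow> real^'m^'m) \<Rightarrow> ('w \<Rightarrow> real^'m) \<Rightarrow> bool" where
  "represents f Y \<longleftrightarrow> f \<in> V \<and> Y \<in> borel_measurable P \<and> (\<exists>F. (\<forall>n. simple_fn \<nu> (F n)) \<and>
     (\<lambda>n. N (\<lambda>s. F n s - f s)) \<longlonglongrightarrow> 0 \<and> conv_in_prob P (\<lambda>n. sint (F n)) Y)"

lemma H_tendsto_0:
  assumes g: "\<And>n. g n \<in> V" and N: "(\<lambda>n. N (g n)) \<longlonglongrightarrow> 0" and l: "0 < l"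
  shows "(\<lambda>n. H (g n) l) \<longlonglongrightarrow> 0"
proof -
  have "(\<lambda>n. \<bar>1 / l\<bar> * N (g n)) \<longlonglongrightarrow> \<bar>1 / l\<bar> * 0" by (rule tendsto_mult[OF tendsto_const N])
  then have "(\<lambda>n. N (\<lambda>s. (1 / l) *\<^sub>R g n s)) \<longlonglongrightarrow> 0" by (simp only: N_scaleR[OF g] mult_zero_right)
  then have "(\<lambda>n. H (\<lambda>s. (1 / l) *\<^sub>R g n s) 1) \<longlonglongrightarrow> 0"
    using N_tendsto_0_iff[of "\<lambda>n s. (1 / l) *\<^sub>R g n s"] scaleR_in_V[OF g] by blast
  moreover have "H (\<lambda>s. (1 / l) *\<^sub>R g n s) 1 = H (g n) l" for n using l by (simp add: H_def)
  ultimately show ?thesis by simp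
qed

lemma N_diff_commute: "N (\<lambda>s. f s - g s) = N (\<lambda>s. g s - f s)"
  unfolding N_def using H_diff_commute[of f g] by simp

lemma represents_diff:
  assumes "represents f Y" "represents g Z"
  shows "represents (\<lambda>s. f s - g s) (\<lambda>\<omega>. Y \<omega> - Z \<omega>)"
proof -
  obtain F where F: "\<And>n. simple_fn \<nu> (F n)" "(\<lambda>n. N (\<lambda>s. F n s - f s)) \<longlonglongrightarrow> 0"
    "conv_in_prob P (\<lambda>n. sint (F n)) Y" using assms(1) unfolding represents_def by blast
  obtain G where G: "\<And>n. simple_fn \<nu> (G n)" "(\<lambda>n. N (\<lambda>s. G n s - g s)) \<longlonglongrightarrow> 0"
    "conv_in_prob P (\<lambda>n. sint (G n)) Z" using assms(2) unfolding represents_def by blast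
  have fg: "f \<in> V" "g \<in> V" and YZ[measurable]: "Y \<in> borel_measurable P" "Z \<in> borel_measurable P"
    using assms by (auto simp: represents_def)
  have D: "simple_fn \<nu> (\<lambda>s. F n s - G n s)" for n by (rule simple_fn_diff(1)[OF F(1) G(1)])
  have Im[measurable]: "sint (F n) \<in> borel_measurable P" "sint (G n) \<in> borel_measurable P"
    "sint (\<lambda>s. F n s - G n s) \<in> borel_measurable P" for n
    using simple_integral_measurable F(1) G(1) D by blast+
  have dV: "(\<lambda>s. F n s - f s) \<in> V" "(\<lambda>s. G n s - g s) \<in> V" for n
    using diff_in_V simple_fn_in_V F(1) G(1) fg by blast+
  have "conv_in_prob P (\<lambda>n \<omega>. sint (F n) \<omega> - sint (G n) \<omega>) (\<lambda>\<omega>. Y \<omega> - Z \<omega>)"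
    by (rule conv_in_prob_minus[OF Im(1,2) YZ F(3) G(3)])
  then have conv: "conv_in_prob P (\<lambda>n. sint (\<lambda>s. F n s - G n s)) (\<lambda>\<omega>. Y \<omega> - Z \<omega>)"
  proof (rule conv_in_prob_cong_AE[rotated -1])
    show "AE \<omega> in P. sint (F n) \<omega> - sint (G n) \<omega>
        = sint (\<lambda>s. F n s - G n s) \<omega>" for n
      using simple_fn_diff(2)[OF F(1) G(1), of n n] by eventually_elim simp
  qed measurable
  obtain T where T: "T \<ge> 1" "\<And>f g. f \<in> V \<Longrightarrow> g \<in> V \<Longrightarrow> N (\<lambda>s. f s + g s) \<le> T * (N f + N g)"
    using N_quasi_triangle by blast
  have le: "N (\<lambda>s. F n s - G n s - (f s - g s)) \<le> T * (N (\<lambda>s. F n s - f s) + N (\<lambda>s. G n s - g s))" for n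
  proof -
    have "(\<lambda>s. g s - G n s) \<in> V" using diff_in_V simple_fn_in_V G(1) fg by blast
    from T(2)[OF dV(1) this, of n]
    have le': "N (\<lambda>s. F n s - f s + (g s - G n s)) \<le> T * (N (\<lambda>s. F n s - f s) + N (\<lambda>s. g s - G n s))" .
    have "(\<lambda>s. F n s - G n s - (f s - g s)) = (\<lambda>s. F n s - f s + (g s - G n s))" by (simp add: fun_eq_iff)
    then show ?thesis using le' unfolding N_diff_commute[of g "G n"] by (simp only:)
  qed
  have "(\<lambda>n. T * (N (\<lambda>s. F n s - f s) + N (\<lambda>s. G n s - g s))) \<longlonglongrightarrow> T * (0 + 0)"
    by (intro tendsto_mult[OF tendsto_const] tendsto_add F(2) G(2))
  then have lim: "(\<lambda>n. T * (N (\<lambda>s. F n s - f s) + N (\<lambda>s. G n s - g s))) \<longlonglongrightarrow> 0" by simp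
  have "(\<lambda>n. N (\<lambda>s. F n s - G n s - (f s - g s))) \<longlonglongrightarrow> 0"
  proof (rule tendsto_sandwich[OF _ _ tendsto_const lim])
    show "\<forall>\<^sub>F n in sequentially. 0 \<le> N (\<lambda>s. F n s - G n s - (f s - g s))"
      using N_nonneg diff_in_V simple_fn_in_V[OF D] fg by (intro always_eventually allI) blast
    show "\<forall>\<^sub>F n in sequentially. N (\<lambda>s. F n s - G n s - (f s - g s)) \<le> T * (N (\<lambda>s. F n s - f s) + N (\<lambda>s. G n s - g s))"
      using le by (intro always_eventually allI)
  qed
  moreover have "(\<lambda>\<omega>. Y \<omega> - Z \<omega>) \<in> borel_measurable P" by measurable
  moreover have "(\<lambda>s. f s - g s) \<in> V" using diff_in_V fg by blast
  ultimately show ?thesis unfolding represents_def using D conv by (intro conjI exI[of _ "\<lambda>n s. F n s - G n s"]) blast+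
qed

text \<open>The tail estimate of the approximating simple functions at half the threshold; scaling and
  quasi-additivity of the modular absorb the difference.\<close>

lemma represents_tail:
  "\<exists>L\<ge>1. \<forall>f Y. represents f Y \<longrightarrow> (\<forall>\<delta>>0. ennreal (tail Y \<delta>) \<le> ennreal L * H f \<delta>)"
proof -
  obtain L where L: "L \<ge> 1" "\<And>F \<delta>. simple_fn \<nu> F \<Longrightarrow> \<delta> > 0 \<Longrightarrow>
    ennreal (tail (sint F) \<delta>) \<le> ennreal L * H F \<delta>"
    using simple_integral_tail by blast
  define c where "c = L * 2 powr b * 2 powr b"
  have p2: "1 \<le> 2 powr b" using b_pos by (intro ge_one_powr_ge_zero) simp_all
  have c1: "c \<ge> 1" unfolding c_def using L(1) p2 mult_mono[of 1 L 1 "2 powr b"] mult_mono[of 1 "L * 2 powr b" 1 "2 powr b"] by simp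
  have "ennreal (tail Y \<delta>) \<le> ennreal c * H f \<delta>"
    if rep: "represents f Y" and \<delta>: "\<delta> > 0" for f Y \<delta>
  proof -
    obtain F where F: "\<And>n. simple_fn \<nu> (F n)" "(\<lambda>n. N (\<lambda>s. F n s - f s)) \<longlonglongrightarrow> 0"
      "conv_in_prob P (\<lambda>n. sint (F n)) Y" using rep unfolding represents_def by blast
    have f: "f \<in> V" and Y[measurable]: "Y \<in> borel_measurable P" using rep by (auto simp: represents_def)
    have Im[measurable]: "sint (F n) \<in> borel_measurable P" for n
      by (rule simple_integral_measurable[OF F(1)])
    have dV: "(\<lambda>s. F n s - f s) \<in> V" for n using diff_in_V[OF simple_fn_in_V[OF F(1)] f] .
    let ?q = "\<lambda>n. tail (\<lambda>\<omega>. sint (F n) \<omega> - Y \<omega>) (\<delta> / 2)"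
    have le: "ennreal (tail Y \<delta>)
        \<le> ennreal c * (H (\<lambda>s. F n s - f s) \<delta> + H f \<delta>) + ennreal (?q n)" for n
    proof -
      have "tail Y \<delta>
          \<le> tail (sint (F n)) (\<delta> / 2)
            + tail (\<lambda>\<omega>. Y \<omega> - sint (F n) \<omega>) (\<delta> / 2)"
        by (rule prob_norm_triangle) measurable
      then have "ennreal (tail Y \<delta>)
          \<le> ennreal (tail (sint (F n)) (\<delta> / 2)) + ennreal (?q n)"
        by (simp add: ennreal_plus[symmetric] ennreal_leI norm_minus_commute del: ennreal_plus)
      also have "ennreal (tail (sint (F n)) (\<delta> / 2))
          \<le> ennreal L * H (F n) (\<delta> / 2)"
        using \<delta> by (intro L(2) F(1)) simp
      also have "H (F n) (\<delta> / 2) \<le> ennreal (2 powr b) * H (F n) \<delta>"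
      proof -
        have "H (F n) (\<delta> / 2) \<le> ennreal ((\<delta> / (\<delta> / 2)) powr b) * H (F n) \<delta>"
          using \<delta> by (intro H_scale_le simple_fn_borel F(1)) simp_all
        moreover have "\<delta> / (\<delta> / 2) = 2" using \<delta> by simp
        ultimately show ?thesis by (simp only:)
      qed
      also have "H (F n) \<delta> \<le> ennreal (2 powr b) * (H (\<lambda>s. F n s - f s) \<delta> + H f \<delta>)"
        using H_add[OF V_measurable[OF dV] V_measurable[OF f], of n \<delta>] by simp
      finally have "ennreal (tail Y \<delta>)
          \<le> ennreal L * (ennreal (2 powr b) * (ennreal (2 powr b) * (H (\<lambda>s. F n s - f s) \<delta> + H f \<delta>))) + ennreal (?q n)"
        by (auto simp: mult_left_mono)
      also have "ennreal L * (ennreal (2 powr b) * (ennreal (2 powr b) * (H (\<lambda>s. F n s - f s) \<delta> + H f \<delta>)))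
          = ennreal c * (H (\<lambda>s. F n s - f s) \<delta> + H f \<delta>)"
        using L(1) by (simp add: c_def ennreal_mult mult.assoc)
      finally show ?thesis .
    qed
    have qlim: "?q \<longlonglongrightarrow> 0" by (rule F(3)[unfolded conv_in_prob_def, rule_format]) (use \<delta> in simp)
    have "(\<lambda>n. ennreal c * (H (\<lambda>s. F n s - f s) \<delta> + H f \<delta>) + ennreal (?q n)) \<longlonglongrightarrow> ennreal c * (0 + H f \<delta>) + ennreal 0"
      by (intro tendsto_add ennreal_tendsto_cmult H_tendsto_0[OF dV F(2) \<delta>] tendsto_const tendsto_ennrealI qlim) simp
    then have "ennreal (tail Y \<delta>) \<le> ennreal c * (0 + H f \<delta>) + ennreal 0"
      by (rule LIMSEQ_le_const) (use le in blast)
    then show ?thesis by simp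
  qed
  then show ?thesis using c1 by blast
qed

lemma represents_small_imp_N_small:
  assumes e: "e > 0"
  shows "\<exists>\<delta>>0. \<forall>g Y. represents g Y \<longrightarrow> tail Y \<delta> \<le> \<delta> \<longrightarrow> N g < e"
proof -
  obtain T where T: "T \<ge> 1" "\<And>f g. f \<in> V \<Longrightarrow> g \<in> V \<Longrightarrow> N (\<lambda>s. f s + g s) \<le> T * (N f + N g)"
    using N_quasi_triangle by blast
  define e' where "e' = e / (2 * T)"
  have e': "e' > 0" "T * (e' + e') = e" using e T(1) by (auto simp: e'_def field_simps)
  obtain \<delta> where \<delta>: "\<delta> > 0" "\<And>F. simple_fn \<nu> F \<Longrightarrow>
      tail (sint F) \<delta> \<le> \<delta> \<Longrightarrow> N F < e'"
    using simple_integral_small_imp_N_small[OF e'(1)] by blast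
  have "N g < e" if rep: "represents g Y" and small: "tail Y (\<delta> / 2) \<le> \<delta> / 2" for g Y
  proof -
    obtain F where F: "\<And>n. simple_fn \<nu> (F n)" "(\<lambda>n. N (\<lambda>s. F n s - g s)) \<longlonglongrightarrow> 0"
      "conv_in_prob P (\<lambda>n. sint (F n)) Y" using rep unfolding represents_def by blast
    have g: "g \<in> V" and Y[measurable]: "Y \<in> borel_measurable P" using rep by (auto simp: represents_def)
    have Im[measurable]: "sint (F n) \<in> borel_measurable P" for n
      by (rule simple_integral_measurable[OF F(1)])
    let ?q = "\<lambda>n. tail (\<lambda>\<omega>. sint (F n) \<omega> - Y \<omega>) (\<delta> / 2)"
    have "?q \<longlonglongrightarrow> 0" by (rule F(3)[unfolded conv_in_prob_def, rule_format]) (use \<delta> in simp)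
    then have "\<forall>\<^sub>F n in sequentially. ?q n < \<delta> / 2" by (rule order_tendstoD) (use \<delta> in simp)
    moreover have "\<forall>\<^sub>F n in sequentially. N (\<lambda>s. F n s - g s) < e'" using F(2) e'(1) by (rule order_tendstoD)
    ultimately have "\<forall>\<^sub>F n in sequentially. ?q n < \<delta> / 2 \<and> N (\<lambda>s. F n s - g s) < e'" by eventually_elim simp
    then have "\<exists>n. ?q n < \<delta> / 2 \<and> N (\<lambda>s. F n s - g s) < e'"
      by (rule eventually_happens'[OF sequentially_bot])
    then obtain n where n: "?q n < \<delta> / 2" "N (\<lambda>s. F n s - g s) < e'" by (elim exE conjE)
    have "tail (sint (F n)) \<delta>
        \<le> tail Y (\<delta> / 2) + ?q n"
      by (rule prob_norm_triangle) measurable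
    also have "\<dots> \<le> \<delta>" using n small by simp
    finally have NF: "N (F n) < e'" by (rule \<delta>(2)[OF F(1)])
    have FV: "F n \<in> V" by (rule simple_fn_in_V[OF F(1)])
    have "N (\<lambda>s. F n s + (g s - F n s)) \<le> T * (N (F n) + N (\<lambda>s. g s - F n s))"
      by (rule T(2)[OF FV diff_in_V[OF g FV]])
    then have "N g \<le> T * (N (F n) + N (\<lambda>s. F n s - g s))" using N_diff_commute[of g "F n"] by simp
    also have "\<dots> < T * (e' + e')" using NF n T(1) by (intro mult_strict_left_mono add_strict_mono) simp_all
    finally show ?thesis using e'(2) by simp
  qed
  then show ?thesis using \<delta>(1) by (intro exI[of _ "\<delta> / 2"]) simp
qed

lemma simple_fn_restrict:
  assumes F: "simple_fn \<nu> F" and A: "A \<in> sets \<nu>"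
  shows "simple_fn \<nu> (\<lambda>s. indicat_real A s *\<^sub>R F s)"
proof -
  have sF: "simple_function \<nu> F" and fin: "emeasure \<nu> {s \<in> space \<nu>. F s \<noteq> 0} < \<infinity>"
    using F by (auto simp: simple_fn_iff)
  have [measurable]: "F \<in> borel_measurable \<nu>" by (rule simple_fn_borel[OF F])
  have s: "simple_function \<nu> (\<lambda>s. indicat_real A s *\<^sub>R F s)"
    using sF A by (intro simple_function_compose2[where h = scaleR] simple_function_indicator)
  have "emeasure \<nu> {s \<in> space \<nu>. indicat_real A s *\<^sub>R F s \<noteq> 0} \<le> emeasure \<nu> {s \<in> space \<nu>. F s \<noteq> 0}"
    by (intro emeasure_mono) auto
  then show ?thesis using s fin by (simp add: simple_fn_iff le_less_trans)
qed

lemma H_restrict_le: "H (\<lambda>s. indicat_real A s *\<^sub>R f s) l \<le> H f l"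
  unfolding H_def by (intro nn_integral_mono) (auto simp: indicator_def G_zero)

lemma simple_integral_space: "sint (\<lambda>s. indicat_real (space \<nu>) s *\<^sub>R F s) = sint F"
proof -
  have "simple_rep \<nu> (\<lambda>s. indicat_real (space \<nu>) s *\<^sub>R F s) = simple_rep \<nu> F"
    by (intro ext) (auto simp: simple_rep_def)
  then show ?thesis unfolding simple_integral_def by simp
qed

text \<open>Convergence in probability of the integrals makes the approximating sequence Cauchy in the
  quasi-norm, and its quasi-norm limit is its pointwise limit.\<close>

lemma approx_represents:
  assumes F: "\<And>n. simple_fn \<nu> (F n)" and f: "f \<in> borel_measurable \<nu>"
    and ae: "AE s in \<nu>. (\<lambda>n. F n s) \<longlonglongrightarrow> f s"
    and X[measurable]: "X \<in> borel_measurable P" and conv: "conv_in_prob P (\<lambda>n. sint (F n)) X"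
  shows "represents f X"
proof -
  have FV: "F n \<in> V" for n by (rule simple_fn_in_V[OF F])
  have Im[measurable]: "sint (F n) \<in> borel_measurable P" for n
    by (rule simple_integral_measurable[OF F])
  have cauchy: "\<exists>k. \<forall>m\<ge>k. \<forall>n\<ge>k. N (\<lambda>s. F m s - F n s) < e" if e: "e > 0" for e
  proof -
    obtain \<delta> where \<delta>: "\<delta> > 0" "\<And>F. simple_fn \<nu> F \<Longrightarrow>
        tail (sint F) \<delta> \<le> \<delta> \<Longrightarrow> N F < e"
      using simple_integral_small_imp_N_small[OF e] by blast
    let ?q = "\<lambda>n. tail (\<lambda>\<omega>. sint (F n) \<omega> - X \<omega>) (\<delta> / 2)"
    have "?q \<longlonglongrightarrow> 0" by (rule conv[unfolded conv_in_prob_def, rule_format]) (use \<delta> in simp)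
    then have "\<forall>\<^sub>F n in sequentially. ?q n < \<delta> / 2" by (rule order_tendstoD) (use \<delta> in simp)
    then obtain k where k: "\<And>n. n \<ge> k \<Longrightarrow> ?q n < \<delta> / 2" by (auto simp: eventually_sequentially)
    have "N (\<lambda>s. F m s - F n s) < e" if mn: "m \<ge> k" "n \<ge> k" for m n
    proof (rule \<delta>(2)[OF simple_fn_diff(1)[OF F F]])
      have Dm[measurable]: "sint (\<lambda>s. F m s - F n s) \<in> borel_measurable P"
        by (rule simple_integral_measurable[OF simple_fn_diff(1)[OF F F]])
      have "tail (\<lambda>\<omega>. sint (\<lambda>s. F m s - F n s) \<omega>) \<delta>
          = tail (\<lambda>\<omega>. sint (F m) \<omega> - sint (F n) \<omega>) \<delta>"
        by (rule prob_norm_cong_AE) (measurable, rule simple_fn_diff(2)[OF F F])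
      also have "\<dots> \<le> tail (\<lambda>\<omega>. X \<omega> - sint (F n) \<omega>) (\<delta> / 2)
          + tail (\<lambda>\<omega>. sint (F m) \<omega> - sint (F n) \<omega> - (X \<omega> - sint (F n) \<omega>)) (\<delta> / 2)"
        by (rule prob_norm_triangle) measurable
      also have "\<dots> = ?q n + ?q m" by (simp add: norm_minus_commute)
      also have "\<dots> \<le> \<delta>" using k[OF mn(1)] k[OF mn(2)] by simp
      finally show "tail (\<lambda>\<omega>. sint (\<lambda>s. F m s - F n s) \<omega>) \<delta> \<le> \<delta>" .
    qed
    then show ?thesis by blast
  qed
  have "f \<in> V" "(\<lambda>n. N (\<lambda>s. F n s - f s)) \<longlonglongrightarrow> 0"
    by (rule quasi_limit[where r = "\<lambda>n. n" and F = F, OF FV f filterlim_ident ae cauchy]; assumption)+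
  then show ?thesis unfolding represents_def using F X conv by blast
qed

text \<open>Along simple functions approximating \<open>f\<close> in the quasi-norm, the tail estimate makes the
  integrals Cauchy in probability, also after restriction to a set, which decreases the modular.\<close>

lemma V_integrable:
  assumes f: "f \<in> V"
  shows "f \<in> integrable_fns \<nu> P M"
proof -
  obtain F where F: "\<And>n. simple_function \<nu> (F n) \<and> emeasure \<nu> {s \<in> space \<nu>. F n s \<noteq> 0} < \<infinity>"
    "\<And>s. s \<in> space \<nu> \<Longrightarrow> (\<lambda>n. F n s) \<longlonglongrightarrow> f s" "\<And>n. F n \<in> V" "(\<lambda>n. N (\<lambda>s. F n s - f s)) \<longlonglongrightarrow> 0"
    by (rule simple_functions_dense[OF sigma_finite_\<nu> f]) (rule that)
  have Fs: "simple_fn \<nu> (F n)" for n using F(1) by (simp add: simple_fn_iff)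
  have dV: "(\<lambda>s. F n s - f s) \<in> V" for n by (rule diff_in_V[OF simple_fn_in_V[OF Fs] f])
  obtain L where L: "L \<ge> 1" "\<And>F \<delta>. simple_fn \<nu> F \<Longrightarrow> \<delta> > 0 \<Longrightarrow>
    ennreal (tail (sint F) \<delta>) \<le> ennreal L * H F \<delta>"
    using simple_integral_tail by blast
  have "\<exists>X\<in>borel_measurable P. conv_in_prob P (\<lambda>n. sint (\<lambda>s. indicat_real A s *\<^sub>R F n s)) X"
    if A: "A \<in> sets \<nu>" for A
  proof (rule Cauchy_in_prob_convergent)
    let ?F = "\<lambda>n s. indicat_real A s *\<^sub>R F n s"
    have AF: "simple_fn \<nu> (?F n)" for n by (rule simple_fn_restrict[OF Fs A])
    show Im[measurable]: "sint (?F n) \<in> borel_measurable P" for n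
      by (rule simple_integral_measurable[OF AF])
    fix e :: real assume e: "e > 0"
    define d where "d = e / (2 * L * 2 powr b)"
    have p2: "0 < 2 powr b" by simp
    have d: "d > 0" "L * (2 powr b * (d + d)) = e" using e L(1) p2 by (auto simp: d_def field_simps)
    have "(\<lambda>n. H (\<lambda>s. F n s - f s) e) \<longlonglongrightarrow> 0" by (rule H_tendsto_0[OF dV F(4) e])
    then have "\<forall>\<^sub>F n in sequentially. H (\<lambda>s. F n s - f s) e < ennreal d" by (rule order_tendstoD) (use d in simp)
    then obtain k where k: "\<And>n. n \<ge> k \<Longrightarrow> H (\<lambda>s. F n s - f s) e < ennreal d" by (auto simp: eventually_sequentially)
    have "tail (\<lambda>\<omega>. sint (?F m) \<omega> - sint (?F n) \<omega>) e \<le> e"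
      if mn: "m \<ge> k" "n \<ge> k" for m n
    proof -
      have D: "simple_fn \<nu> (\<lambda>s. ?F m s - ?F n s)" by (rule simple_fn_diff(1)[OF AF AF])
      have Dm[measurable]: "sint (\<lambda>s. ?F m s - ?F n s) \<in> borel_measurable P"
        by (rule simple_integral_measurable[OF D])
      have "tail (\<lambda>\<omega>. sint (?F m) \<omega> - sint (?F n) \<omega>) e
          = tail (\<lambda>\<omega>. sint (\<lambda>s. ?F m s - ?F n s) \<omega>) e"
      proof (rule prob_norm_cong_AE)
        show "AE \<omega> in P. sint (?F m) \<omega> - sint (?F n) \<omega>
            = sint (\<lambda>s. ?F m s - ?F n s) \<omega>"
          using simple_fn_diff(2)[OF AF AF, of m n] by eventually_elim simp
      qed measurable
      moreover have "ennreal (tail (\<lambda>\<omega>. sint (\<lambda>s. ?F m s - ?F n s) \<omega>) e) \<le> ennreal e"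
      proof -
        have "ennreal (tail (\<lambda>\<omega>. sint (\<lambda>s. ?F m s - ?F n s) \<omega>) e)
            \<le> ennreal L * H (\<lambda>s. ?F m s - ?F n s) e" by (rule L(2)[OF D e])
        also have "H (\<lambda>s. ?F m s - ?F n s) e = H (\<lambda>s. indicat_real A s *\<^sub>R (F m s - F n s)) e"
          by (simp add: scaleR_diff_right)
        also have "\<dots> \<le> H (\<lambda>s. F m s - F n s) e" by (rule H_restrict_le)
        also have "H (\<lambda>s. F m s - F n s) e \<le> ennreal (2 powr b) * (H (\<lambda>s. F m s - f s) e + H (\<lambda>s. F n s - f s) e)"
          using H_diff[OF V_measurable[OF dV] V_measurable[OF dV], of m n e] by simp
        also have "\<dots> \<le> ennreal (2 powr b) * (ennreal d + ennreal d)"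
          using k[OF mn(1)] k[OF mn(2)] by (intro mult_left_mono add_mono) simp_all
        finally have "ennreal (tail (\<lambda>\<omega>. sint (\<lambda>s. ?F m s - ?F n s) \<omega>) e)
            \<le> ennreal L * (ennreal (2 powr b) * (ennreal d + ennreal d))" by (auto simp: mult_left_mono)
        also have "\<dots> = ennreal (L * (2 powr b * (d + d)))"
        proof -
          have "ennreal (L * (2 powr b * (d + d))) = ennreal L * ennreal (2 powr b * (d + d))"
            using L(1) d(1) by (intro ennreal_mult) simp_all
          also have "ennreal (2 powr b * (d + d)) = ennreal (2 powr b) * ennreal (d + d)"
            using d(1) by (intro ennreal_mult) simp_all
          also have "ennreal (d + d) = ennreal d + ennreal d" using d(1) by (intro ennreal_plus) simp_all
          finally show ?thesis by (rule sym)
        qed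
        finally show ?thesis unfolding d(2) .
      qed
      ultimately show ?thesis using e by simp
    qed
    then show "\<exists>k. \<forall>m\<ge>k. \<forall>n\<ge>k. tail (\<lambda>\<omega>. sint (?F m) \<omega> - sint (?F n) \<omega>) e \<le> e"
      by blast
  qed
  moreover have "AE s in \<nu>. (\<lambda>n. F n s) \<longlonglongrightarrow> f s" using F(2) by (rule AE_I2)
  ultimately have "approx_seq \<nu> P M f F" unfolding approx_seq_def using Fs by blast
  then show ?thesis using V_measurable[OF f] by (auto simp: integrable_fns_def)
qed

lemma integrable_represents:
  assumes "f \<in> integrable_fns \<nu> P M"
  shows "represents f (stoch_integral \<nu> P M f)"
proof -
  have f: "f \<in> borel_measurable \<nu>" using assms by (simp add: integrable_fns_def)
  obtain F where F: "approx_seq \<nu> P M f F" using assms by (auto simp: integrable_fns_def)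
  have "space \<nu> \<in> sets \<nu>" by simp
  with F obtain X where "X \<in> borel_measurable P"
    "conv_in_prob P (\<lambda>n. sint (\<lambda>s. indicat_real (space \<nu>) s *\<^sub>R F n s)) X"
    unfolding approx_seq_def by blast
  then have "\<exists>X. X \<in> borel_measurable P \<and>
      (\<exists>F. approx_seq \<nu> P M f F \<and> conv_in_prob P (\<lambda>n. sint (F n)) X)"
    using F by (auto simp: simple_integral_space)
  from someI_ex[OF this] obtain F' where Y: "stoch_integral \<nu> P M f \<in> borel_measurable P"
    and F': "approx_seq \<nu> P M f F'" "conv_in_prob P (\<lambda>n. sint (F' n)) (stoch_integral \<nu> P M f)"
    unfolding stoch_integral_def[symmetric] by blast
  show ?thesis
    using F'(1) by (intro approx_represents[OF _ f _ Y F'(2)]) (auto simp: approx_seq_def)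
qed

theorem integrable_fns_eq: "integrable_fns \<nu> P M = V"
  using V_integrable integrable_represents by (auto simp: represents_def)

text \<open>The difference of two integrals represents the difference of the integrands, so both directions are
  statements about one function: the tail estimate and its converse.\<close>

theorem conv_in_prob_iff_N:
  assumes f: "f \<in> integrable_fns \<nu> P M" and F: "\<And>n. F n \<in> integrable_fns \<nu> P M"
  shows "conv_in_prob P (\<lambda>n. stoch_integral \<nu> P M (F n)) (stoch_integral \<nu> P M f)
    \<longleftrightarrow> (\<lambda>n. N (\<lambda>s. F n s - f s)) \<longlonglongrightarrow> 0"
proof
  let ?Y = "\<lambda>n \<omega>. stoch_integral \<nu> P M (F n) \<omega> - stoch_integral \<nu> P M f \<omega>"
  have rep: "represents (\<lambda>s. F n s - f s) (?Y n)" for n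
    by (intro represents_diff integrable_represents f F)
  have dV: "(\<lambda>s. F n s - f s) \<in> V" for n using rep[of n] by (simp add: represents_def)
  {
    assume conv: "conv_in_prob P (\<lambda>n. stoch_integral \<nu> P M (F n)) (stoch_integral \<nu> P M f)"
    show "(\<lambda>n. N (\<lambda>s. F n s - f s)) \<longlonglongrightarrow> 0"
    proof (rule LIMSEQ_I)
      fix e :: real assume e: "e > 0"
      obtain \<delta> where \<delta>: "\<delta> > 0" "\<And>g Y. represents g Y \<Longrightarrow> tail Y \<delta> \<le> \<delta> \<Longrightarrow> N g < e"
        using represents_small_imp_N_small[OF e] by blast
      have "(\<lambda>n. tail (?Y n) \<delta>) \<longlonglongrightarrow> 0"
        by (rule conv[unfolded conv_in_prob_def, rule_format]) (rule \<delta>)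
      then have "\<forall>\<^sub>F n in sequentially. tail (?Y n) \<delta> < \<delta>"
        using \<delta>(1) by (rule order_tendstoD)
      then obtain k where k: "\<And>n. n \<ge> k \<Longrightarrow> tail (?Y n) \<delta> < \<delta>"
        by (auto simp: eventually_sequentially)
      have "norm (N (\<lambda>s. F n s - f s) - 0) < e" if "n \<ge> k" for n
        using \<delta>(2)[OF rep[of n]] k[OF that] N_nonneg[OF dV[of n]] by simp
      then show "\<exists>no. \<forall>n\<ge>no. norm (N (\<lambda>s. F n s - f s) - 0) < e" by blast
    qed
  next
    assume lim: "(\<lambda>n. N (\<lambda>s. F n s - f s)) \<longlonglongrightarrow> 0"
    obtain L where L: "L \<ge> 1" "\<And>f Y \<delta>. represents f Y \<Longrightarrow> \<delta> > 0 \<Longrightarrow>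
        ennreal (tail Y \<delta>) \<le> ennreal L * H f \<delta>"
      using represents_tail by blast
    show "conv_in_prob P (\<lambda>n. stoch_integral \<nu> P M (F n)) (stoch_integral \<nu> P M f)"
      unfolding conv_in_prob_def
    proof (intro allI impI)
      fix \<epsilon> :: real assume e: "\<epsilon> > 0"
      have "(\<lambda>n. ennreal L * H (\<lambda>s. F n s - f s) \<epsilon>) \<longlonglongrightarrow> ennreal L * 0"
        by (intro ennreal_tendsto_cmult H_tendsto_0[OF dV lim e]) simp
      then have "(\<lambda>n. ennreal L * H (\<lambda>s. F n s - f s) \<epsilon>) \<longlonglongrightarrow> 0" by simp
      then have "(\<lambda>n. ennreal (tail (?Y n) \<epsilon>)) \<longlonglongrightarrow> 0"
        by (rule ennreal_tendsto_0_le[OF L(2)[OF rep e]])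
      then have "(\<lambda>n. ennreal (tail (?Y n) \<epsilon>)) \<longlonglongrightarrow> ennreal 0" by simp
      then show "(\<lambda>n. tail (?Y n) \<epsilon>) \<longlonglongrightarrow> 0"
        by (rule tendsto_ennrealD) simp_all
    qed
  }
qed

text \<open>Let \<open>\<eta>\<close> be the quasi-norm, or any positive number if the quasi-norm vanishes, and split according to
  the consecutive powers of 2 between which \<open>|Y| / \<eta>\<close> lies.  The tail estimate bounds the probability of
  each shell; from one shell to the next this bound decreases by the factor \<open>2\<^sup>a\<close> while \<open>|Y|\<^sup>p\<close> grows by
  \<open>2\<^sup>p\<close>, so the contributions are geometric.  If the quasi-norm vanishes, \<open>\<eta>\<close> tends to 0 at the end.\<close>

theorem moment_bound:
  assumes p: "0 < p" "p < a"
  shows "\<exists>L>0. \<forall>f Y. represents f Y \<longrightarrow> (\<integral>\<^sup>+ \<omega>. ennreal (norm (Y \<omega>) powr p) \<partial>P) \<le> ennreal (L * N f powr p)"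
proof -
  obtain L where L: "L \<ge> 1" "\<And>f Y \<delta>. represents f Y \<Longrightarrow> \<delta> > 0 \<Longrightarrow>
      ennreal (tail Y \<delta>) \<le> ennreal L * H f \<delta>"
    using represents_tail by blast
  define q where "q = 2 powr (p - a)"
  have q: "0 < q" "q < 1" using p powr_less_mono[of "p - a" 0 2] by (auto simp: q_def)
  define S where "S = 1 + 2 powr p * L * (1 / (1 - q))"
  have S: "S > 0" using L(1) q unfolding S_def by (intro add_pos_nonneg mult_nonneg_nonneg) simp_all
  have main: "(\<integral>\<^sup>+ \<omega>. ennreal (norm (Y \<omega>) powr p) \<partial>P) \<le> ennreal (S * \<eta> powr p)"
    if rep: "represents f Y" and \<eta>: "\<eta> > 0" "N f \<le> \<eta>" for f Y \<eta>
  proof -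
    have f: "f \<in> V" and Y[measurable]: "Y \<in> borel_measurable P" using rep by (auto simp: represents_def)
    let ?A = "\<lambda>k :: nat. {\<omega> \<in> space P. 2 ^ k * \<eta> \<le> norm (Y \<omega>)}"
    let ?c = "\<lambda>k :: nat. (2 ^ Suc k * \<eta>) powr p"
    have tail: "ennreal (?c k) * emeasure P (?A k) \<le> ennreal (2 powr p * L * \<eta> powr p * q ^ k)" for k
    proof -
      have pk: "0 < 2 ^ k * \<eta>" using \<eta> by simp
      define x where "x = N f / (2 ^ k * \<eta>)"
      have x: "0 \<le> x" "x \<le> 1 / 2 ^ k"
        using N_nonneg[OF f] \<eta> by (auto simp: x_def field_simps)
      have "x \<le> 1" using x(2) by (rule order_trans) simp
      have "max (x powr a) (x powr b) \<le> x powr a"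
        using x \<open>x \<le> 1\<close> ab by (intro max.boundedI powr_mono') simp_all
      also have "\<dots> \<le> (1 / 2 ^ k) powr a" using x a_pos by (intro powr_mono2) simp_all
      finally have mx: "max (x powr a) (x powr b) \<le> (1 / 2 ^ k) powr a" .
      have "emeasure P (?A k) \<le> ennreal L * H f (2 ^ k * \<eta>)"
        using L(2)[OF rep pk] by (simp add: emeasure_eq_measure)
      also have "\<dots> \<le> ennreal L * ennreal ((1 / 2 ^ k) powr a)"
        using order_trans[OF H_N_bounds(2)[OF f pk] ennreal_leI[OF mx[unfolded x_def]]] by (intro mult_left_mono) simp_all
      finally have "ennreal (?c k) * emeasure P (?A k) \<le> ennreal (?c k) * (ennreal L * ennreal ((1 / 2 ^ k) powr a))"
        by (rule mult_left_mono) simp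
      also have "\<dots> = ennreal (?c k * (L * (1 / 2 ^ k) powr a))"
        using L(1) by (simp add: ennreal_mult)
      also have "?c k * (L * (1 / 2 ^ k) powr a) = 2 powr p * L * \<eta> powr p * q ^ k"
      proof -
        have "?c k = 2 powr p * (2 ^ k) powr p * \<eta> powr p" using \<eta> by (simp add: powr_mult)
        moreover have "(2 ^ k) powr p = (2 powr p) ^ k" by (rule power_powr_commute) simp
        moreover have "(1 / 2 ^ k :: real) powr a = 1 / (2 ^ k) powr a" by (simp add: powr_divide)
        moreover have "(2 ^ k :: real) powr a = (2 powr a) ^ k" by (rule power_powr_commute) simp
        moreover have "q ^ k = (2 powr p) ^ k / (2 powr a) ^ k" by (simp add: q_def powr_diff power_divide)
        ultimately show ?thesis by simp
      qed
      finally show ?thesis .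
    qed
    have "(\<integral>\<^sup>+ \<omega>. ennreal (norm (Y \<omega>) powr p) \<partial>P)
        \<le> (\<integral>\<^sup>+ \<omega>. ennreal (\<eta> powr p) + (\<Sum>k. ennreal (?c k) * indicator (?A k) \<omega>) \<partial>P)"
    proof (rule nn_integral_mono)
      fix \<omega> assume w: "\<omega> \<in> space P"
      show "ennreal (norm (Y \<omega>) powr p) \<le> ennreal (\<eta> powr p) + (\<Sum>k. ennreal (?c k) * indicator (?A k) \<omega>)"
      proof (cases "norm (Y \<omega>) \<le> \<eta>")
        case True
        then have "ennreal (norm (Y \<omega>) powr p) \<le> ennreal (\<eta> powr p)"
          using p by (intro ennreal_leI powr_mono2) simp_all
        then show ?thesis by (rule add_increasing2[rotated]) simp
      next
        case False
        have "\<exists>k. norm (Y \<omega>) / \<eta> < 2 ^ k" by (rule real_arch_pow) simp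
        then obtain k0 where k0: "norm (Y \<omega>) < 2 ^ k0 * \<eta>" using \<eta> by (auto simp: field_simps)
        define j where "j = (LEAST k. norm (Y \<omega>) < 2 ^ k * \<eta>)"
        have j: "norm (Y \<omega>) < 2 ^ j * \<eta>" unfolding j_def by (rule LeastI[of _ k0]) (rule k0)
        have "j \<noteq> 0" using j False by (auto intro: ccontr)
        then obtain k where k: "j = Suc k" by (cases j) auto
        have "\<not> norm (Y \<omega>) < 2 ^ k * \<eta>" using not_less_Least[of k "\<lambda>k. norm (Y \<omega>) < 2 ^ k * \<eta>"] k by (simp add: j_def)
        then have wk: "\<omega> \<in> ?A k" using w by simp
        have "ennreal (norm (Y \<omega>) powr p) \<le> ennreal (?c k)"
          using j k p by (intro ennreal_leI powr_mono2) simp_all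
        also have "\<dots> = (\<Sum>i\<in>{k}. ennreal (?c i) * indicator (?A i) \<omega>)" using wk by simp
        also have "\<dots> \<le> (\<Sum>k. ennreal (?c k) * indicator (?A k) \<omega>)" by (rule sum_le_suminf) simp_all
        finally show ?thesis by (rule add_increasing[rotated]) simp
      qed
    qed
    also have "\<dots> = ennreal (\<eta> powr p) + (\<integral>\<^sup>+ \<omega>. (\<Sum>k. ennreal (?c k) * indicator (?A k) \<omega>) \<partial>P)"
      by (subst nn_integral_add) (simp_all add: emeasure_space_1)
    also have "(\<integral>\<^sup>+ \<omega>. (\<Sum>k. ennreal (?c k) * indicator (?A k) \<omega>) \<partial>P) = (\<Sum>k. ennreal (?c k) * emeasure P (?A k))"
      by (subst nn_integral_suminf) (simp_all add: nn_integral_cmult_indicator)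
    also have "\<dots> \<le> (\<Sum>k. ennreal (2 powr p * L * \<eta> powr p * q ^ k))"
      by (rule suminf_le[OF tail]) simp_all
    also have "\<dots> = ennreal (2 powr p * L * \<eta> powr p * (1 / (1 - q)))"
    proof -
      have sm: "summable (\<lambda>k. 2 powr p * L * \<eta> powr p * q ^ k)"
        using q by (intro summable_mult summable_geometric) simp
      have "(\<Sum>k. ennreal (2 powr p * L * \<eta> powr p * q ^ k)) = ennreal (\<Sum>k. 2 powr p * L * \<eta> powr p * q ^ k)"
        using L(1) q sm by (intro suminf_ennreal2) simp_all
      also have "(\<Sum>k. 2 powr p * L * \<eta> powr p * q ^ k) = 2 powr p * L * \<eta> powr p * (1 / (1 - q))"
        using q by (simp add: suminf_mult suminf_geometric summable_geometric)
      finally show ?thesis .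
    qed
    finally have "(\<integral>\<^sup>+ \<omega>. ennreal (norm (Y \<omega>) powr p) \<partial>P)
        \<le> ennreal (\<eta> powr p) + ennreal (2 powr p * L * \<eta> powr p * (1 / (1 - q)))" by (simp add: add_left_mono)
    also have "\<dots> = ennreal (S * \<eta> powr p)"
    proof -
      have "S * \<eta> powr p = \<eta> powr p + 2 powr p * L * \<eta> powr p * (1 / (1 - q))"
        unfolding S_def by (simp add: algebra_simps)
      moreover have "0 \<le> 2 powr p * L * \<eta> powr p * (1 / (1 - q))"
        using L(1) q by (intro mult_nonneg_nonneg) simp_all
      ultimately show ?thesis by (simp add: ennreal_plus)
    qed
    finally show ?thesis .
  qed
  have "(\<integral>\<^sup>+ \<omega>. ennreal (norm (Y \<omega>) powr p) \<partial>P) \<le> ennreal (S * N f powr p)" if rep: "represents f Y" for f Y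
  proof (cases "N f = 0")
    case False
    have "f \<in> V" using rep by (simp add: represents_def)
    then show ?thesis using main[OF rep, of "N f"] N_nonneg[of f] False by simp
  next
    case True
    have "(\<lambda>n. 1 / real (Suc n)) \<longlonglongrightarrow> 0" by (rule LIMSEQ_Suc[OF lim_1_over_n])
    then have "(\<lambda>n. (1 / real (Suc n)) powr p) \<longlonglongrightarrow> 0 powr p"
      using p by (intro tendsto_powr' tendsto_const) simp_all
    then have "(\<lambda>n. ennreal (S * (1 / real (Suc n)) powr p)) \<longlonglongrightarrow> ennreal (S * 0 powr p)"
      by (intro tendsto_ennrealI tendsto_mult tendsto_const)
    moreover have "(\<integral>\<^sup>+ \<omega>. ennreal (norm (Y \<omega>) powr p) \<partial>P) \<le> ennreal (S * (1 / real (Suc n)) powr p)" for n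
      using True by (intro main[OF rep]) simp_all
    ultimately have "(\<integral>\<^sup>+ \<omega>. ennreal (norm (Y \<omega>) powr p) \<partial>P) \<le> ennreal (S * 0 powr p)"
      by (intro LIMSEQ_le_const) blast+
    then show ?thesis using True by simp
  qed
  then show ?thesis using S by blast
qed

end

section \<open>Integrability, quasi-norm, tails and completeness\<close>

theorem theorem2p8:
  fixes \<nu> :: "'s measure"
    and B :: "'s \<Rightarrow> real^'m^'m"
    and \<sigma> :: "(real^'m) measure"
    and P :: "'w measure"
    and M :: "'s set \<Rightarrow> 'w \<Rightarrow> real^'m"
    and a b C3 C4 :: real
  assumes "sigma_finite_measure \<nu>"
    and "\<forall>s\<in>space \<nu>. B s \<in> Q_ops \<and> transpose (B s) = B s"
    and "B \<in> borel_measurable \<nu>"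
    and "ereal (1 / 2) < (INF s\<in>space \<nu>. ereal (lam_min (B s)))"
    and "(INF s\<in>space \<nu>. ereal (lam_min (B s))) \<le> (SUP s\<in>space \<nu>. ereal (lam_max (B s)))"
    and "(SUP s\<in>space \<nu>. ereal (lam_max (B s))) < \<infinity>"
    and "a = (INF s\<in>space \<nu>. 1 / lam_max (B s))"
    and "b = (SUP s\<in>space \<nu>. 1 / lam_min (B s))"
    and "spectral_measure \<sigma>"
    and "multi_os_isrm \<nu> B \<sigma> P M"
    and "C3 > 0" and "C4 > 0"
    and "\<forall>s\<in>space \<nu>. \<forall>x.
           C3 * min (norm x powr a) (norm x powr b) \<le> tau (B s) x \<and>
           tau (B s) x \<le> C4 * max (norm x powr a) (norm x powr b)"
  shows
    "(integrable_fns \<nu> P M = {f \<in> borel_measurable \<nu>. \<forall>l>0. Hfun \<nu> B f l < \<infinity>} \<and>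
     integrable_fns \<nu> P M = {f \<in> borel_measurable \<nu>. \<exists>l>0. Hfun \<nu> B f l < \<infinity>}) \<and>
     ((\<forall>f\<in>integrable_fns \<nu> P M. \<exists>l>0. Hfun \<nu> B f l \<le> 1) \<and>
     quasi_norm_ae \<nu> (integrable_fns \<nu> P M) (Mnorm \<nu> B) \<and>
     (\<forall>f\<in>integrable_fns \<nu> P M. \<forall>l>0.
        ennreal (C3 * min ((Mnorm \<nu> B f / l) powr a) ((Mnorm \<nu> B f / l) powr b)) \<le> Hfun \<nu> B f l \<and>
        Hfun \<nu> B f l \<le> ennreal (C4 * max ((Mnorm \<nu> B f / l) powr a) ((Mnorm \<nu> B f / l) powr b)))) \<and>
     ((\<exists>L1\<ge>1. \<forall>f\<in>integrable_fns \<nu> P M. \<forall>\<delta>>0.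
        ennreal (measure P {\<omega>\<in>space P. norm (stoch_integral \<nu> P M f \<omega>) \<ge> \<delta>})
          \<le> ennreal L1 * Hfun \<nu> B f \<delta>) \<and>
     (\<forall>p. 0 < p \<and> p < a \<longrightarrow>
        (\<exists>L2>0. \<forall>f\<in>integrable_fns \<nu> P M.
           (\<integral>\<^sup>+ \<omega>. ennreal (norm (stoch_integral \<nu> P M f \<omega>) powr p) \<partial>P)
             \<le> ennreal (L2 * Mnorm \<nu> B f powr p)))) \<and>
     (quasi_complete (integrable_fns \<nu> P M) (Mnorm \<nu> B) \<and>
     (\<forall>f\<in>integrable_fns \<nu> P M. \<forall>F. (\<forall>n. F n \<in> integrable_fns \<nu> P M) \<longrightarrow>
        (conv_in_prob P (\<lambda>n. stoch_integral \<nu> P M (F n)) (stoch_integral \<nu> P M f)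
          \<longleftrightarrow> (\<lambda>n. Mnorm \<nu> B (\<lambda>s. F n s - f s)) \<longlonglongrightarrow> 0)))"
proof -
  have sym: "transpose (B s) = B s" if "s \<in> space \<nu>" for s using assms(2) that by blast
  \<comment> \<open>over the empty set the infimum would be \<open>\<infinity>\<close> and the supremum \<open>-\<infinity>\<close>\<close>
  obtain s0 where s0: "s0 \<in> space \<nu>"
  proof (cases "space \<nu> = {}")
    case True
    then have False using assms(5) by (simp add: top_ereal_def bot_ereal_def)
    then show ?thesis ..
  qed (use that in blast)
  obtain c where c: "1 / 2 < c" "ereal c < (INF s\<in>space \<nu>. ereal (lam_min (B s)))"
  proof -
    obtain z where z: "ereal (1 / 2) < z" "z < (INF s\<in>space \<nu>. ereal (lam_min (B s)))"
      using dense[OF assms(4)] by blast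
    then obtain c where "z = ereal c" by (cases z) auto
    then show thesis using that[of c] z by simp
  qed
  have lo: "c \<le> lam_min (B s)" if "s \<in> space \<nu>" for s
  proof -
    have "ereal c < ereal (lam_min (B s))"
      using c(2) INF_lower[OF that, of "\<lambda>s. ereal (lam_min (B s))"] by (rule less_le_trans)
    then show ?thesis by simp
  qed
  obtain C where C: "\<And>s. s \<in> space \<nu> \<Longrightarrow> lam_max (B s) \<le> C"
  proof -
    obtain z where z: "(SUP s\<in>space \<nu>. ereal (lam_max (B s))) < z" "z < \<infinity>"
      using dense[OF assms(6)] by blast
    then obtain C where C: "z = ereal C" by (cases z) auto
    have "lam_max (B s) \<le> C" if "s \<in> space \<nu>" for s
    proof -
      have "ereal (lam_max (B s)) < ereal C"
        using SUP_upper[OF that, of "\<lambda>s. ereal (lam_max (B s))"] z(1) unfolding C by (rule le_less_trans)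
      then show ?thesis by simp
    qed
    then show thesis by (rule that)
  qed
  have mm: "lam_min (B s) \<le> lam_max (B s)" if "s \<in> space \<nu>" for s
  proof -
    have "eigvals (B s) \<noteq> {}" "finite (eigvals (B s))" using eigvals_nonempty[OF sym[OF that]] by auto
    then obtain z where "z \<in> eigvals (B s)" "finite (Re ` eigvals (B s))" by auto
    then have "lam_min (B s) \<le> Re z" "Re z \<le> lam_max (B s)" by (auto simp: lam_min_def lam_max_def)
    then show ?thesis by simp
  qed
  have pos: "0 < lam_min (B s)" "0 < lam_max (B s)" if "s \<in> space \<nu>" for s
    using lo[OF that] mm[OF that] c(1) by auto
  have Cpos: "0 < C" using C[OF s0] pos(2)[OF s0] by simp
  have bdda: "bdd_below ((\<lambda>s. 1 / lam_max (B s)) ` space \<nu>)"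
    using pos by (intro bdd_belowI[of _ 0]) (auto intro: less_imp_le)
  have bddb: "bdd_above ((\<lambda>s. 1 / lam_min (B s)) ` space \<nu>)"
  proof (rule bdd_aboveI)
    fix x assume "x \<in> (\<lambda>s. 1 / lam_min (B s)) ` space \<nu>"
    then obtain s where s: "s \<in> space \<nu>" "x = 1 / lam_min (B s)" by blast
    then show "x \<le> 1 / c" using lo[OF s(1)] c(1) by (simp add: frac_le)
  qed
  have ne: "(space \<nu>) \<noteq> {}" using s0 by blast
  have a0: "0 < a"
  proof -
    have "1 / C \<le> a" unfolding assms(7)
      using C pos by (intro cINF_greatest[OF ne]) (simp add: frac_le)
    then show ?thesis using Cpos by (meson divide_pos_pos less_le_trans zero_less_one)
  qed
  have as: "a \<le> 1 / lam_max (B s)" if "s \<in> space \<nu>" for s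
    unfolding assms(7) by (rule cINF_lower[OF bdda that])
  have bs: "1 / lam_min (B s) \<le> b" if "s \<in> space \<nu>" for s
    unfolding assms(8) by (rule cSUP_upper[OF that bddb])
  have b2: "b < 2"
  proof -
    have "b \<le> 1 / c" unfolding assms(8)
      using lo c(1) by (intro cSUP_least[OF ne]) (simp add: frac_le)
    also have "1 / c < 2" using c(1) by (simp add: field_simps)
    finally show ?thesis .
  qed
  have ab: "a \<le> b"
  proof -
    have "1 / lam_max (B s0) \<le> 1 / lam_min (B s0)" using mm[OF s0] pos[OF s0] by (simp add: frac_le)
    then show ?thesis using as[OF s0] bs[OF s0] by linarith
  qed
  have b0: "0 < b" using a0 ab by simp
  have pin: "pinched a b (B s)" if s: "s \<in> space \<nu>" for s
  proof (rule symmetric_pinched[OF sym[OF s] a0 b0])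
    show "1 / b \<le> lam_min (B s)" using bs[OF s] b0 pos[OF s] by (simp add: field_simps)
    show "lam_max (B s) \<le> 1 / a" using as[OF s] a0 pos[OF s] by (simp add: field_simps)
  qed
  interpret os_isrm \<nu> B \<sigma> P M a b
    by (rule os_isrm.intro[OF assms(1,3) pin a0 ab b2 assms(9,10)])
  have HH: "Hfun \<nu> B f l = H f l" if "0 < l" for f l
    using Hfun_eq_box_gauge[OF that] by (simp add: H_def)
  have NN: "Mnorm \<nu> B = N"
    unfolding Mnorm_def N_def by (intro ext arg_cong[where f = Inf]) (auto simp: HH)
  \<comment> \<open>the given bounds on the polar radius at a unit vector, where it equals 1\<close>
  have CC: "C3 \<le> 1" "1 \<le> C4"
  proof -
    have n: "norm (axis undefined 1 :: real^'m) = 1" by simp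
    have "tau (B s0) (axis undefined 1 :: real^'m) = 1" by (rule tau_unit[OF a0 b0 pin[OF s0] n])
    moreover have "C3 * min (norm (axis undefined 1 :: real^'m) powr a) (norm (axis undefined 1 :: real^'m) powr b)
          \<le> tau (B s0) (axis undefined 1) \<and>
        tau (B s0) (axis undefined 1) \<le> C4 * max (norm (axis undefined 1 :: real^'m) powr a) (norm (axis undefined 1 :: real^'m) powr b)"
      using assms(13) s0 by blast
    ultimately show "C3 \<le> 1" "1 \<le> C4" unfolding n by simp_all
  qed
  have V1: "V = {f \<in> borel_measurable \<nu>. \<forall>l>0. Hfun \<nu> B f l < \<infinity>}"
  proof (intro set_eqI iffI)
    fix f assume "f \<in> V"
    then show "f \<in> {f \<in> borel_measurable \<nu>. \<forall>l>0. Hfun \<nu> B f l < \<infinity>}"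
      using V_H_finite V_measurable by (simp add: HH)
  next
    fix f assume f: "f \<in> {f \<in> borel_measurable \<nu>. \<forall>l>0. Hfun \<nu> B f l < \<infinity>}"
    then have "Hfun \<nu> B f 1 < \<infinity>" using zero_less_one by blast
    then have "H f 1 < \<infinity>" using HH[of 1 f] by simp
    then show "f \<in> V" using f zero_less_one unfolding V_def by blast
  qed
  have V2: "V = {f \<in> borel_measurable \<nu>. \<exists>l>0. Hfun \<nu> B f l < \<infinity>}"
  proof (intro set_eqI iffI)
    fix f assume "f \<in> V"
    then obtain l where "f \<in> borel_measurable \<nu>" "l > 0" "H f l < \<infinity>" unfolding V_def by blast
    then show "f \<in> {f \<in> borel_measurable \<nu>. \<exists>l>0. Hfun \<nu> B f l < \<infinity>}"
      using HH[of l f] by auto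
  next
    fix f assume "f \<in> {f \<in> borel_measurable \<nu>. \<exists>l>0. Hfun \<nu> B f l < \<infinity>}"
    then obtain l where f: "f \<in> borel_measurable \<nu>" "l > 0" "Hfun \<nu> B f l < \<infinity>" by blast
    then have "H f l < \<infinity>" using HH[of l f] by simp
    then show "f \<in> V" using f unfolding V_def by blast
  qed
  have two_sided: "ennreal (C3 * min ((N f / l) powr a) ((N f / l) powr b)) \<le> Hfun \<nu> B f l \<and>
      Hfun \<nu> B f l \<le> ennreal (C4 * max ((N f / l) powr a) ((N f / l) powr b))" if f: "f \<in> V" and l: "l > 0" for f l
  proof
    have "C3 * min ((N f / l) powr a) ((N f / l) powr b) \<le> 1 * min ((N f / l) powr a) ((N f / l) powr b)"
      using CC by (intro mult_right_mono) simp_all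
    then have "ennreal (C3 * min ((N f / l) powr a) ((N f / l) powr b)) \<le> ennreal (min ((N f / l) powr a) ((N f / l) powr b))"
      by (intro ennreal_leI) simp
    then show "ennreal (C3 * min ((N f / l) powr a) ((N f / l) powr b)) \<le> Hfun \<nu> B f l"
      unfolding HH[OF l] using H_N_bounds(1)[OF f l] by (rule order_trans)
    have "1 * max ((N f / l) powr a) ((N f / l) powr b) \<le> C4 * max ((N f / l) powr a) ((N f / l) powr b)"
      using CC by (intro mult_right_mono) (simp_all add: le_max_iff_disj)
    then have "ennreal (max ((N f / l) powr a) ((N f / l) powr b)) \<le> ennreal (C4 * max ((N f / l) powr a) ((N f / l) powr b))"
      by (intro ennreal_leI) simp
    with H_N_bounds(2)[OF f l] show "Hfun \<nu> B f l \<le> ennreal (C4 * max ((N f / l) powr a) ((N f / l) powr b))"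
      unfolding HH[OF l] by (rule order_trans)
  qed
  have rep: "represents f (stoch_integral \<nu> P M f)" if "f \<in> V" for f
    using integrable_represents that unfolding integrable_fns_eq by blast
  have tail: "\<exists>L1\<ge>1. \<forall>f\<in>V. \<forall>\<delta>>0.
      ennreal (measure P {\<omega>\<in>space P. norm (stoch_integral \<nu> P M f \<omega>) \<ge> \<delta>}) \<le> ennreal L1 * Hfun \<nu> B f \<delta>"
  proof -
    obtain L where "L \<ge> 1" "\<And>f Y \<delta>. represents f Y \<Longrightarrow> \<delta> > 0 \<Longrightarrow>
        ennreal (prob {\<omega> \<in> space P. \<delta> \<le> norm (Y \<omega>)}) \<le> ennreal L * H f \<delta>"
      using represents_tail by blast
    then have "ennreal (prob {\<omega> \<in> space P. \<delta> \<le> norm (stoch_integral \<nu> P M f \<omega>)}) \<le> ennreal L * Hfun \<nu> B f \<delta>"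
      if "f \<in> V" "\<delta> > 0" for f \<delta>
      using rep[OF that(1)] that(2) by (simp add: HH)
    then show ?thesis using \<open>L \<ge> 1\<close> by blast
  qed
  have moments: "\<exists>L2>0. \<forall>f\<in>V. (\<integral>\<^sup>+ \<omega>. ennreal (norm (stoch_integral \<nu> P M f \<omega>) powr p) \<partial>P) \<le> ennreal (L2 * N f powr p)"
    if "0 < p" "p < a" for p
    using moment_bound[OF that] rep by blast
  have unit: "\<exists>l>0. Hfun \<nu> B f l \<le> 1" if "f \<in> V" for f
    using V_unit_level[OF that] HH by metis
  have iff: "conv_in_prob P (\<lambda>n. stoch_integral \<nu> P M (F n)) (stoch_integral \<nu> P M f)
      \<longleftrightarrow> (\<lambda>n. N (\<lambda>s. F n s - f s)) \<longlonglongrightarrow> 0" if "f \<in> V" "\<forall>n. F n \<in> V" for f F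
    using conv_in_prob_iff_N[unfolded integrable_fns_eq] that by blast
  have unit': "\<forall>f\<in>V. \<exists>l>0. Hfun \<nu> B f l \<le> 1" using unit by blast
  have two_sided': "\<forall>f\<in>V. \<forall>l>0.
      ennreal (C3 * min ((N f / l) powr a) ((N f / l) powr b)) \<le> Hfun \<nu> B f l \<and>
      Hfun \<nu> B f l \<le> ennreal (C4 * max ((N f / l) powr a) ((N f / l) powr b))" using two_sided by blast
  have moments': "\<forall>p. 0 < p \<and> p < a \<longrightarrow> (\<exists>L2>0. \<forall>f\<in>V.
      (\<integral>\<^sup>+ \<omega>. ennreal (norm (stoch_integral \<nu> P M f \<omega>) powr p) \<partial>P) \<le> ennreal (L2 * N f powr p))"
    using moments by blast
  have iff': "\<forall>f\<in>V. \<forall>F. (\<forall>n. F n \<in> V) \<longrightarrow>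
      (conv_in_prob P (\<lambda>n. stoch_integral \<nu> P M (F n)) (stoch_integral \<nu> P M f)
        \<longleftrightarrow> (\<lambda>n. N (\<lambda>s. F n s - f s)) \<longlonglongrightarrow> 0)" using iff by blast
  show ?thesis
    unfolding integrable_fns_eq NN
    by (intro conjI V1 V2 unit' quasi_norm_ae_N two_sided' tail moments' quasi_complete_N iff')
qed

end
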